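(* Let $P$ be a convex polyhedron. If $P$ has a Hamiltonian quasigeodesic $Q$, then there is an edge-unfolding of $P$ to a net.
   Context: A convex polyhedron here is the boundary surface of a convex polyhedron in $\mathbb{R}^3$; a doubly-covered convex polygon is also treated as a (degenerate) convex polyhedron. An edge-unfolding of $P$ is obtained by cutting the surface of $P$ along a set of edges of $P$ that forms a spanning tree of the vertices of $P$, and unfolding the resulting surface isometrically into the plane as a single connected piece. A net is an edge-unfolding whose planar image is a simple polygon, i.e., it has no self-overlap. A quasigeodesic on $P$ is a curve such that at every point the surface angle on each side of the curve is at most $\pi$ (geodesics have exactly $\pi$ on each side); quasigeodesics may pass through vertices and are geodesic segments between vertices. A Hamiltonian quasigeodesic is a simple closed quasigeodesic on $P$ that follows edges of $P$ (the 1-skeleton) and passes through every vertex of $P$; equivalently, a Hamiltonian circuit in the 1-skeleton of $P$ such that at every vertex the surface angle on each side of the circuit is at most $\pi$. *)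

theory Defs
  imports "HOL-Analysis.Analysis"
begin

text \<open>A convex polyhedron is given by the convex polytope P in R^3 whose boundary
  surface we consider.  Either P is 3-dimensional (its surface consists of its
  2-dimensional faces), or P is a convex polygon (aff_dim 2), in which case the
  surface is the doubly covered polygon, consisting of two copies (P,True) and
  (P,False) of P glued along the boundary edges.\<close>

definition convex_polyhedron :: "(real^3) set \<Rightarrow> bool" where
  "convex_polyhedron P \<longleftrightarrow> polytope P \<and> (aff_dim P = 3 \<or> aff_dim P = 2)"

definition poly_vertices :: "(real^3) set \<Rightarrow> (real^3) set" where
  "poly_vertices P = {v. v extreme_point_of P}"

definition poly_edges :: "(real^3) set \<Rightarrow> (real^3) set set" where
  "poly_edges P = {e. e face_of P \<and> aff_dim e = 1}"

text \<open>Faces of the surface (tagged so that the doubly covered polygon has two faces).\<close>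
definition surf_faces :: "(real^3) set \<Rightarrow> ((real^3) set \<times> bool) set" where
  "surf_faces P = (if aff_dim P = 3
      then {(F, True) | F. F face_of P \<and> aff_dim F = 2}
      else {(P, True), (P, False)})"

text \<open>Euclidean angle between two nonzero vectors.\<close>
definition vec_angle :: "real^3 \<Rightarrow> real^3 \<Rightarrow> real" where
  "vec_angle x y = arccos ((x \<bullet> y) / (norm x * norm y))"

text \<open>The surface angle of the convex polygon F at its vertex v: the angle between
  the two edges of F incident to v.\<close>
definition face_angle :: "(real^3) set \<Rightarrow> real^3 \<Rightarrow> real" where
  "face_angle F v = (SOME \<theta>. \<exists>a b. a \<noteq> b \<and> a \<noteq> v \<and> b \<noteq> v \<and>
      closed_segment v a face_of F \<and> closed_segment v b face_of F \<and>
      \<theta> = vec_angle (a - v) (b - v))"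

text \<open>Hamiltonian circuit in the 1-skeleton, given as a cyclic list of the vertices.\<close>
definition ham_circuit :: "(real^3) set \<Rightarrow> (real^3) list \<Rightarrow> bool" where
  "ham_circuit P vs \<longleftrightarrow> distinct vs \<and> set vs = poly_vertices P \<and> 3 \<le> length vs \<and>
     (\<forall>i < length vs. closed_segment (vs ! i) (vs ! ((i + 1) mod length vs)) \<in> poly_edges P)"

definition circuit_edges :: "(real^3) list \<Rightarrow> (real^3) set set" where
  "circuit_edges vs = {closed_segment (vs ! i) (vs ! ((i + 1) mod length vs)) | i. i < length vs}"

text \<open>Two surface faces at vertex v are on the same side of the circuit at v iff they
  are connected around v through edges incident to v that are not on the circuit.\<close>
definition side_adj :: "(real^3) set \<Rightarrow> (real^3) list \<Rightarrow> real^3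
     \<Rightarrow> (((real^3) set \<times> bool) \<times> ((real^3) set \<times> bool)) set" where
  "side_adj P vs v = {(\<phi>, \<psi>). \<phi> \<in> surf_faces P \<and> \<psi> \<in> surf_faces P \<and> \<phi> \<noteq> \<psi> \<and>
      (\<exists>e \<in> poly_edges P. v \<in> e \<and> e \<notin> circuit_edges vs \<and> e \<subseteq> fst \<phi> \<and> e \<subseteq> fst \<psi>)}"

text \<open>Surface angle at v on the side of the circuit containing face phi.\<close>
definition side_angle :: "(real^3) set \<Rightarrow> (real^3) list \<Rightarrow> real^3 \<Rightarrow> ((real^3) set \<times> bool) \<Rightarrow> real" where
  "side_angle P vs v \<phi> = (\<Sum>\<psi> \<in> {\<psi> \<in> surf_faces P. v \<in> fst \<psi> \<and> (\<phi>, \<psi>) \<in> (side_adj P vs v)\<^sup>*}.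
      face_angle (fst \<psi>) v)"

definition hamiltonian_quasigeodesic :: "(real^3) set \<Rightarrow> (real^3) list \<Rightarrow> bool" where
  "hamiltonian_quasigeodesic P vs \<longleftrightarrow> ham_circuit P vs \<and>
     (\<forall>v \<in> poly_vertices P. \<forall>\<phi> \<in> surf_faces P. v \<in> fst \<phi> \<longrightarrow> side_angle P vs v \<phi> \<le> pi)"

text \<open>Spanning trees of the 1-skeleton (connected and acyclic, covering all vertices).\<close>
definition tree_link :: "(real^3) set set \<Rightarrow> ((real^3) \<times> (real^3)) set" where
  "tree_link T = {(a, b). closed_segment a b \<in> T}"

definition spanning_tree :: "(real^3) set \<Rightarrow> (real^3) set set \<Rightarrow> bool" where
  "spanning_tree P T \<longleftrightarrow> T \<subseteq> poly_edges P \<and>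
     (\<forall>u \<in> poly_vertices P. \<forall>v \<in> poly_vertices P. (u, v) \<in> (tree_link T)\<^sup>*) \<and>
     \<not> (\<exists>cs. distinct cs \<and> 3 \<le> length cs \<and>
          (\<forall>i < length cs. closed_segment (cs ! i) (cs ! ((i + 1) mod length cs)) \<in> T))"

text \<open>Faces adjacent across an uncut edge (not in T) containing the point x.\<close>
definition uncut_adj :: "(real^3) set \<Rightarrow> (real^3) set set \<Rightarrow> (real^3) set
     \<Rightarrow> (((real^3) set \<times> bool) \<times> ((real^3) set \<times> bool)) set" where
  "uncut_adj P T X = {(\<phi>, \<psi>). \<phi> \<in> surf_faces P \<and> \<psi> \<in> surf_faces P \<and> \<phi> \<noteq> \<psi> \<and>
      (\<exists>e \<in> poly_edges P - T. X \<subseteq> e \<and> e \<subseteq> fst \<phi> \<and> e \<subseteq> fst \<psi>)}"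

text \<open>Edge-unfolding: cutting along the spanning tree T, each surface face phi is placed
  isometrically in the plane by g phi; faces sharing an uncut edge are glued along it
  (agreeing there) and lie on opposite sides of it; the result is one connected piece.\<close>
definition edge_unfolding :: "(real^3) set \<Rightarrow> (real^3) set set
     \<Rightarrow> (((real^3) set \<times> bool) \<Rightarrow> (real^3) \<Rightarrow> (real^2)) \<Rightarrow> bool" where
  "edge_unfolding P T g \<longleftrightarrow> spanning_tree P T \<and>
     (\<forall>\<phi> \<in> surf_faces P. \<forall>x \<in> fst \<phi>. \<forall>y \<in> fst \<phi>. dist (g \<phi> x) (g \<phi> y) = dist x y) \<and>
     (\<forall>e \<in> poly_edges P - T. \<forall>\<phi> \<in> surf_faces P. \<forall>\<psi> \<in> surf_faces P.
        \<phi> \<noteq> \<psi> \<and> e \<subseteq> fst \<phi> \<and> e \<subseteq> fst \<psi> \<longrightarrow>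
          (\<forall>x \<in> e. g \<phi> x = g \<psi> x) \<and>
          interior (g \<phi> ` fst \<phi>) \<inter> interior (g \<psi> ` fst \<psi>) = {}) \<and>
     (\<forall>\<phi> \<in> surf_faces P. \<forall>\<psi> \<in> surf_faces P. (\<phi>, \<psi>) \<in> (uncut_adj P T {})\<^sup>*)"

text \<open>A net: the unfolding is non-overlapping, i.e. injective on the cut surface. Two
  points x of face phi and y of face psi are the same point of the cut surface iff
  x = y and phi, psi are connected around x through uncut edges containing x.\<close>
definition is_net :: "(real^3) set \<Rightarrow> (real^3) set set
     \<Rightarrow> (((real^3) set \<times> bool) \<Rightarrow> (real^3) \<Rightarrow> (real^2)) \<Rightarrow> bool" where
  "is_net P T g \<longleftrightarrow> edge_unfolding P T g \<and>
     (\<forall>\<phi> \<in> surf_faces P. \<forall>\<psi> \<in> surf_faces P. \<forall>x \<in> fst \<phi>. \<forall>y \<in> fst \<psi>.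
        g \<phi> x = g \<psi> y \<longrightarrow> x = y \<and> (\<phi>, \<psi>) \<in> (uncut_adj P T {x})\<^sup>*)"

end

theory Submission
  imports Defs
begin

text \<open>The circuit Q splits the surface into two sides without interior vertices, so that the dual tree of each side can be
  built up face by face.  Attaching a face along an edge keeps the development convex, because at both ends of that edge the angles on
  this side of Q sum up to at most pi: the two pieces share a supporting line there.  Hence both sides
  develop to convex polygons, with all edges of Q on their boundaries.  Cutting all edges of Q but one, the two polygons are
  placed on opposite sides of the line through the remaining edge.  They could only meet outside that edge
  if both had a straight angle at one of its ends, which is impossible since the total angle at a vertex is less than 2 pi.

  The two global facts about the surface are obtained from vertex links by linear programming: at every vertex v the
  edges below v are connected through faces.  This gives the connectedness of the dual graph off the cut, and, sweeping the
  vertices by height, the vanishing of the first cohomology modulo 2, hence its acyclicity.\<close>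

section \<open>Angles\<close>

text \<open>No Jordan curve theorem enters: that Q has two sides, each of them a tree of faces, is
  read off from parities. A simple cycle of faces off the cut crosses a set \<open>C\<close> of
  uncut edges with an even number of edges in every face. Such a \<open>C\<close> is a cocycle
  modulo 2, hence consists of the edges between two classes of vertices; but the cut tree joins all
  vertices without using \<open>C\<close>, so there is only one class and \<open>C\<close> is empty.
  This statement, the assumption \<open>acyclic\<close> of \<open>slit_surface\<close>, keeps a new
  face from touching the developed part along two edges, and puts the two faces at the remaining
  edge on different sides. Convexity alone is too weak an induction hypothesis. At each corner of
  the development the angle between the two bounding edges must be known to equal the sum of the
  face angles there; only then does the bound pi of the quasigeodesic turn into supporting lines.
  The doubly covered polygon, all of whose edges lie on Q, satisfies the same locale, so that both
  kinds of polyhedra share the geometric part.\<close>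

definition ang :: "'a::real_inner \<Rightarrow> 'a \<Rightarrow> real" where
  "ang x y = arccos ((x \<bullet> y) / (norm x * norm y))"

lemma ang_arg_bounds:
  "-1 \<le> (x \<bullet> y) / (norm x * norm y)" "(x \<bullet> y) / (norm x * norm y) \<le> 1"
proof -
  have "\<bar>(x \<bullet> y) / (norm x * norm y)\<bar> \<le> 1"
    using Cauchy_Schwarz_ineq2[of x y]
    by (cases "norm x * norm y = 0") (auto simp: divide_le_eq abs_mult)
  then show "-1 \<le> (x \<bullet> y) / (norm x * norm y)" "(x \<bullet> y) / (norm x * norm y) \<le> 1"
    by linarith+
qed

lemma ang_ge_0: "0 \<le> ang x y" and ang_le_pi: "ang x y \<le> pi"
  unfolding ang_def using arccos_bounded[OF ang_arg_bounds] by auto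

lemma ang_commute: "ang x y = ang y x"
  unfolding ang_def by (simp add: inner_commute mult.commute)

lemma inner_eq_cos_ang: "x \<bullet> y = norm x * norm y * cos (ang x y)"
proof (cases "x = 0 \<or> y = 0")
  case False
  then show ?thesis unfolding ang_def by (subst cos_arccos[OF ang_arg_bounds]) auto
qed auto

lemma sin_ang_ge_0: "0 \<le> sin (ang x y)"
  using ang_ge_0 ang_le_pi sin_ge_zero by blast

text \<open>Lagrange's identity: the left side is the squared area of a parallelogram, the right
  side its Gram determinant. Together with \<open>sin_ang_ge_0\<close> it yields sines from inner
  products by comparing squares, in any dimension.\<close>

lemma sin_ang_squared:
  "(norm x * norm y * sin (ang x y))\<^sup>2 = (x \<bullet> x) * (y \<bullet> y) - (x \<bullet> y)\<^sup>2"
proof -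
  have "(norm x * norm y * sin (ang x y))\<^sup>2 = (norm x * norm y)\<^sup>2 * (1 - (cos (ang x y))\<^sup>2)"
    by (simp add: power_mult_distrib sin_squared_eq)
  also have "\<dots> = (norm x * norm y)\<^sup>2 - (x \<bullet> y)\<^sup>2"
    by (subst inner_eq_cos_ang[of x y]) (simp add: algebra_simps power_mult_distrib)
  finally show ?thesis by (simp add: power_mult_distrib power2_norm_eq_inner)
qed

lemma ang_unique:
  assumes "x \<noteq> 0" "y \<noteq> 0" "0 \<le> t" "t \<le> pi" "x \<bullet> y = norm x * norm y * cos t"
  shows "ang x y = t"
  unfolding ang_def using assms by (simp add: arccos_cos)

lemma ang_scale_left: "0 < c \<Longrightarrow> ang (c *\<^sub>R x) y = ang x y"
  unfolding ang_def by (cases "x = 0") auto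

lemma ang_scale_right: "0 < c \<Longrightarrow> ang x (c *\<^sub>R y) = ang x y"
  using ang_scale_left ang_commute by metis

lemma ang_self: "x \<noteq> 0 \<Longrightarrow> ang x x = 0"
  by (rule ang_unique) (auto simp: norm_eq_sqrt_inner)

lemma ang_minus_self: "x \<noteq> 0 \<Longrightarrow> ang x (- x) = pi"
  by (rule ang_unique) (auto simp: norm_eq_sqrt_inner)

lemma ang_minus_right:
  assumes "x \<noteq> 0" "y \<noteq> 0" shows "ang x (- y) = pi - ang x y"
  by (rule ang_unique) (use assms ang_ge_0 ang_le_pi in \<open>auto simp: inner_eq_cos_ang[of x y] cos_diff\<close>)

lemma ang_eq_0D:
  assumes "ang x y = 0" shows "norm y *\<^sub>R x = norm x *\<^sub>R y"
  using inner_eq_cos_ang[of x y] assms by (simp add: norm_cauchy_schwarz_eq)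

lemma ang_eq_piD:
  assumes "ang x y = pi" shows "norm y *\<^sub>R x = - (norm x *\<^sub>R y)"
proof -
  have "x \<bullet> (- y) = norm x * norm (- y)" using inner_eq_cos_ang[of x y] assms by simp
  then show ?thesis by (simp only: norm_cauchy_schwarz_eq) auto
qed

lemma ang_strict_bounds:
  assumes "\<And>a b. a *\<^sub>R x + b *\<^sub>R y = 0 \<Longrightarrow> a = 0 \<and> b = 0"
  shows "0 < ang x y" "ang x y < pi"
proof -
  have nz: "x \<noteq> 0" "y \<noteq> 0" using assms[of 1 0] assms[of 0 1] by auto
  have "ang x y \<noteq> 0" using ang_eq_0D[of x y] assms[of "norm y" "- norm x"] nz by auto
  then show "0 < ang x y" using ang_ge_0[of x y] by linarith
  have "ang x y \<noteq> pi" using ang_eq_piD[of x y] assms[of "norm y" "norm x"] nz by auto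
  then show "ang x y < pi" using ang_le_pi[of x y] by linarith
qed

text \<open>Both partial areas are multiples of the area \<open>G\<close> spanned by x and z, with
  the factors b and a; cosine and sine of the sum of the angles then follow by algebra. The cosine
  determines the sum only up to reflection, hence the separate bound by pi.\<close>

lemma ang_add:
  assumes y: "y = a *\<^sub>R x + b *\<^sub>R z" and ab: "0 \<le> a" "0 \<le> b" and nz: "x \<noteq> 0" "y \<noteq> 0" "z \<noteq> 0"
  shows "ang x z = ang x y + ang y z"
proof -
  define G where "G = norm x * norm z * sin (ang x z)"
  have G0: "0 \<le> G" unfolding G_def by (simp add: sin_ang_ge_0)
  have G2: "G\<^sup>2 = (x \<bullet> x) * (z \<bullet> z) - (x \<bullet> z)\<^sup>2" unfolding G_def by (rule sin_ang_squared)
  have yy: "y \<bullet> y = a * a * (x \<bullet> x) + 2 * a * b * (x \<bullet> z) + b * b * (z \<bullet> z)"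
    unfolding y by (simp add: inner_add_left inner_add_right inner_commute algebra_simps)
  have xy: "x \<bullet> y = a * (x \<bullet> x) + b * (x \<bullet> z)" and yz: "y \<bullet> z = a * (x \<bullet> z) + b * (z \<bullet> z)"
    unfolding y by (simp_all add: inner_add_left inner_add_right)
  have s1: "norm x * norm y * sin (ang x y) = b * G"
  proof (rule power2_eq_imp_eq)
    show "(norm x * norm y * sin (ang x y))\<^sup>2 = (b * G)\<^sup>2"
      unfolding sin_ang_squared power_mult_distrib[of b G] G2 yy xy
      by (simp add: power2_eq_square algebra_simps)
  qed (use ab G0 in \<open>auto simp: sin_ang_ge_0\<close>)
  have s2: "norm y * norm z * sin (ang y z) = a * G"
  proof (rule power2_eq_imp_eq)
    show "(norm y * norm z * sin (ang y z))\<^sup>2 = (a * G)\<^sup>2"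
      unfolding sin_ang_squared power_mult_distrib[of a G] G2 yy yz
      by (simp add: power2_eq_square algebra_simps)
  qed (use ab G0 in \<open>auto simp: sin_ang_ge_0\<close>)
  let ?N = "norm x * norm y * (norm y * norm z)"
  have N: "?N > 0" using nz by simp
  have "?N * cos (ang x y + ang y z) =
      (norm x * norm y * cos (ang x y)) * (norm y * norm z * cos (ang y z))
      - (norm x * norm y * sin (ang x y)) * (norm y * norm z * sin (ang y z))"
    by (simp add: cos_add algebra_simps)
  also have "\<dots> = (x \<bullet> y) * (y \<bullet> z) - (b * G) * (a * G)"
    by (simp add: s1 s2 inner_eq_cos_ang[symmetric])
  also have "(b * G) * (a * G) = a * b * G\<^sup>2" by (simp add: power2_eq_square)
  also have "(x \<bullet> y) * (y \<bullet> z) - a * b * G\<^sup>2 = (x \<bullet> z) * (y \<bullet> y)"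
    unfolding G2 xy yz yy by (simp add: power2_eq_square algebra_simps)
  also have "\<dots> = (x \<bullet> z) * (norm y * norm y)" by (simp add: dot_square_norm power2_eq_square)
  finally have c: "x \<bullet> z = norm x * norm z * cos (ang x y + ang y z)"
    using nz by (simp add: field_simps)
  have "?N * sin (ang x y + ang y z) =
      (norm x * norm y * sin (ang x y)) * (norm y * norm z * cos (ang y z))
      + (norm x * norm y * cos (ang x y)) * (norm y * norm z * sin (ang y z))"
    by (simp add: sin_add algebra_simps)
  also have "\<dots> = (b * G) * (y \<bullet> z) + (x \<bullet> y) * (a * G)"
    by (simp add: s1 s2 inner_eq_cos_ang[symmetric])
  also have "\<dots> = G * (y \<bullet> y)"
    unfolding xy yz yy by (simp add: algebra_simps)
  finally have "0 \<le> ?N * sin (ang x y + ang y z)" using G0 by simp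
  then have s: "0 \<le> sin (ang x y + ang y z)" using N by (simp add: zero_le_mult_iff)
  \<comment> \<open>A nonnegative sine leaves only the value 2 pi beyond pi; there y would be
    opposite to both x and z, although it lies in their cone.\<close>
  have "ang x y + ang y z \<le> pi"
  proof (rule ccontr)
    assume "\<not> ?thesis"
    then have gt: "ang x y + ang y z > pi" by simp
    have "ang x y + ang y z = 2 * pi"
    proof (rule ccontr)
      assume "ang x y + ang y z \<noteq> 2 * pi"
      then have "ang x y + ang y z < 2 * pi" using ang_le_pi[of x y] ang_le_pi[of y z] by linarith
      then have "sin (ang x y + ang y z) < 0" using gt sin_lt_zero by blast
      with s show False by simp
    qed
    then have "ang x y = pi" "ang y z = pi" using ang_le_pi[of x y] ang_le_pi[of y z] by linarith+
    then have "x \<bullet> y < 0" "y \<bullet> z < 0" using inner_eq_cos_ang[of x y] inner_eq_cos_ang[of y z] nz by auto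
    then have "a * (x \<bullet> y) + b * (y \<bullet> z) \<le> 0" using ab by (simp add: mult_nonneg_nonpos add_nonpos_nonpos)
    moreover have "a * (x \<bullet> y) + b * (y \<bullet> z) = y \<bullet> y" unfolding xy yz yy by (simp add: algebra_simps)
    moreover have "y \<bullet> y > 0" using nz by simp
    ultimately show False by linarith
  qed
  then show ?thesis using ang_unique[OF nz(1,3) _ _ c] ang_ge_0[of x y] ang_ge_0[of y z] by simp
qed

text \<open>The vectors \<open>p\<close> and \<open>q\<close> are multiples of the parts of x and z
  orthogonal to y. If the inequality failed, \<open>p \<bullet> q\<close> would reach its
  Cauchy-Schwarz minimum, so that \<open>p\<close> and \<open>q\<close> would be opposite: a linear
  relation between x, y and z.\<close>

lemma ang_triangle_strict:
  fixes x y z :: "'a::real_inner"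
  assumes ind: "\<And>a b c. a *\<^sub>R x + b *\<^sub>R y + c *\<^sub>R z = 0 \<Longrightarrow> a = 0 \<and> b = 0 \<and> c = 0"
  shows "ang x z < ang x y + ang y z"
proof (rule ccontr)
  assume "\<not> ?thesis"
  then have le: "ang x y + ang y z \<le> ang x z" by simp
  have nz: "x \<noteq> 0" "y \<noteq> 0" "z \<noteq> 0" using ind[of 1 0 0] ind[of 0 1 0] ind[of 0 0 1] by auto
  have "cos (ang x z) \<le> cos (ang x y + ang y z)"
    using le ang_ge_0[of x y] ang_ge_0[of y z] ang_le_pi[of x z] by (simp add: cos_mono_le_eq)
  then have "norm x * norm z * (norm y)\<^sup>2 * cos (ang x z) \<le> norm x * norm z * (norm y)\<^sup>2 * cos (ang x y + ang y z)"
    by (intro mult_left_mono) auto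
  then have "(x \<bullet> z) * (y \<bullet> y) \<le> (norm x * norm y * cos (ang x y)) * (norm y * norm z * cos (ang y z))
      - (norm x * norm y * sin (ang x y)) * (norm y * norm z * sin (ang y z))"
    by (simp add: cos_add inner_eq_cos_ang[of x z] dot_square_norm power2_eq_square algebra_simps)
  then have 1: "(x \<bullet> z) * (y \<bullet> y) - (x \<bullet> y) * (y \<bullet> z)
      \<le> - (norm x * norm y * sin (ang x y)) * (norm y * norm z * sin (ang y z))"
    by (simp add: inner_eq_cos_ang[symmetric])
  define p where "p = (y \<bullet> y) *\<^sub>R x - (x \<bullet> y) *\<^sub>R y"
  define q where "q = (y \<bullet> y) *\<^sub>R z - (y \<bullet> z) *\<^sub>R y"
  have npq: "norm p = norm y * (norm x * norm y * sin (ang x y))"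
  proof (rule power2_eq_imp_eq)
    show "(norm p)\<^sup>2 = (norm y * (norm x * norm y * sin (ang x y)))\<^sup>2"
      unfolding power_mult_distrib[of "norm y"] sin_ang_squared power2_norm_eq_inner p_def
      by (simp add: inner_diff_left inner_diff_right inner_commute power2_eq_square algebra_simps)
  qed (auto simp: sin_ang_ge_0)
  have nq: "norm q = norm y * (norm y * norm z * sin (ang y z))"
  proof (rule power2_eq_imp_eq)
    show "(norm q)\<^sup>2 = (norm y * (norm y * norm z * sin (ang y z)))\<^sup>2"
      unfolding power_mult_distrib[of "norm y"] sin_ang_squared power2_norm_eq_inner q_def
      by (simp add: inner_diff_left inner_diff_right inner_commute power2_eq_square algebra_simps)
  qed (auto simp: sin_ang_ge_0)
  have "p \<bullet> q = (y \<bullet> y) * ((x \<bullet> z) * (y \<bullet> y) - (x \<bullet> y) * (y \<bullet> z))"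
    unfolding p_def q_def
    by (simp add: inner_diff_left inner_diff_right inner_commute power2_eq_square algebra_simps)
  also have "\<dots> \<le> (y \<bullet> y) * (- (norm x * norm y * sin (ang x y)) * (norm y * norm z * sin (ang y z)))"
    by (rule mult_left_mono[OF 1]) simp
  also have "\<dots> = - (norm p * norm q)"
    unfolding npq nq by (simp add: dot_square_norm power2_eq_square algebra_simps)
  finally have "p \<bullet> q \<le> - (norm p * norm q)" .
  moreover have "- (norm p * norm q) \<le> p \<bullet> q" using norm_cauchy_schwarz[of p "- q"] by simp
  ultimately have "p \<bullet> (- q) = norm p * norm (- q)" by simp
  then have "norm (- q) *\<^sub>R p = norm p *\<^sub>R (- q)" using norm_cauchy_schwarz_eq by metis
  then have "norm q *\<^sub>R p + norm p *\<^sub>R q = 0" by simp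
  then have "(norm q * (y \<bullet> y)) *\<^sub>R x + (- norm q * (x \<bullet> y) - norm p * (y \<bullet> z)) *\<^sub>R y
      + (norm p * (y \<bullet> y)) *\<^sub>R z = 0"
    unfolding p_def[of] q_def[of]
    by (simp add: algebra_simps scaleR_left_diff_distrib)
  from ind[OF this] have "norm p * (y \<bullet> y) = 0" by blast
  then have "p = 0" using nz by simp
  then have "(y \<bullet> y) *\<^sub>R x + (- (x \<bullet> y)) *\<^sub>R y + 0 *\<^sub>R z = 0" unfolding p_def by simp
  from ind[OF this] show False using nz by simp
qed

section \<open>Orthonormal frames and polar coordinates in the plane\<close>

lemma decomp_real2:
  fixes a d z :: "real^2"
  assumes "norm a = 1" "norm d = 1" "a \<bullet> d = 0"
  shows "z = (z \<bullet> a) *\<^sub>R a + (z \<bullet> d) *\<^sub>R d"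
proof -
  have ind: "independent {a, d}"
    using assms by (intro pairwise_orthogonal_independent) (auto simp: pairwise_def orthogonal_def inner_commute)
  have ne: "a \<noteq> d" using assms by (auto simp: norm_eq_1)
  then have "card {a, d} = DIM(real^2)" by simp
  then have "UNIV \<subseteq> span {a, d}" using ind by (intro card_ge_dim_independent) (auto simp: dim_UNIV)
  then obtain s t where z: "z = s *\<^sub>R a + t *\<^sub>R d"
    by (auto simp: span_insert span_singleton algebra_simps set_eq_iff subset_iff) (metis add.commute diff_add_cancel)
  have "z \<bullet> a = s" "z \<bullet> d = t" using assms unfolding z
    by (simp_all add: inner_add_left inner_add_right norm_eq_1 inner_commute)
  then show ?thesis using z by simp
qed

lemma polar_real2:
  fixes a d b :: "real^2"
  assumes "norm a = 1" "norm d = 1" "a \<bullet> d = 0" "0 \<le> b \<bullet> d"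
  shows "b = (norm b * cos (ang a b)) *\<^sub>R a + (norm b * sin (ang a b)) *\<^sub>R d"
proof -
  have ba: "b \<bullet> a = norm b * cos (ang a b)" using inner_eq_cos_ang[of a b] assms by (simp add: inner_commute)
  have b: "b = (b \<bullet> a) *\<^sub>R a + (b \<bullet> d) *\<^sub>R d" using decomp_real2 assms by blast
  have "b \<bullet> d = norm a * norm b * sin (ang a b)"
  proof (rule power2_eq_imp_eq)
    have "((b \<bullet> a) *\<^sub>R a + (b \<bullet> d) *\<^sub>R d) \<bullet> b = (b \<bullet> a)\<^sup>2 + (b \<bullet> d)\<^sup>2"
      by (simp add: inner_add_left inner_add_right power2_eq_square inner_commute)
    then have "b \<bullet> b = (b \<bullet> a)\<^sup>2 + (b \<bullet> d)\<^sup>2" using b by simp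
    then show "(b \<bullet> d)\<^sup>2 = (norm a * norm b * sin (ang a b))\<^sup>2"
      unfolding sin_ang_squared using assms by (simp add: norm_eq_1 inner_commute)
  qed (use assms in \<open>auto simp: sin_ang_ge_0\<close>)
  then show ?thesis using b ba assms by simp
qed

text \<open>Unlike in \<open>ang_add\<close>, it is not known that a lies in the cone of b and c,
  only that they lie on different sides of its line. The bound pi ensures that the way from b to c
  through a is not the longer one.\<close>

lemma ang_add_opposite_sides:
  fixes a d b c :: "real^2"
  assumes "norm a = 1" "norm d = 1" "a \<bullet> d = 0" "0 \<le> c \<bullet> d" "b \<bullet> d \<le> 0" "b \<noteq> 0" "c \<noteq> 0"
    and le: "ang a b + ang a c \<le> pi"
  shows "ang b c = ang a b + ang a c"
proof (rule ang_unique)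
  have c: "c = (norm c * cos (ang a c)) *\<^sub>R a + (norm c * sin (ang a c)) *\<^sub>R d"
    using polar_real2[of a d c] assms by auto
  have b: "b = (norm b * cos (ang a b)) *\<^sub>R a + (norm b * sin (ang a b)) *\<^sub>R (- d)"
    using polar_real2[of a "- d" b] assms by auto
  have aa: "a \<bullet> a = 1" "d \<bullet> d = 1" "d \<bullet> a = 0" using assms by (auto simp: norm_eq_1 inner_commute)
  have "b \<bullet> c = ((norm b * cos (ang a b)) *\<^sub>R a + (norm b * sin (ang a b)) *\<^sub>R (- d)) \<bullet>
      ((norm c * cos (ang a c)) *\<^sub>R a + (norm c * sin (ang a c)) *\<^sub>R d)"
    using b c by metis
  also have "\<dots> = norm b * norm c * cos (ang a b + ang a c)"
    using assms(3) aa by (simp add: inner_add_left inner_add_right inner_diff_left cos_add algebra_simps)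
  finally show "b \<bullet> c = norm b * norm c * cos (ang a b + ang a c)" .
qed (use assms in \<open>auto simp: ang_ge_0\<close>)

section \<open>Ridges, edges and corners of polytopes\<close>

lemma vec_angle_eq_ang: "vec_angle x y = ang x y"
  by (simp add: vec_angle_def ang_def)

lemma span_pairE:
  assumes "w \<in> span {b, c}"
  obtains s t where "w = s *\<^sub>R b + t *\<^sub>R c"
proof -
  obtain s where "w - s *\<^sub>R b \<in> span {c}" using assms by (auto simp: span_breakdown_eq)
  then obtain t where "w - s *\<^sub>R b = t *\<^sub>R c" by (auto simp: span_singleton)
  then have "w = s *\<^sub>R b + t *\<^sub>R c" by (simp add: diff_eq_eq add.commute)
  then show ?thesis using that by blast
qed

section \<open>Faces of polytopes obtained from linear programs\<close>

lemma polytope_le_from_extreme: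
  fixes P :: "'a::euclidean_space set"
  assumes "polytope P" "\<And>x. x extreme_point_of P \<Longrightarrow> a \<bullet> x \<le> c" "p \<in> P"
  shows "a \<bullet> p \<le> c"
proof -
  have "P = convex hull {x. x extreme_point_of P}"
    by (rule Krein_Milman_Minkowski) (use assms polytope_imp_compact polytope_imp_convex in auto)
  also have "\<dots> \<subseteq> {x. a \<bullet> x \<le> c}"
    by (rule hull_minimal) (use assms convex_halfspace_le in auto)
  finally show ?thesis using assms by auto
qed

lemma finite_extreme_points:
  fixes P :: "'a::euclidean_space set"
  shows "polytope P \<Longrightarrow> finite {x. x extreme_point_of P}"
  by (simp add: finite_polyhedron_extreme_points polytope_imp_polyhedron)

lemma polytope_extreme_point_notin_face:
  fixes P :: "'a::euclidean_space set"
  assumes "polytope P" "G face_of P" "G \<noteq> P"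
  obtains x where "x extreme_point_of P" "x \<notin> G"
proof (rule ccontr)
  assume "\<not> thesis"
  then have "{x. x extreme_point_of P} \<subseteq> G" using that by auto
  moreover have "P = convex hull {x. x extreme_point_of P}"
    by (rule Krein_Milman_Minkowski) (use assms polytope_imp_compact polytope_imp_convex in auto)
  ultimately have "P \<subseteq> G" using hull_minimal[of _ G convex] face_of_imp_convex assms by metis
  then show False using assms face_of_imp_subset by auto
qed

text \<open>The linear program behind the ridge theorem: minimising the ratio of y to a, where a
  vanishes exactly on G, produces a face strictly between G and P.\<close>
lemma ridge_facet_aux:
  fixes P :: "'a::euclidean_space set"
  assumes P: "polytope P" and G: "G face_of P" "u \<in> G" "aff_dim G = aff_dim P - 2"
    and a: "\<And>x. x \<in> P \<Longrightarrow> 0 \<le> a \<bullet> (x - u)" "\<And>x. x \<in> P \<Longrightarrow> a \<bullet> (x - u) = 0 \<longleftrightarrow> x \<in> G"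
    and y: "\<And>x. x \<in> G \<Longrightarrow> y \<bullet> (x - u) = 0"
    and npr: "\<And>c. \<not> (\<forall>x\<in>P. y \<bullet> (x - u) = c * (a \<bullet> (x - u)))"
  obtains m F where "F = {x \<in> P. y \<bullet> (x - u) = m * (a \<bullet> (x - u))}"
    "\<And>x. x \<in> P \<Longrightarrow> m * (a \<bullet> (x - u)) \<le> y \<bullet> (x - u)"
    "F face_of P" "G \<subseteq> F" "aff_dim F = aff_dim P - 1"
proof -
  have GP: "G \<subseteq> P" "G \<noteq> P" using G face_of_imp_subset by auto
  define V where "V = {x. x extreme_point_of P} - G"
  obtain z where "z extreme_point_of P" "z \<notin> G" using polytope_extreme_point_notin_face[OF P G(1) GP(2)] .
  then have "z \<in> V" unfolding V_def by simp
  then have V: "finite V" "V \<noteq> {}" unfolding V_def using finite_extreme_points[OF P] by auto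
  have VP: "V \<subseteq> P" unfolding V_def by (auto simp: extreme_point_of_def)
  define r where "r x = (y \<bullet> (x - u)) / (a \<bullet> (x - u))" for x
  define m where "m = Min (r ` V)"
  have apos: "a \<bullet> (x - u) > 0" if "x \<in> V" for x 
    using a(1)[of x] a(2)[of x] VP that unfolding V_def by force
  have "m \<in> r ` V" unfolding m_def using V by (intro Min_in) auto
  then obtain v where v: "v \<in> V" "r v = m" by auto
  have "m \<le> r x" if "x \<in> V" for x unfolding m_def using V that by simp
  then have mV: "m * (a \<bullet> (x - u)) \<le> y \<bullet> (x - u)" if "x \<in> V" for x
    using that apos unfolding r_def by (simp add: pos_le_divide_eq)
  have ge: "m * (a \<bullet> (x - u)) \<le> y \<bullet> (x - u)" if "x \<in> P" for x
  proof -
    have "(m *\<^sub>R a - y) \<bullet> x \<le> (m *\<^sub>R a - y) \<bullet> u"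
    proof (rule polytope_le_from_extreme[OF P _ that])
      fix z assume z: "z extreme_point_of P"
      then have "z \<in> P" by (simp add: extreme_point_of_def)
      show "(m *\<^sub>R a - y) \<bullet> z \<le> (m *\<^sub>R a - y) \<bullet> u"
      proof (cases "z \<in> G")
        case True
        then show ?thesis using a(2)[OF \<open>z \<in> P\<close>] y[OF True] by (simp add: algebra_simps)
      next
        case False
        then show ?thesis using mV[of z] z unfolding V_def by (simp add: algebra_simps)
      qed
    qed
    then show ?thesis by (simp add: algebra_simps)
  qed
  define F where "F = {x \<in> P. y \<bullet> (x - u) = m * (a \<bullet> (x - u))}"
  have "F = P \<inter> {x. (y - m *\<^sub>R a) \<bullet> x = (y - m *\<^sub>R a) \<bullet> u}"
    unfolding F_def by (auto simp: algebra_simps)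
  also have "\<dots> face_of P"
    by (rule face_of_Int_supporting_hyperplane_ge)
      (use ge P polytope_imp_convex in \<open>auto simp: algebra_simps\<close>)
  finally have Ff: "F face_of P" .
  have GF: "G \<subseteq> F" unfolding F_def using GP a(2) y by auto
  have "v \<in> F" unfolding F_def using v apos[of v] VP unfolding r_def by (auto simp: field_simps)
  then have "G \<noteq> F" using v unfolding V_def by auto
  have "F \<noteq> P" using npr[of m] unfolding F_def by auto
  have "aff_dim F < aff_dim P"
    by (rule face_of_aff_dim_lt) (use Ff \<open>F \<noteq> P\<close> P polytope_imp_convex in auto)
  moreover have "aff_dim G < aff_dim F"
  proof (rule face_of_aff_dim_lt)
    show "convex F" using Ff face_of_imp_convex by blast
    show "G face_of F" using face_of_subset[OF G(1) GF] Ff face_of_imp_subset by blast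
    show "G \<noteq> F" by fact
  qed
  ultimately have "aff_dim F = aff_dim P - 1" using G by simp
  then show ?thesis using that F_def ge Ff GF by blast
qed

lemma subspace_dim2_basis:
  fixes W :: "'a::euclidean_space set"
  assumes "subspace W" "dim W = 2"
  obtains b c where "b \<in> W" "c \<in> W" "norm b = 1" "norm c = 1" "b \<bullet> c = 0" "W = span {b, c}"
proof -
  obtain B where B: "B \<subseteq> W" "pairwise orthogonal B" "\<And>x. x \<in> B \<Longrightarrow> norm x = 1"
    "card B = dim W" "span B = W"
    using orthonormal_basis_subspace[OF assms(1)] by metis
  obtain b c where "B = {b, c}" "b \<noteq> c" using B(4) assms by (metis card_2_iff)
  moreover from this have "orthogonal b c" using B(2) by (auto simp: pairwise_def)
  ultimately show ?thesis using B(1,3,5)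
    by (intro that[of b c]) (auto simp: orthogonal_def)
qed

text \<open>The functionals that vanish on \<open>G\<close>, reduced to the directions of
  \<open>P\<close>, form the plane \<open>W\<close>. With \<open>a\<close> exposing \<open>G\<close>
  and \<open>y\<close> orthogonal to \<open>a\<close> in \<open>W\<close>, the ratio of y to a off
  \<open>G\<close> has a least and a greatest value, attained on one facet each. The vertices of a
  polygon and the edges of a 3-polytope are both instances.\<close>

theorem polytope_ridge_two_facets:
  fixes P :: "'a::euclidean_space set"
  assumes P: "polytope P" and G: "G face_of P" "G \<noteq> {}" "aff_dim G = aff_dim P - 2"
  obtains F1 F2 where "F1 \<noteq> F2"
    "{F. F face_of P \<and> G \<subseteq> F \<and> aff_dim F = aff_dim P - 1} = {F1, F2}"
proof -
  obtain u where u: "u \<in> G" using G by auto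
  have GP: "G \<subseteq> P" using G face_of_imp_subset by auto
  have cP: "convex P" using P polytope_imp_convex by auto
  define D where "D = span ((+) (- u) ` P)"
  define DG where "DG = span ((+) (- u) ` G)"
  have xD: "x - u \<in> D" if "x \<in> P" for x unfolding D_def using that by (auto intro: span_base)
  have xDG: "x - u \<in> DG" if "x \<in> G" for x unfolding DG_def using that by (auto intro: span_base)
  have "int (dim D) = aff_dim P" "int (dim DG) = aff_dim G"
    unfolding D_def DG_def dim_span using u GP aff_dim_eq_dim[of u P] aff_dim_eq_dim[of u G]
    by (auto simp: hull_inc)
  moreover define W where "W = {y \<in> D. \<forall>x \<in> DG. orthogonal x y}"
  moreover have "dim W + dim DG = dim D"
    unfolding W_def by (rule dim_subspace_orthogonal_to_vectors)
      (use GP in \<open>auto simp: D_def DG_def intro!: span_mono\<close>)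
  ultimately have dW: "dim W = 2" using G by linarith
  have sW: "subspace W" unfolding W_def D_def subspace_def
    by (auto simp: orthogonal_clauses span_add span_scale span_zero)
  obtain b c where bc: "b \<in> W" "c \<in> W" "norm b = 1" "norm c = 1" "b \<bullet> c = 0" "W = span {b, c}"
    using subspace_dim2_basis[OF sW dW] by blast
  have WG: "w \<bullet> (x - u) = 0" if "w \<in> W" "x \<in> G" for w x
    using that xDG unfolding W_def by (auto simp: orthogonal_def inner_commute)
  have W0: "w = 0" if "w \<in> W" "\<forall>x\<in>P. w \<bullet> (x - u) = 0" for w
  proof -
    have "orthogonal w z" if "z \<in> D" for z
      using that unfolding D_def
      by (rule orthogonal_to_span) (use \<open>\<forall>x\<in>P. w \<bullet> (x - u) = 0\<close> in \<open>auto simp: orthogonal_def\<close>)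
    then have "orthogonal w w" using that W_def by auto
    then show ?thesis by (simp add: orthogonal_self)
  qed
  \<comment> \<open>Removing the part orthogonal to \<open>D\<close> does not change the values of a
    functional on \<open>P\<close>, measured from u.\<close>
  have proj: "\<exists>w\<in>W. \<forall>x\<in>P. k \<bullet> (x - u) = w \<bullet> (x - u)" if k: "\<forall>x\<in>G. k \<bullet> (x - u) = 0" for k
  proof -
    obtain w z where wz: "w \<in> span D" "\<And>t. t \<in> span D \<Longrightarrow> orthogonal z t" "k = w + z"
      using orthogonal_subspace_decomp_exists[of D k] by metis
    have sD: "span D = D" unfolding D_def by (simp add: span_span)
    have eq: "k \<bullet> (x - u) = w \<bullet> (x - u)" if "x \<in> P" for x
      using wz(2)[of "x - u"] xD[OF that] sD wz(3) by (simp add: inner_add_left orthogonal_def)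
    have "orthogonal w t" if "t \<in> DG" for t
      using that unfolding DG_def
      by (rule orthogonal_to_span) (use k eq GP in \<open>force simp: orthogonal_def\<close>)
    then have "w \<in> W" unfolding W_def using wz sD by (auto simp: orthogonal_commute)
    with eq show ?thesis by blast
  qed
  have expo: "\<exists>w\<in>W. (\<forall>x\<in>P. 0 \<le> w \<bullet> (x - u)) \<and> (\<forall>x\<in>P. w \<bullet> (x - u) = 0 \<longleftrightarrow> x \<in> F)"
    if F: "F face_of P" "G \<subseteq> F" for F
  proof -
    obtain k d where kd: "P \<subseteq> {x. k \<bullet> x \<le> d}" "F = P \<inter> {x. k \<bullet> x = d}"
      using exposed_face_of_polyhedron[OF polytope_imp_polyhedron[OF P]] F(1)
      unfolding exposed_face_of_def by blast
    have ku: "k \<bullet> u = d" using kd F u by auto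
    obtain w where w: "w \<in> W" "\<forall>x\<in>P. (- k) \<bullet> (x - u) = w \<bullet> (x - u)"
    proof -
      have "\<forall>x\<in>G. (- k) \<bullet> (x - u) = 0" using kd ku F(2) by (auto simp: inner_diff_right)
      from proj[OF this] show ?thesis using that by blast
    qed
    have "\<forall>x\<in>P. w \<bullet> (x - u) = d - k \<bullet> x" using w(2) ku by (auto simp: inner_diff_right)
    then show ?thesis using w(1) kd by (intro bexI[of _ w]) auto
  qed
  obtain a where a: "a \<in> W" "\<And>x. x \<in> P \<Longrightarrow> 0 \<le> a \<bullet> (x - u)" "\<And>x. x \<in> P \<Longrightarrow> a \<bullet> (x - u) = 0 \<longleftrightarrow> x \<in> G"
    using expo[OF G(1) order_refl] by blast
  have "G \<noteq> P" using G by auto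
  then have a0: "a \<noteq> 0" using a(3) GP by auto
  obtain s t where st: "a = s *\<^sub>R b + t *\<^sub>R c"
    using a(1) unfolding bc(6) by (rule span_pairE)
  \<comment> \<open>The vector \<open>a\<close> turned by a right angle inside
    \<open>W\<close>.\<close>
  define y where "y = (- t) *\<^sub>R b + s *\<^sub>R c"
  define N where "N = s * s + t * t"
  have N0: "N \<noteq> 0" using a0 unfolding N_def st
    by (metis add_0 mult_zero_left not_square_less_zero scaleR_zero_left sum_squares_eq_zero_iff)
  have yW: "y \<in> W" unfolding y_def by (intro subspace_add subspace_scale sW bc)
  have ya: "y \<bullet> a = 0" "y \<bullet> y = N" using bc unfolding y_def st N_def
    by (auto simp: inner_add_left inner_add_right inner_diff_left inner_diff_right norm_eq_1 inner_commute algebra_simps)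
  have comb: "\<exists>\<alpha> \<beta>. w = \<alpha> *\<^sub>R a + \<beta> *\<^sub>R y" if wW: "w \<in> W" for w
  proof -
    obtain p q where w: "w = p *\<^sub>R b + q *\<^sub>R c"
      using wW unfolding bc(6) by (rule span_pairE)
    have "w = ((p * s + q * t) / N) *\<^sub>R a + ((q * s - p * t) / N) *\<^sub>R y"
    proof -
      have "((p * s + q * t) / N) *\<^sub>R a + ((q * s - p * t) / N) *\<^sub>R y
         = (((p * s + q * t) * s - (q * s - p * t) * t) / N) *\<^sub>R b
           + (((p * s + q * t) * t + (q * s - p * t) * s) / N) *\<^sub>R c"
        unfolding st y_def by (simp add: algebra_simps add_divide_distrib diff_divide_distrib)
      also have "(p * s + q * t) * s - (q * s - p * t) * t = p * N" unfolding N_def by (simp add: algebra_simps)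
      also have "(p * s + q * t) * t + (q * s - p * t) * s = q * N" unfolding N_def by (simp add: algebra_simps)
      finally show ?thesis using w N0 by simp
    qed
    then show ?thesis by blast
  qed
  have npr: "\<not> (\<forall>x\<in>P. y \<bullet> (x - u) = e * (a \<bullet> (x - u)))" for e
  proof
    assume "\<forall>x\<in>P. y \<bullet> (x - u) = e * (a \<bullet> (x - u))"
    then have "\<forall>x\<in>P. (y - e *\<^sub>R a) \<bullet> (x - u) = 0" by (simp add: inner_diff_left)
    then have "y - e *\<^sub>R a = 0" by (intro W0) (use yW a sW in \<open>auto simp: subspace_diff subspace_scale\<close>)
    then have "y \<bullet> (y - e *\<^sub>R a) = 0" by simp
    then show False using ya N0 by (simp add: inner_diff_right)
  qed
  obtain m1 F1 where F1: "F1 = {x \<in> P. y \<bullet> (x - u) = m1 * (a \<bullet> (x - u))}"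
    "\<And>x. x \<in> P \<Longrightarrow> m1 * (a \<bullet> (x - u)) \<le> y \<bullet> (x - u)"
    "F1 face_of P" "G \<subseteq> F1" "aff_dim F1 = aff_dim P - 1"
    by (rule ridge_facet_aux[OF P G(1) u G(3) a(2,3), of y]) (use WG yW npr in auto)
  \<comment> \<open>The greatest ratio of y is found as the least ratio of
    \<open>- y\<close>.\<close>
  have npr': "\<not> (\<forall>x\<in>P. (- y) \<bullet> (x - u) = e * (a \<bullet> (x - u)))" for e
    using npr[of "- e"] by fastforce
  obtain m2 F2 where F2: "F2 = {x \<in> P. (- y) \<bullet> (x - u) = m2 * (a \<bullet> (x - u))}"
    "\<And>x. x \<in> P \<Longrightarrow> m2 * (a \<bullet> (x - u)) \<le> (- y) \<bullet> (x - u)"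
    "F2 face_of P" "G \<subseteq> F2" "aff_dim F2 = aff_dim P - 1"
    by (rule ridge_facet_aux[OF P G(1) u G(3) a(2,3), of "- y"]) (use WG yW npr' in auto)
  have apos: "a \<bullet> (x - u) > 0" if "x \<in> P" "x \<notin> G" for x using a(2,3)[of x] that by linarith
  have notG: "\<exists>x. x \<in> F \<and> x \<in> P \<and> x \<notin> G" if "F face_of P" "G \<subseteq> F" "aff_dim F = aff_dim P - 1" for F
  proof -
    have "F \<noteq> G" using that G by auto
    then show ?thesis using that face_of_imp_subset[OF that(1)] by blast
  qed
  have ne: "F1 \<noteq> F2"
  proof
    assume eq: "F1 = F2"
    obtain x where x: "x \<in> F1" "x \<in> P" "x \<notin> G" using notG F1 by blast
    have "x \<in> F2" using x eq by simp
    then have "m1 * (a \<bullet> (x - u)) = - m2 * (a \<bullet> (x - u))" using x F1(1) F2(1) by auto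
    then have "(m1 + m2) * (a \<bullet> (x - u)) = 0" by (simp add: algebra_simps)
    then have "m1 = - m2" using apos[OF x(2,3)] by auto
    then have "\<forall>z\<in>P. y \<bullet> (z - u) = m1 * (a \<bullet> (z - u))" using F1(2) F2(2) by force
    then show False using npr by blast
  qed
  have uniq: "F \<in> {F1, F2}" if F: "F face_of P" "G \<subseteq> F" "aff_dim F = aff_dim P - 1" for F
  proof -
    obtain w where w: "w \<in> W" "\<And>x. x \<in> P \<Longrightarrow> 0 \<le> w \<bullet> (x - u)" "\<And>x. x \<in> P \<Longrightarrow> w \<bullet> (x - u) = 0 \<longleftrightarrow> x \<in> F"
      using expo[OF F(1,2)] by blast
    obtain \<alpha> \<beta> where ab: "w = \<alpha> *\<^sub>R a + \<beta> *\<^sub>R y" using comb w(1) by blast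
    have wx: "w \<bullet> (x - u) = \<alpha> * (a \<bullet> (x - u)) + \<beta> * (y \<bullet> (x - u))" for x
      unfolding ab by (simp add: inner_add_left)
    obtain x where x: "x \<in> F" "x \<in> P" "x \<notin> G" using notG F by blast
    have FP: "F \<subseteq> P" using F face_of_imp_subset by auto
    have eqx: "\<alpha> * (a \<bullet> (x - u)) + \<beta> * (y \<bullet> (x - u)) = 0" using w(3)[OF x(2)] x wx by simp
    consider "\<beta> = 0" | "\<beta> > 0" | "\<beta> < 0" by linarith
    then show ?thesis
    proof cases
      case 1
      then have "\<alpha> = 0" using eqx apos[OF x(2,3)] by auto
      then have "F = P" using 1 w(3) wx FP by auto
      then show ?thesis using F by simp
    next
      case 2
      \<comment> \<open>A point of F off \<open>G\<close> gives
        \<open>\<alpha> + \<beta> * m1 \<le> 0\<close>, a point of F1 off \<open>G\<close> the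
        reverse; so w is a positive multiple of the functional that cuts out F1.\<close>
      obtain z where z: "z \<in> F1" "z \<in> P" "z \<notin> G" using notG F1 by blast
      have "m1 * (a \<bullet> (x - u)) \<le> y \<bullet> (x - u)" using F1(2) x by auto
      then have "\<beta> * (m1 * (a \<bullet> (x - u))) \<le> \<beta> * (y \<bullet> (x - u))" using 2 by (intro mult_left_mono) auto
      then have "(\<alpha> + \<beta> * m1) * (a \<bullet> (x - u)) \<le> 0" using eqx by (simp add: algebra_simps)
      then have 3: "\<alpha> + \<beta> * m1 \<le> 0" using apos[OF x(2,3)] by (simp add: mult_le_0_iff)
      have "0 \<le> \<alpha> * (a \<bullet> (z - u)) + \<beta> * (m1 * (a \<bullet> (z - u)))" using w(2)[OF z(2)] wx[of z] z F1(1) by auto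
      then have "0 \<le> (\<alpha> + \<beta> * m1) * (a \<bullet> (z - u))" by (simp add: algebra_simps)
      then have "0 \<le> \<alpha> + \<beta> * m1" using apos[OF z(2,3)] by (simp add: zero_le_mult_iff)
      with 3 have al: "\<alpha> = - \<beta> * m1" by simp
      have "w \<bullet> (q - u) = \<beta> * (y \<bullet> (q - u) - m1 * (a \<bullet> (q - u)))" for q
        unfolding wx al by (simp add: algebra_simps)
      then have "F = F1" using w(3) FP 2 unfolding F1(1) by auto
      then show ?thesis by simp
    next
      case 3
      obtain z where z: "z \<in> F2" "z \<in> P" "z \<notin> G" using notG F2 by blast
      have "m2 * (a \<bullet> (x - u)) \<le> (- y) \<bullet> (x - u)" using F2(2) x by auto
      then have "(- \<beta>) * (m2 * (a \<bullet> (x - u))) \<le> (- \<beta>) * ((- y) \<bullet> (x - u))" using 3 by (intro mult_left_mono) auto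
      then have "(\<alpha> - \<beta> * m2) * (a \<bullet> (x - u)) \<le> 0" using eqx by (simp add: algebra_simps)
      then have 4: "\<alpha> - \<beta> * m2 \<le> 0" using apos[OF x(2,3)] by (simp add: mult_le_0_iff)
      have "y \<bullet> (z - u) = - (m2 * (a \<bullet> (z - u)))" using z F2(1) by auto
      then have "0 \<le> \<alpha> * (a \<bullet> (z - u)) - \<beta> * (m2 * (a \<bullet> (z - u)))" using w(2)[OF z(2)] wx[of z] by simp
      then have "0 \<le> (\<alpha> - \<beta> * m2) * (a \<bullet> (z - u))" by (simp add: algebra_simps)
      then have "0 \<le> \<alpha> - \<beta> * m2" using apos[OF z(2,3)] by (simp add: zero_le_mult_iff)
      with 4 have al: "\<alpha> = \<beta> * m2" by simp
      have "w \<bullet> (q - u) = \<beta> * (y \<bullet> (q - u) + m2 * (a \<bullet> (q - u)))" for q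
        unfolding wx al by (simp add: algebra_simps)
      then have "w \<bullet> (q - u) = 0 \<longleftrightarrow> (- y) \<bullet> (q - u) = m2 * (a \<bullet> (q - u))" for q using 3 by auto
      then have "F = F2" using w(3) FP unfolding F2(1) by auto
      then show ?thesis by simp
    qed
  qed
  show ?thesis by (rule that[OF ne]) (use uniq F1 F2 in auto)
qed

lemma polytope_1_segment:
  fixes P :: "'a::euclidean_space set"
  assumes "polytope P" "e face_of P" "aff_dim e = 1"
  obtains x y where "x \<noteq> y" "e = closed_segment x y" "x extreme_point_of P" "y extreme_point_of P"
proof -
  have e: "compact e" "convex e" "e \<noteq> {}" "collinear e"
    using assms face_of_polytope_polytope polytope_imp_compact polytope_imp_convex
    by (auto simp: collinear_aff_dim)
  obtain x y where xy: "e = closed_segment x y" using compact_convex_collinear_segment[OF e(3,1,2,4)] by blast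
  have "x \<noteq> y" using assms xy by auto
  moreover have "x extreme_point_of P" "y extreme_point_of P"
    using extreme_point_of_face[OF assms(2)] xy by (auto simp: extreme_point_of_segment)
  ultimately show ?thesis using that xy by blast
qed

lemma segment_face_extreme:
  fixes P :: "'a::euclidean_space set"
  assumes "closed_segment x y face_of P"
  shows "x extreme_point_of P" "y extreme_point_of P"
  using extreme_point_of_face[OF assms, of x] extreme_point_of_face[OF assms, of y]
  by (auto simp: extreme_point_of_segment[of _ x y])

text \<open>Of the functionals exposing the two edges at v, each vanishes along one edge and is
  negative along the other, so it reads off the sign of one coordinate. This places the polygon in
  the cone of its two edges.\<close>

lemma polygon_corner:
  fixes F :: "'a::euclidean_space set"
  assumes F: "polytope F" "aff_dim F = 2" and v: "v extreme_point_of F"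
  obtains x y where "x \<noteq> y" "x \<noteq> v" "y \<noteq> v" "closed_segment v x face_of F" "closed_segment v y face_of F"
    "\<And>w. w \<noteq> v \<Longrightarrow> closed_segment v w face_of F \<Longrightarrow> w = x \<or> w = y"
    "\<And>a b. a *\<^sub>R (x - v) + b *\<^sub>R (y - v) = 0 \<Longrightarrow> a = 0 \<and> b = 0"
    "\<And>p. p \<in> F \<Longrightarrow> \<exists>s t. 0 \<le> s \<and> 0 \<le> t \<and> p - v = s *\<^sub>R (x - v) + t *\<^sub>R (y - v)"
proof -
  have vf: "{v} face_of F" using v by (simp add: face_of_singleton)
  obtain F1 F2 where F12: "F1 \<noteq> F2" "{e. e face_of F \<and> {v} \<subseteq> e \<and> aff_dim e = aff_dim F - 1} = {F1, F2}"
    using polytope_ridge_two_facets[OF F(1) vf] F by auto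
  have edge: "\<exists>x. x \<noteq> v \<and> e = closed_segment v x" if e: "e face_of F" "v \<in> e" "aff_dim e = 1" for e
  proof -
    obtain a b where ab: "a \<noteq> b" "e = closed_segment a b" by (rule polytope_1_segment[OF F(1) e(1,3)])
    have "v extreme_point_of e" using extreme_point_of_face[OF e(1)] v e by auto
    then have "v = a \<or> v = b" using ab by (simp add: extreme_point_of_segment)
    then show ?thesis
    proof
      assume "v = a" then show ?thesis using ab by (intro exI[of _ b]) auto
    next
      assume "v = b" then show ?thesis using ab closed_segment_commute[of a b] by (intro exI[of _ a]) auto
    qed
  qed
  have f1: "F1 face_of F" "v \<in> F1" "aff_dim F1 = 1" and f2: "F2 face_of F" "v \<in> F2" "aff_dim F2 = 1"
    using F12(2) F(2) by auto
  obtain x where x: "x \<noteq> v" "F1 = closed_segment v x" using edge f1 by blast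
  obtain y where y: "y \<noteq> v" "F2 = closed_segment v y" using edge f2 by blast
  have xy: "x \<noteq> y" using F12(1) x y by auto
  have uniq: "w = x \<or> w = y" if "w \<noteq> v" "closed_segment v w face_of F" for w
  proof -
    have "aff_dim (closed_segment v w) = 1"
      using that(1) aff_dim_convex_hull[of "{v, w}"] by (simp add: segment_convex_hull[symmetric] aff_dim_2)
    then have "closed_segment v w \<in> {F1, F2}" using F12(2) that F(2) by auto
    then show ?thesis using x y that by (auto simp: closed_segment_eq doubleton_eq_iff)
  qed
  have cF: "convex F" using F polytope_imp_convex by auto
  have inF: "v \<in> F" "x \<in> F" "y \<in> F"
    using f1 f2 x y face_of_imp_subset by (auto simp: extreme_point_of_def)
  have yx: "y - v \<noteq> c *\<^sub>R (x - v)" for c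
  proof
    assume "y - v = c *\<^sub>R (x - v)"
    then have "y = (1 - c) *\<^sub>R v + c *\<^sub>R x" by (simp add: algebra_simps)
    then have "y \<in> affine hull {v, x}" unfolding affine_hull_2 by (metis (mono_tags, lifting) diff_add_cancel mem_Collect_eq)
    then have "y \<in> affine hull F1" using x hull_mono[of "{v,x}" F1 affine] by (auto simp: subset_iff)
    then have "y \<in> F1" using face_of_imp_eq_affine_Int[OF cF f1(1)] inF by blast
    then have "y extreme_point_of F1" using extreme_point_of_face[OF f1(1)] segment_face_extreme[of v y F] f2(1) y by auto
    then show False using x y xy by (auto simp: extreme_point_of_segment)
  qed
  have ind: "a = 0 \<and> b = 0" if "a *\<^sub>R (x - v) + b *\<^sub>R (y - v) = 0" for a b
  proof (cases "b = 0")
    case True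
    then show ?thesis using that x by simp
  next
    case False
    have "y - v = (1 / b) *\<^sub>R (b *\<^sub>R (y - v))" using False by simp
    also have "b *\<^sub>R (y - v) = (- a) *\<^sub>R (x - v)" using that by (simp add: eq_neg_iff_add_eq_0 add.commute)
    finally show ?thesis using yx[of "(1/b) * (- a)"] by simp
  qed
  have card2: "card {y - v, x - v} = 2" using xy by simp
  have indep: "independent {y - v, x - v}"
    unfolding independent_insert using x yx by (simp add: span_singleton image_iff independent_empty)
  have "int (dim ((+) (- v) ` F)) = 2" using F(2) inF aff_dim_eq_dim[of v F] by (simp add: hull_inc)
  then have "(+) (- v) ` F \<subseteq> span {y - v, x - v}"
    by (intro card_ge_dim_independent) (use inF indep card2 in auto)
  then have sp: "\<exists>s t. p - v = s *\<^sub>R (x - v) + t *\<^sub>R (y - v)" if "p \<in> F" for p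
  proof -
    have "p - v \<in> span {y - v, x - v}"
      using that \<open>(+) (- v) ` F \<subseteq> _\<close> by force
    then obtain t s where "p - v = t *\<^sub>R (y - v) + s *\<^sub>R (x - v)" by (rule span_pairE)
    then show ?thesis by (auto simp: add.commute)
  qed
  have expo: "\<exists>k d. F \<subseteq> {x. k \<bullet> x \<le> d} \<and> e = F \<inter> {x. k \<bullet> x = d}" if "e face_of F" for e
    using exposed_face_of_polyhedron[OF polytope_imp_polyhedron[OF F(1)]] that
    unfolding exposed_face_of_def by blast
  have ynot: "y \<notin> F1"
  proof
    assume "y \<in> F1"
    then have "y extreme_point_of F1" using extreme_point_of_face[OF f1(1)] segment_face_extreme[of v y F] f2(1) y by auto
    then show False using x y xy by (auto simp: extreme_point_of_segment)
  qed
  have xnot: "x \<notin> F2"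
  proof
    assume "x \<in> F2"
    then have "x extreme_point_of F2" using extreme_point_of_face[OF f2(1)] segment_face_extreme[of v x F] f1(1) x by auto
    then show False using x y xy by (auto simp: extreme_point_of_segment)
  qed
  obtain k d where kd: "F \<subseteq> {x. k \<bullet> x \<le> d}" "F1 = F \<inter> {x. k \<bullet> x = d}" using expo f1 by blast
  obtain k' d' where kd': "F \<subseteq> {x. k' \<bullet> x \<le> d'}" "F2 = F \<inter> {x. k' \<bullet> x = d'}" using expo f2 by blast
  have k: "k \<bullet> v = d" "k \<bullet> x = d" "k \<bullet> y < d" using kd f1 x ynot inF by force+
  have k': "k' \<bullet> v = d'" "k' \<bullet> y = d'" "k' \<bullet> x < d'" using kd' f2 y xnot inF by force+
  have "\<exists>s t. 0 \<le> s \<and> 0 \<le> t \<and> p - v = s *\<^sub>R (x - v) + t *\<^sub>R (y - v)" if p: "p \<in> F" for p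
  proof -
    obtain s t where st: "p - v = s *\<^sub>R (x - v) + t *\<^sub>R (y - v)" using sp p by blast
    have "k \<bullet> (p - v) \<le> 0" using kd p k by (auto simp: inner_diff_right)
    moreover have "k \<bullet> (p - v) = t * (k \<bullet> y - d)" unfolding st using k by (simp add: inner_add_right inner_diff_right)
    ultimately have "0 \<le> t" using k by (simp add: mult_le_0_iff)
    have "k' \<bullet> (p - v) \<le> 0" using kd' p k' by (auto simp: inner_diff_right)
    moreover have "k' \<bullet> (p - v) = s * (k' \<bullet> x - d')" unfolding st using k' by (simp add: inner_add_right inner_diff_right)
    ultimately have "0 \<le> s" using k' by (simp add: mult_le_0_iff)
    with \<open>0 \<le> t\<close> st show ?thesis by blast
  qed
  then show ?thesis using that[of x y] xy x y f1 f2 uniq ind by blast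
qed

text \<open>The choice in \<open>face_angle\<close> is harmless: only two edges leave v, and
  interchanging them preserves the angle.\<close>

lemma face_angle_eq:
  assumes F: "polytope F" "aff_dim F = 2"
    and x: "x \<noteq> y" "x \<noteq> v" "y \<noteq> v" "closed_segment v x face_of F" "closed_segment v y face_of F"
  shows "face_angle F v = ang (x - v) (y - v)"
proof -
  have v: "v extreme_point_of F" using segment_face_extreme x by blast
  obtain p q where pq: "\<And>w. w \<noteq> v \<Longrightarrow> closed_segment v w face_of F \<Longrightarrow> w = p \<or> w = q"
    using polygon_corner[OF F v] by metis
  show ?thesis unfolding face_angle_def vec_angle_eq_ang
  proof (rule some_equality)
    show "\<exists>a b. a \<noteq> b \<and> a \<noteq> v \<and> b \<noteq> v \<and> closed_segment v a face_of F \<and> closed_segment v b face_of F \<and>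
      ang (x - v) (y - v) = ang (a - v) (b - v)" using x by blast
    fix \<theta> assume "\<exists>a b. a \<noteq> b \<and> a \<noteq> v \<and> b \<noteq> v \<and> closed_segment v a face_of F \<and> closed_segment v b face_of F \<and>
      \<theta> = ang (a - v) (b - v)"
    then show "\<theta> = ang (x - v) (y - v)" using pq x by (metis ang_commute)
  qed
qed

lemma face_angle_bounds:
  assumes F: "polytope F" "aff_dim F = 2" and v: "v extreme_point_of F"
  shows "0 < face_angle F v" "face_angle F v < pi"
proof -
  obtain x y where xy: "x \<noteq> y" "x \<noteq> v" "y \<noteq> v" "closed_segment v x face_of F" "closed_segment v y face_of F"
    "\<And>a b. a *\<^sub>R (x - v) + b *\<^sub>R (y - v) = 0 \<Longrightarrow> a = 0 \<and> b = 0"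
    using polygon_corner[OF F v] by metis
  show "0 < face_angle F v" "face_angle F v < pi"
    unfolding face_angle_eq[OF F xy(1-5)] using ang_strict_bounds[OF xy(6)] by auto
qed

section \<open>The link of a vertex of a 3-polytope\<close>

lemma edge_in_face:
  assumes "e face_of P" "e \<subseteq> F" "F face_of P"
  shows "e face_of F"
  using face_of_subset[OF assms(1,2) face_of_imp_subset[OF assms(3)]] .

lemma poly_edge_face:
  assumes "F face_of P" "e face_of F" "aff_dim e = 1"
  shows "e \<in> poly_edges P"
  using assms face_of_trans unfolding poly_edges_def by blast

lemma aff_dim_segment: "x \<noteq> y \<Longrightarrow> aff_dim (closed_segment x y) = 1"
  using aff_dim_convex_hull[of "{x, y}"] by (simp add: segment_convex_hull[symmetric] aff_dim_2)

lemma poly_edges_segment_ne: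
  assumes "closed_segment x y \<in> poly_edges P" shows "x \<noteq> y"
  using assms by (auto simp: poly_edges_def)

lemma polygon_edges_at_vertex:
  fixes F :: "(real^3) set"
  assumes F: "polytope F" "aff_dim F = 2" and z: "z extreme_point_of F"
  shows "card {e. e face_of F \<and> aff_dim e = 1 \<and> z \<in> e} = 2"
proof -
  have "{z} face_of F" using z by (simp add: face_of_singleton)
  then obtain F1 F2 where F12: "F1 \<noteq> F2" "{e. e face_of F \<and> {z} \<subseteq> e \<and> aff_dim e = aff_dim F - 1} = {F1, F2}"
    using polytope_ridge_two_facets[OF F(1), of "{z}"] F(2) by auto
  have "{e. e face_of F \<and> aff_dim e = 1 \<and> z \<in> e} = {e. e face_of F \<and> {z} \<subseteq> e \<and> aff_dim e = aff_dim F - 1}"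
    using F by auto
  then show ?thesis using F12 by (simp only: card_2_iff) blast
qed

lemma finite_face_set: "polytope F \<Longrightarrow> finite {e. e face_of F \<and> Q e}"
  for F :: "'a::euclidean_space set"
  using finite_polytope_faces[of F] by (rule rev_finite_subset) auto

text \<open>Double counting: every vertex of the polygon lies on two of its edges, so the numbers
  \<open>card (S \<inter> e)\<close> have an even sum. In other words, the cut defined by a set of
  vertices satisfies the cocycle condition on each face.\<close>

lemma polygon_cut_even:
  fixes F :: "(real^3) set"
  assumes F: "polytope F" "aff_dim F = 2" and S: "S \<subseteq> {z. z extreme_point_of F}"
  shows "even (card {e. e face_of F \<and> aff_dim e = 1 \<and> odd (card (S \<inter> e))})"
proof -
  define E where "E = {e. e face_of F \<and> aff_dim e = 1}"
  have fS: "finite S" using S finite_extreme_points[OF F(1)] finite_subset by auto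
  have fE: "finite E" unfolding E_def using finite_face_set[OF F(1)] .
  have "(\<Sum>e\<in>E. card (S \<inter> e)) = (\<Sum>e\<in>E. \<Sum>z\<in>S. if z \<in> e then 1 else 0)"
    using fS by (simp add: sum.If_cases Int_def)
  also have "\<dots> = (\<Sum>z\<in>S. \<Sum>e\<in>E. if z \<in> e then 1 else 0)" by (rule sum.swap)
  also have "\<dots> = (\<Sum>z\<in>S. 2)"
  proof (rule sum.cong[OF refl])
    fix z assume "z \<in> S"
    have "(\<Sum>e\<in>E. if z \<in> e then 1 else 0) = card {e \<in> E. z \<in> e}"
      using fE by (simp add: sum.If_cases Int_def)
    also have "{e \<in> E. z \<in> e} = {e. e face_of F \<and> aff_dim e = 1 \<and> z \<in> e}" unfolding E_def by auto
    also have "card \<dots> = 2" using polygon_edges_at_vertex[OF F] S \<open>z \<in> S\<close> by auto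
    finally show "(\<Sum>e\<in>E. if z \<in> e then 1 else 0) = (2::nat)" .
  qed
  finally have "even (\<Sum>e\<in>E. card (S \<inter> e))" by simp
  then have "even (card {e \<in> E. odd (card (S \<inter> e))})" using even_sum_iff[OF fE, of "\<lambda>e. card (S \<inter> e)"] by simp
  moreover have "{e \<in> E. odd (card (S \<inter> e))} = {e. e face_of F \<and> aff_dim e = 1 \<and> odd (card (S \<inter> e))}"
    unfolding E_def by auto
  ultimately show ?thesis by simp
qed

lemma extreme_in_segment_face:
  fixes P :: "'a::euclidean_space set"
  assumes "closed_segment x y face_of P" "z extreme_point_of P" "z \<in> closed_segment x y"
  shows "z = x \<or> z = y"
  using extreme_point_of_face[OF assms(1), of z] assms by (auto simp: extreme_point_of_segment)

lemma span3_UNIV: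
  fixes X Y Z :: "real^3"
  assumes ind: "\<And>a b c. a *\<^sub>R X + b *\<^sub>R Y + c *\<^sub>R Z = 0 \<Longrightarrow> a = 0 \<and> b = 0 \<and> c = 0"
  obtains a b c where "p = a *\<^sub>R X + b *\<^sub>R Y + c *\<^sub>R Z"
proof -
  have X0: "X \<noteq> 0" using ind[of 1 0 0] by auto
  have Y: "Y \<notin> span {X}"
  proof
    assume "Y \<in> span {X}"
    then obtain k where "Y = k *\<^sub>R X" by (auto simp: span_singleton)
    then show False using ind[of "- k" 1 0] by auto
  qed
  have Z: "Z \<notin> span {Y, X}"
  proof
    assume "Z \<in> span {Y, X}"
    then obtain k l where "Z = k *\<^sub>R Y + l *\<^sub>R X" by (rule span_pairE)
    then show False using ind[of "- l" "- k" 1] by auto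
  qed
  have YX: "Y \<noteq> X" using Y by (auto intro: span_base)
  have ZY: "Z \<notin> {Y, X}" using Z span_base[of Z "{Y,X}"] by blast
  have "independent {Z, Y, X}"
    using X0 Y Z YX ZY by (simp add: independent_insert independent_empty)
  then have "UNIV \<subseteq> span {Z, Y, X}"
    using YX ZY by (intro card_ge_dim_independent) (auto simp: dim_UNIV card_insert_if)
  then have "p \<in> span {Z, Y, X}" by blast
  then obtain k where "p - k *\<^sub>R Z \<in> span {Y, X}" by (auto simp: span_breakdown_eq[of p])
  then obtain l m where "p - k *\<^sub>R Z = l *\<^sub>R Y + m *\<^sub>R X" by (rule span_pairE)
  then have "p = m *\<^sub>R X + l *\<^sub>R Y + k *\<^sub>R Z" by (simp add: diff_eq_eq algebra_simps)
  then show ?thesis using that by blast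
qed

text \<open>Faces of a polytope are exposed. The sign is chosen such that F is the set of minima,
  and values are measured from a point of F, so that later arguments carry no constants.\<close>

lemma exposing_functional:
  fixes P :: "'a::euclidean_space set"
  assumes "polytope P" "F face_of P" "u \<in> F"
  obtains k where "\<And>p. p \<in> P \<Longrightarrow> 0 \<le> k \<bullet> (p - u)" "\<And>p. p \<in> P \<Longrightarrow> k \<bullet> (p - u) = 0 \<longleftrightarrow> p \<in> F"
proof -
  obtain k d where kd: "P \<subseteq> {x. k \<bullet> x \<le> d}" "F = P \<inter> {x. k \<bullet> x = d}"
    using exposed_face_of_polyhedron[OF polytope_imp_polyhedron[OF assms(1)]] assms(2)
    unfolding exposed_face_of_def by blast
  then have "k \<bullet> u = d" using assms by auto
  then show ?thesis using kd by (intro that[of "- k"]) (auto simp: inner_diff_right)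
qed

section \<open>Facets and edges around a vertex of a 3-polytope\<close>

locale polyhedron3 =
  fixes P :: "(real^3) set"
  assumes polyP: "polytope P" and dimP: "aff_dim P = 3"
begin

definition facets :: "(real^3) set set" where
  "facets = {F. F face_of P \<and> aff_dim F = 2}"

definition nbr :: "real^3 \<Rightarrow> (real^3) set" where
  "nbr v = {x. closed_segment v x \<in> poly_edges P}"

lemma facetD:
  assumes "F \<in> facets"
  shows "F face_of P" "aff_dim F = 2" "polytope F" "convex F" "F \<subseteq> P"
proof -
  show f: "F face_of P" "aff_dim F = 2" using assms by (auto simp: facets_def)
  show "polytope F" "convex F" "F \<subseteq> P"
    using face_of_polytope_polytope[OF polyP f(1)] face_of_imp_convex[OF f(1)] face_of_imp_subset[OF f(1)] by auto
qed

lemma finite_facets: "finite facets"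
  unfolding facets_def using finite_face_set[OF polyP] .

lemma nbrD:
  assumes "x \<in> nbr v"
  shows "x \<noteq> v" "closed_segment v x face_of P" "x extreme_point_of P" "v extreme_point_of P"
    "x \<in> P" "v \<in> P" "v \<in> nbr x"
proof -
  show f: "closed_segment v x face_of P" using assms by (simp add: nbr_def poly_edges_def)
  show "x \<noteq> v" using assms poly_edges_segment_ne[of v x P] by (auto simp: nbr_def)
  show "x extreme_point_of P" "v extreme_point_of P" using segment_face_extreme[OF f] by auto
  then show "x \<in> P" "v \<in> P" by (auto simp: extreme_point_of_def)
  show "v \<in> nbr x" using assms by (simp add: nbr_def closed_segment_commute)
qed

lemma finite_nbr: "finite (nbr v)"
  using finite_extreme_points[OF polyP] nbrD(3) by (metis (no_types, lifting) finite_subset mem_Collect_eq subsetI)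

lemma edge_two_facets:
  assumes "e \<in> poly_edges P"
  obtains F1 F2 where "F1 \<noteq> F2" "{F \<in> facets. e \<subseteq> F} = {F1, F2}"
proof -
  have e: "e face_of P" "aff_dim e = 1" using assms by (auto simp: poly_edges_def)
  then have "e \<noteq> {}" by auto
  then obtain F1 F2 where "F1 \<noteq> F2" "{F. F face_of P \<and> e \<subseteq> F \<and> aff_dim F = aff_dim P - 1} = {F1, F2}"
    using polytope_ridge_two_facets[OF polyP e(1)] e dimP by auto
  moreover have "{F. F face_of P \<and> e \<subseteq> F \<and> aff_dim F = aff_dim P - 1} = {F \<in> facets. e \<subseteq> F}"
    using dimP by (auto simp: facets_def)
  ultimately show ?thesis using that by auto
qed

lemma segment_subset_facet:
  assumes "F \<in> facets" "x \<in> F" "y \<in> F"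
  shows "closed_segment x y \<subseteq> F"
  using facetD(4)[OF assms(1)] assms by (simp add: closed_segment_subset)

lemma nbr_in_facet:
  assumes "x \<in> nbr v" "F \<in> facets" "x \<in> F" "v \<in> F"
  shows "closed_segment v x face_of F"
  using edge_in_face[OF nbrD(2)[OF assms(1)] _ facetD(1)[OF assms(2)]] segment_subset_facet assms by auto

lemma facet_corner:
  assumes F: "F \<in> facets" and v: "v extreme_point_of P" "v \<in> F"
  obtains x y where "x \<noteq> y" "x \<in> nbr v" "y \<in> nbr v" "nbr v \<inter> F = {x, y}"
    "face_angle F v = ang (x - v) (y - v)"
    "\<And>a b. a *\<^sub>R (x - v) + b *\<^sub>R (y - v) = 0 \<Longrightarrow> a = 0 \<and> b = 0"
    "\<And>p. p \<in> F \<Longrightarrow> \<exists>s t. 0 \<le> s \<and> 0 \<le> t \<and> p - v = s *\<^sub>R (x - v) + t *\<^sub>R (y - v)"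
proof -
  have vF: "v extreme_point_of F" using v extreme_point_of_face[OF facetD(1)[OF F]] by auto
  obtain x y where xy: "x \<noteq> y" "x \<noteq> v" "y \<noteq> v" "closed_segment v x face_of F" "closed_segment v y face_of F"
    "\<And>w. w \<noteq> v \<Longrightarrow> closed_segment v w face_of F \<Longrightarrow> w = x \<or> w = y"
    "\<And>a b. a *\<^sub>R (x - v) + b *\<^sub>R (y - v) = 0 \<Longrightarrow> a = 0 \<and> b = 0"
    "\<And>p. p \<in> F \<Longrightarrow> \<exists>s t. 0 \<le> s \<and> 0 \<le> t \<and> p - v = s *\<^sub>R (x - v) + t *\<^sub>R (y - v)"
    by (rule polygon_corner[OF facetD(3,2)[OF F] vF]) blast
  have n: "x \<in> nbr v" "y \<in> nbr v"
    unfolding nbr_def using poly_edge_face[OF facetD(1)[OF F]] xy aff_dim_segment[of v x] aff_dim_segment[of v y] by auto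
  have "x \<in> F" "y \<in> F" using xy face_of_imp_subset by (meson ends_in_segment(2) subsetD)+
  moreover have "w = x \<or> w = y" if "w \<in> nbr v" "w \<in> F" for w
    using xy(6)[of w] nbr_in_facet[OF that(1) F that(2) v(2)] nbrD(1)[OF that(1)] by blast
  ultimately have "nbr v \<inter> F = {x, y}" using n by blast
  then show ?thesis using that n xy face_angle_eq[OF facetD(3,2)[OF F] xy(1-5)] by blast
qed

lemma facet_corner_other:
  assumes F: "F \<in> facets" and x: "x \<in> nbr v" "x \<in> F" "v \<in> F"
  obtains y where "x \<noteq> y" "y \<in> nbr v" "y \<in> F" "nbr v \<inter> F = {x, y}"
    "face_angle F v = ang (x - v) (y - v)"
    "\<And>a b. a *\<^sub>R (x - v) + b *\<^sub>R (y - v) = 0 \<Longrightarrow> a = 0 \<and> b = 0"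
    "\<And>p. p \<in> F \<Longrightarrow> \<exists>s t. 0 \<le> s \<and> 0 \<le> t \<and> p - v = s *\<^sub>R (x - v) + t *\<^sub>R (y - v)"
proof -
  obtain p q where pq: "p \<noteq> q" "p \<in> nbr v" "q \<in> nbr v" "nbr v \<inter> F = {p, q}"
    "face_angle F v = ang (p - v) (q - v)"
    "\<And>a b. a *\<^sub>R (p - v) + b *\<^sub>R (q - v) = 0 \<Longrightarrow> a = 0 \<and> b = 0"
    "\<And>r. r \<in> F \<Longrightarrow> \<exists>s t. 0 \<le> s \<and> 0 \<le> t \<and> r - v = s *\<^sub>R (p - v) + t *\<^sub>R (q - v)"
    by (rule facet_corner[OF F nbrD(4)[OF x(1)] x(3)]) blast
  have "x = p \<or> x = q" using pq(4) x by blast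
  then show ?thesis
  proof
    assume "x = p" then show ?thesis using that[of q] pq by blast
  next
    assume xq: "x = q"
    show ?thesis
    proof (rule that[of p])
      show "a = 0 \<and> b = 0" if "a *\<^sub>R (x - v) + b *\<^sub>R (p - v) = 0" for a b
        using pq(6)[of b a] that xq by (simp add: add.commute)
      show "\<exists>s t. 0 \<le> s \<and> 0 \<le> t \<and> r - v = s *\<^sub>R (x - v) + t *\<^sub>R (p - v)" if "r \<in> F" for r
        using pq(7)[OF that] xq by (metis add.commute)
      show "face_angle F v = ang (x - v) (p - v)" using pq(5) xq by (simp add: ang_commute)
    qed (use pq xq in auto)
  qed
qed

lemma facet_normal:
  assumes F: "F \<in> facets" and v: "v \<in> F"
  obtains k where "\<And>p. p \<in> P \<Longrightarrow> 0 \<le> k \<bullet> (p - v)" "\<And>p. p \<in> P \<Longrightarrow> k \<bullet> (p - v) = 0 \<longleftrightarrow> p \<in> F"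
  by (rule exposing_functional[OF polyP facetD(1)[OF F] v]) blast

lemma facet_subset_eq:
  assumes "F \<in> facets" "G \<in> facets" "F \<subseteq> G"
  shows "F = G"
proof (rule ccontr)
  assume "F \<noteq> G"
  have "F face_of G" using edge_in_face facetD assms by blast
  then have "aff_dim F < aff_dim G" using face_of_aff_dim_lt facetD(4)[OF assms(2)] \<open>F \<noteq> G\<close> by blast
  then show False using facetD assms by simp
qed

text \<open>\<open>P\<close> lies in the wedge of the two facets on an edge, since their normals
  read off the coordinates \<open>t1\<close> and \<open>t2\<close>. This is an optimality test: a
  functional that vanishes along the edge and is nonnegative on the two adjacent edges at v is
  nonnegative on all of \<open>P\<close>, measured from v.\<close>

lemma edge_wedge:
  assumes x: "x \<in> nbr v"
  obtains F1 F2 y1 y2 where "F1 \<in> facets" "F2 \<in> facets" "F1 \<noteq> F2" "{x, v, y1} \<subseteq> F1" "{x, v, y2} \<subseteq> F2"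
    "y1 \<in> nbr v" "y2 \<in> nbr v" "y1 \<noteq> x" "y2 \<noteq> x"
    "\<And>p. p \<in> P \<Longrightarrow> \<exists>s t1 t2. 0 \<le> t1 \<and> 0 \<le> t2 \<and> p - v = s *\<^sub>R (x - v) + t1 *\<^sub>R (y1 - v) + t2 *\<^sub>R (y2 - v)"
    "\<And>a b c. a *\<^sub>R (x - v) + b *\<^sub>R (y1 - v) + c *\<^sub>R (y2 - v) = 0 \<Longrightarrow> a = 0 \<and> b = 0 \<and> c = 0"
    "\<And>F. F \<in> facets \<Longrightarrow> x \<in> F \<Longrightarrow> v \<in> F \<Longrightarrow> F = F1 \<or> F = F2"
proof -
  have xe: "closed_segment v x \<in> poly_edges P" using x by (simp add: nbr_def)
  obtain F1 F2 where F12: "F1 \<noteq> F2" "{F \<in> facets. closed_segment v x \<subseteq> F} = {F1, F2}"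
    by (rule edge_two_facets[OF xe])
  then have f: "F1 \<in> facets" "F2 \<in> facets" "x \<in> F1" "v \<in> F1" "x \<in> F2" "v \<in> F2" by auto
  have uniq: "F = F1 \<or> F = F2" if "F \<in> facets" "x \<in> F" "v \<in> F" for F
    using F12(2) that segment_subset_facet[OF that(1,3,2)] by blast
  obtain y1 where y1: "x \<noteq> y1" "y1 \<in> nbr v" "y1 \<in> F1" "nbr v \<inter> F1 = {x, y1}"
    "\<And>p. p \<in> F1 \<Longrightarrow> \<exists>s t. 0 \<le> s \<and> 0 \<le> t \<and> p - v = s *\<^sub>R (x - v) + t *\<^sub>R (y1 - v)"
    by (rule facet_corner_other[OF f(1) x f(3,4)]) blast
  obtain y2 where y2: "x \<noteq> y2" "y2 \<in> nbr v" "y2 \<in> F2" "nbr v \<inter> F2 = {x, y2}"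
    "\<And>p. p \<in> F2 \<Longrightarrow> \<exists>s t. 0 \<le> s \<and> 0 \<le> t \<and> p - v = s *\<^sub>R (x - v) + t *\<^sub>R (y2 - v)"
    by (rule facet_corner_other[OF f(2) x f(5,6)]) blast
  obtain k1 where k1: "\<And>p. p \<in> P \<Longrightarrow> 0 \<le> k1 \<bullet> (p - v)" "\<And>p. p \<in> P \<Longrightarrow> k1 \<bullet> (p - v) = 0 \<longleftrightarrow> p \<in> F1"
    by (rule facet_normal[OF f(1,4)]) blast
  obtain k2 where k2: "\<And>p. p \<in> P \<Longrightarrow> 0 \<le> k2 \<bullet> (p - v)" "\<And>p. p \<in> P \<Longrightarrow> k2 \<bullet> (p - v) = 0 \<longleftrightarrow> p \<in> F2"
    by (rule facet_normal[OF f(2,6)]) blast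
  have inP: "x \<in> P" "y1 \<in> P" "y2 \<in> P" using x y1 y2 nbrD by auto
  \<comment> \<open>Otherwise y2 = y1, so that \<open>k2\<close> would vanish on the corner spanning
    \<open>F1\<close>, and \<open>F1\<close> would be contained in \<open>F2\<close>.\<close>
  have y2F1: "y2 \<notin> F1"
  proof
    assume a: "y2 \<in> F1"
    have "F1 \<subseteq> F2"
    proof
      fix p assume p: "p \<in> F1"
      have "y2 \<in> nbr v \<inter> F1" using a y2(2) by simp
      then have "y2 = y1" unfolding y1(4) using y2(1) by auto
      then have "k2 \<bullet> (x - v) = 0" "k2 \<bullet> (y1 - v) = 0" using k2(2) inP f y2 by auto
      then have "k2 \<bullet> (p - v) = 0" using y1(5)[OF p] by (auto simp: inner_add_right)
      then show "p \<in> F2" using k2(2) p facetD(5)[OF f(1)] by blast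
    qed
    then show False using facet_subset_eq f F12 by blast
  qed
  have y1F2: "y1 \<notin> F2"
  proof
    assume a: "y1 \<in> F2"
    then have "y1 \<in> nbr v \<inter> F2" using y1(2) by simp
    then have "y1 = y2" unfolding y2(4) using y1(1) by auto
    then show False using y2F1 y1(3) by simp
  qed
  have kk: "k1 \<bullet> (x - v) = 0" "k1 \<bullet> (y1 - v) = 0" "k1 \<bullet> (y2 - v) > 0"
      "k2 \<bullet> (x - v) = 0" "k2 \<bullet> (y2 - v) = 0" "k2 \<bullet> (y1 - v) > 0"
    using k1 k2 inP f y1 y2 y1F2 y2F1 by (auto simp: order_less_le)
  have ind: "a = 0 \<and> b = 0 \<and> c = 0" if "a *\<^sub>R (x - v) + b *\<^sub>R (y1 - v) + c *\<^sub>R (y2 - v) = 0" for a b c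
  proof -
    have "k1 \<bullet> (a *\<^sub>R (x - v) + b *\<^sub>R (y1 - v) + c *\<^sub>R (y2 - v)) = 0"
      "k2 \<bullet> (a *\<^sub>R (x - v) + b *\<^sub>R (y1 - v) + c *\<^sub>R (y2 - v)) = 0" using that by simp_all
    then have "c = 0" "b = 0" using kk by (simp_all add: inner_add_right)
    then show ?thesis using that nbrD(1)[OF x] by auto
  qed
  have "\<exists>s t1 t2. 0 \<le> t1 \<and> 0 \<le> t2 \<and> p - v = s *\<^sub>R (x - v) + t1 *\<^sub>R (y1 - v) + t2 *\<^sub>R (y2 - v)" if p: "p \<in> P" for p
  proof -
    obtain s t1 t2 where e: "p - v = s *\<^sub>R (x - v) + t1 *\<^sub>R (y1 - v) + t2 *\<^sub>R (y2 - v)"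
      by (rule span3_UNIV[OF ind]) auto
    have "k1 \<bullet> (p - v) = t2 * (k1 \<bullet> (y2 - v))" "k2 \<bullet> (p - v) = t1 * (k2 \<bullet> (y1 - v))"
      unfolding e using kk by (simp_all add: inner_add_right)
    then have "0 \<le> t1" "0 \<le> t2" using k1(1)[OF p] k2(1)[OF p] kk by (auto simp: zero_le_mult_iff)
    with e show ?thesis by blast
  qed
  then show ?thesis using that[of F1 F2 y1 y2] f F12(1) y1 y2 ind uniq by blast
qed

text \<open>The part of the vertex figure over D, as a graph: its vertices are represented by
  neighbours of v, its edges by facets containing two of them.\<close>

definition link :: "real^3 \<Rightarrow> (real^3) set \<Rightarrow> ((real^3) \<times> (real^3)) set" where
  "link v D = {(x, y). x \<in> D \<and> y \<in> D \<and> (\<exists>F\<in>facets. {v, x, y} \<subseteq> F)}"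

lemma sym_link: "sym (link v D)"
  unfolding link_def sym_def by blast

lemma not_in_hyperplane: "a \<noteq> 0 \<Longrightarrow> \<exists>p\<in>P. a \<bullet> (p - v) \<noteq> 0"
proof (rule ccontr)
  assume a: "a \<noteq> 0" and "\<not> (\<exists>p\<in>P. a \<bullet> (p - v) \<noteq> 0)"
  then have "P \<subseteq> {x. a \<bullet> x = a \<bullet> v}" by (auto simp: inner_diff_right)
  then have "aff_dim P \<le> aff_dim {x. a \<bullet> x = a \<bullet> v}" by (rule aff_dim_subset)
  then show False using a dimP by (simp add: aff_dim_hyperplane)
qed

text \<open>Simplex descent for the ratio of l to w, where w exposes the vertex v.\<close>
lemma link_ratio_connected:
  assumes v: "v extreme_point_of P"
    and w: "\<And>p. p \<in> P \<Longrightarrow> p \<noteq> v \<Longrightarrow> 0 < w \<bullet> (p - v)"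
    and nonpar: "\<And>\<rho>. l - \<rho> *\<^sub>R w \<noteq> 0"
    and D: "D = {x \<in> nbr v. l \<bullet> (x - v) < c * (w \<bullet> (x - v))}"
    and xy: "x \<in> D" "y \<in> D"
  shows "(x, y) \<in> (link v D)\<^sup>*"
proof -
  \<comment> \<open>The value of \<open>l\<close>, measured from v, where the ray from v through z
    meets the plane \<open>w \<bullet> (p - v) = 1\<close>: a linear functional on the vertex
    figure.\<close>
  define r where "r z = (l \<bullet> (z - v)) / (w \<bullet> (z - v))" for z
  have wpos: "0 < w \<bullet> (z - v)" if "z \<in> nbr v" for z using w nbrD that by blast
  have Dr: "z \<in> D \<longleftrightarrow> z \<in> nbr v \<and> r z < c" for z
    unfolding D r_def using wpos[of z] by (auto simp: pos_divide_less_eq)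
  have fD: "finite D" using finite_nbr[of v] unfolding D by auto
  define \<mu> where "\<mu> = Min (r ` D)"
  have muD: "\<mu> \<le> r z" if "z \<in> D" for z unfolding \<mu>_def using that fD by simp
  have "\<mu> \<in> r ` D" unfolding \<mu>_def using fD xy by (intro Min_in) auto
  then obtain m where m: "m \<in> D" "r m = \<mu>" by auto
  \<comment> \<open>A minimum among the two adjacent edges is global:
    \<open>l - r z *\<^sub>R w\<close> vanishes along the edge to z and is nonnegative on both
    adjacent edges, so \<open>edge_wedge\<close> applies.\<close>
  have glob: "r z * (w \<bullet> (p - v)) \<le> l \<bullet> (p - v)" 
    if z: "z \<in> nbr v" and p: "p \<in> P"
      and y: "\<And>y F. y \<in> nbr v \<Longrightarrow> F \<in> facets \<Longrightarrow> {v, z, y} \<subseteq> F \<Longrightarrow> r z \<le> r y" for z p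
  proof -
    define g where "g = l - r z *\<^sub>R w"
    obtain F1 F2 y1 y2 where E: "F1 \<in> facets" "F2 \<in> facets" "{z, v, y1} \<subseteq> F1" "{z, v, y2} \<subseteq> F2"
      "y1 \<in> nbr v" "y2 \<in> nbr v"
      "\<And>p. p \<in> P \<Longrightarrow> \<exists>s t1 t2. 0 \<le> t1 \<and> 0 \<le> t2 \<and> p - v = s *\<^sub>R (z - v) + t1 *\<^sub>R (y1 - v) + t2 *\<^sub>R (y2 - v)"
      by (rule edge_wedge[OF z]) blast
    have "r z \<le> r y1" "r z \<le> r y2" using y[OF E(5,1)] y[OF E(6,2)] E by auto
    then have "g \<bullet> (y1 - v) \<ge> 0" "g \<bullet> (y2 - v) \<ge> 0"
      using wpos[OF E(5)] wpos[OF E(6)] unfolding g_def r_def[of y1] r_def[of y2]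
      by (auto simp: inner_diff_left pos_le_divide_eq)
    moreover have "g \<bullet> (z - v) = 0" unfolding g_def r_def using wpos[OF z] by (simp add: inner_diff_left)
    moreover obtain s t1 t2 where "0 \<le> t1" "0 \<le> t2" "p - v = s *\<^sub>R (z - v) + t1 *\<^sub>R (y1 - v) + t2 *\<^sub>R (y2 - v)"
      using E(7)[OF p] by blast
    ultimately have "0 \<le> g \<bullet> (p - v)" by (simp add: inner_add_right)
    then show ?thesis unfolding g_def by (simp add: inner_diff_left)
  qed
  have down: "\<exists>y\<in>D. r y < r z \<and> (z, y) \<in> link v D" if z: "z \<in> D" "\<mu> < r z" for z
  proof (rule ccontr)
    assume no: "\<not> ?thesis"
    have "r z \<le> r y" if "y \<in> nbr v" "F \<in> facets" "{v, z, y} \<subseteq> F" for y F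
    proof (rule ccontr)
      assume "\<not> r z \<le> r y"
      then have "y \<in> D" "r y < r z" using Dr that z by auto
      then show False using no that z unfolding link_def by blast
    qed
    then have "r z * (w \<bullet> (m - v)) \<le> l \<bullet> (m - v)"
      using glob[of z m] z m Dr nbrD(5) by blast
    then have "r z \<le> r m" unfolding r_def[of m] using wpos[of m] m Dr by (simp add: pos_le_divide_eq)
    then show False using m z by simp
  qed
  have tomin: "\<exists>y\<in>D. r y = \<mu> \<and> (z, y) \<in> (link v D)\<^sup>*" if "z \<in> D" for z
    using that
  proof (induction "card {y \<in> D. r y < r z}" arbitrary: z rule: less_induct)
    case less
    show ?case
    proof (cases "r z = \<mu>")
      case True then show ?thesis using less by blast
    next
      case False
      then have "\<mu> < r z" using muD[OF less.prems] by simp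
      then obtain y where y: "y \<in> D" "r y < r z" "(z, y) \<in> link v D" using down less.prems by blast
      have "{u \<in> D. r u < r y} \<subset> {u \<in> D. r u < r z}" using y by auto
      then have "card {u \<in> D. r u < r y} < card {u \<in> D. r u < r z}" using fD by (intro psubset_card_mono) auto
      then obtain u where u: "u \<in> D" "r u = \<mu>" "(y, u) \<in> (link v D)\<^sup>*" using less.hyps y by blast
      then show ?thesis using converse_rtrancl_into_rtrancl[OF y(3) u(3)] by blast
    qed
  qed
  \<comment> \<open>Two different minima lie, with v, in the face on which \<open>g\<close>
    vanishes. It contains two edges at v, and \<open>nonpar\<close> keeps it proper, so it is a
    facet that links them.\<close>
  have same: "(z, z') \<in> (link v D)\<^sup>*" if z: "z \<in> D" "r z = \<mu>" "z' \<in> D" "r z' = \<mu>" for z z'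
  proof (cases "z = z'")
    case False
    define g where "g = l - \<mu> *\<^sub>R w"
    have zn: "z \<in> nbr v" "z' \<in> nbr v" using z Dr by auto
    have ge: "0 \<le> g \<bullet> (p - v)" if "p \<in> P" for p
    proof -
      have "r z \<le> r y" if "y \<in> nbr v" for y
        using that z muD[of y] Dr[of y] Dr[of z] by (cases "r y < c") auto
      then show ?thesis using glob[OF zn(1) \<open>p \<in> P\<close>] z unfolding g_def by (auto simp: inner_diff_left)
    qed
    define G where "G = P \<inter> {p. g \<bullet> p = g \<bullet> v}"
    have Gf: "G face_of P" unfolding G_def
      by (rule face_of_Int_supporting_hyperplane_ge)
        (use ge polyP polytope_imp_convex in \<open>auto simp: inner_diff_right\<close>)
    have "l \<bullet> (y - v) = r y * (w \<bullet> (y - v))" if "y \<in> nbr v" for y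
      unfolding r_def using wpos[OF that] by simp
    then have "g \<bullet> (z - v) = 0" "g \<bullet> (z' - v) = 0" using z zn
      unfolding g_def by (simp_all add: inner_diff_left)
    then have inG: "v \<in> G" "z \<in> G" "z' \<in> G" using zn nbrD unfolding G_def by (auto simp: inner_diff_right)
    have g0: "g \<noteq> 0" unfolding g_def using nonpar .
    obtain p where p: "p \<in> P" "g \<bullet> (p - v) \<noteq> 0" using not_in_hyperplane[OF g0] by blast
    have "G \<noteq> P" using p unfolding G_def by (auto simp: inner_diff_right)
    then have lt: "aff_dim G < 3" using face_of_aff_dim_lt[OF _ Gf] polyP polytope_imp_convex dimP by metis
    have n0: "aff_dim G \<noteq> 0" using inG nbrD(1)[OF zn(1)] by (auto simp: aff_dim_eq_0)
    have n1: "aff_dim G \<noteq> 1"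
    proof
      assume "aff_dim G = 1"
      then obtain a b where G: "G = closed_segment a b" by (rule polytope_1_segment[OF polyP Gf])
      then have "z = a \<or> z = b" "z' = a \<or> z' = b" "v = a \<or> v = b"
        using inG Gf extreme_in_segment_face[of a b P] zn nbrD by blast+
      then show False using nbrD(1)[OF zn(1)] nbrD(1)[OF zn(2)] False by auto
    qed
    have "G \<noteq> {}" using inG by blast
    then have "aff_dim G \<ge> 0" using aff_dim_negative_iff[of G] by linarith
    then have "aff_dim G = 2" using lt n0 n1 by linarith
    then have "G \<in> facets" using Gf by (simp add: facets_def)
    then have "(z, z') \<in> link v D" using inG z unfolding link_def by blast
    then show ?thesis by blast
  qed auto
  obtain x' y' where x': "x' \<in> D" "r x' = \<mu>" "(x, x') \<in> (link v D)\<^sup>*"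
    and y': "y' \<in> D" "r y' = \<mu>" "(y, y') \<in> (link v D)\<^sup>*" using tomin xy by meson
  have "(y', y) \<in> (link v D)\<^sup>*" using y'(3) sym_rtrancl[OF sym_link] by (meson symD)
  then show ?thesis using x' same[OF x'(1,2) y'(1,2)] by (meson rtrancl_trans)
qed

text \<open>If l is a multiple of the functional w exposing v, all ratios agree and the descent says
  nothing. But then D consists of all neighbours of v, and these are also the sublevel set of any
  functional orthogonal to w, with a threshold one above its largest ratio.\<close>

lemma link_connected:
  assumes v: "v extreme_point_of P"
    and D: "D = {x \<in> nbr v. l \<bullet> (x - v) < 0}"
    and xy: "x \<in> D" "y \<in> D"
  shows "(x, y) \<in> (link v D)\<^sup>*"
proof -
  have "{v} face_of P" using v by (simp add: face_of_singleton)
  then obtain w where w0: "\<And>p. p \<in> P \<Longrightarrow> 0 \<le> w \<bullet> (p - v)" "\<And>p. p \<in> P \<Longrightarrow> w \<bullet> (p - v) = 0 \<longleftrightarrow> p \<in> {v}"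
    using exposing_functional[OF polyP, of "{v}" v] by blast
  then have w: "0 < w \<bullet> (p - v)" if "p \<in> P" "p \<noteq> v" for p using that by (auto simp: order_less_le)
  show ?thesis
  proof (cases "\<exists>\<rho>. l = \<rho> *\<^sub>R w")
    case False
    show ?thesis by (rule link_ratio_connected[OF v w, of l _ 0]) (use False D xy in auto)
  next
    case True
    then obtain \<rho> where \<rho>: "l = \<rho> *\<^sub>R w" by blast
    have "l \<bullet> (x - v) < 0" and xn: "x \<in> nbr v" using xy D by auto
    then have "\<rho> < 0" using w[of x] nbrD[OF xn] \<rho> by (auto simp: mult_less_0_iff)
    then have Dn: "D = nbr v" unfolding D \<rho> using w nbrD by (auto simp: mult_less_0_iff)
    obtain a :: "real^3" where a: "a \<noteq> 0" "orthogonal w a" using orthogonal_to_vector_exists[of w] by auto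
    have w0: "w \<noteq> 0" using w[of x] nbrD[OF xn] by auto
    define c where "c = Max ((\<lambda>z. (a \<bullet> (z - v)) / (w \<bullet> (z - v))) ` nbr v) + 1"
    have "a \<bullet> (z - v) < c * (w \<bullet> (z - v))" if z: "z \<in> nbr v" for z
    proof -
      have "(a \<bullet> (z - v)) / (w \<bullet> (z - v)) \<le> c - 1" unfolding c_def using finite_nbr z by auto
      then have "(a \<bullet> (z - v)) / (w \<bullet> (z - v)) < c" by simp
      then show ?thesis using w[of z] nbrD[OF z] by (simp add: pos_divide_less_eq)
    qed
    then have D': "D = {x \<in> nbr v. a \<bullet> (x - v) < c * (w \<bullet> (x - v))}" using Dn by auto
    have np: "a - \<rho> *\<^sub>R w \<noteq> 0" for \<rho>
    proof
      assume "a - \<rho> *\<^sub>R w = 0"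
      then have "a \<bullet> (a - \<rho> *\<^sub>R w) = 0" by simp
      then show False using a by (simp add: inner_diff_right orthogonal_def inner_commute)
    qed
    show ?thesis by (rule link_ratio_connected[OF v w np D' xy])
  qed
qed

end

text \<open>Each pair of points forbids the directions of one hyperplane only, and finitely many
  hyperplanes form a null set.\<close>

lemma separating_direction:
  fixes V :: "'a::euclidean_space set"
  assumes "finite V"
  obtains h where "\<And>x y. x \<in> V \<Longrightarrow> y \<in> V \<Longrightarrow> x \<noteq> y \<Longrightarrow> h \<bullet> x \<noteq> h \<bullet> y"
proof -
  let ?B = "\<Union>(x, y) \<in> {(x, y) \<in> V \<times> V. x \<noteq> y}. {h. (x - y) \<bullet> h = 0}"
  have "negligible ?B"
  proof (intro negligible_Union ballI)
    have "finite {(x, y) \<in> V \<times> V. x \<noteq> y}" by (rule finite_subset[of _ "V \<times> V"]) (use assms in auto)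
    then show "finite ((\<lambda>(x, y). {h. (x - y) \<bullet> h = 0}) ` {(x, y) \<in> V \<times> V. x \<noteq> y})" by simp
  qed (auto intro!: negligible_hyperplane)
  then have "?B \<noteq> UNIV" using non_negligible_UNIV by metis
  then obtain h where "h \<notin> ?B" by blast
  then have "(x - y) \<bullet> h \<noteq> 0" if "x \<in> V" "y \<in> V" "x \<noteq> y" for x y using that by blast
  then show ?thesis using that by (metis inner_commute inner_diff_left right_minus_eq)
qed

section \<open>Cross products and determinants in a plane\<close>

unbundle cross3_syntax

lemma cross_plane_relation:
  fixes a b c n :: "real^3"
  shows "((a \<times> b) \<bullet> n) *\<^sub>R c + ((b \<times> c) \<bullet> n) *\<^sub>R a + ((c \<times> a) \<bullet> n) *\<^sub>R b = ((a \<times> b) \<bullet> c) *\<^sub>R n"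
  by (simp add: cross3_simps forall_3)

text \<open>Cramer's rule in the plane orthogonal to n, where
  \<open>(a \<times> b) \<bullet> n\<close> is the determinant of a and b up to a factor common to
  all three brackets.\<close>

lemma plane_relation:
  fixes a b c n :: "real^3"
  assumes "n \<noteq> 0" "a \<bullet> n = 0" "b \<bullet> n = 0" "c \<bullet> n = 0"
  shows "((a \<times> b) \<bullet> n) *\<^sub>R c + ((b \<times> c) \<bullet> n) *\<^sub>R a + ((c \<times> a) \<bullet> n) *\<^sub>R b = 0"
proof -
  have "(((a \<times> b) \<bullet> n) *\<^sub>R c + ((b \<times> c) \<bullet> n) *\<^sub>R a + ((c \<times> a) \<bullet> n) *\<^sub>R b) \<bullet> n = 0"
    using assms by (simp add: inner_add_left)
  then have "((a \<times> b) \<bullet> c) * (n \<bullet> n) = 0" unfolding cross_plane_relation by simp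
  then show ?thesis unfolding cross_plane_relation using assms by simp
qed

lemma cross_normal_eq:
  fixes X Y n :: "real^3"
  shows "(X \<times> Y) \<times> n = (n \<bullet> X) *\<^sub>R Y - (n \<bullet> Y) *\<^sub>R X"
  by (simp add: cross3_simps forall_3)

text \<open>The two combinations are the directions in which the planes of two consecutive facets,
  spanned by W, X and by X, Z, meet the plane orthogonal to n. If \<open>n \<bullet> X\<close> is
  positive, their orientation in that plane is the one that W, X, Z have in space.\<close>

lemma cross_consecutive:
  fixes W X Z n :: "real^3"
  shows "((((n \<bullet> W) *\<^sub>R X - (n \<bullet> X) *\<^sub>R W) \<times> ((n \<bullet> X) *\<^sub>R Z - (n \<bullet> Z) *\<^sub>R X)) \<bullet> n) = (n \<bullet> X) * (n \<bullet> n) * ((W \<times> X) \<bullet> Z)"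
proof -
  have 1: "(n \<bullet> W) * ((X \<times> Z) \<bullet> n) - (n \<bullet> X) * ((W \<times> Z) \<bullet> n) + (n \<bullet> Z) * ((W \<times> X) \<bullet> n) = (n \<bullet> n) * ((W \<times> X) \<bullet> Z)"
    by (simp add: cross3_simps forall_3)
  have "((((n \<bullet> W) *\<^sub>R X - (n \<bullet> X) *\<^sub>R W) \<times> ((n \<bullet> X) *\<^sub>R Z - (n \<bullet> Z) *\<^sub>R X)) \<bullet> n)
    = (n \<bullet> X) * ((n \<bullet> W) * ((X \<times> Z) \<bullet> n) - (n \<bullet> X) * ((W \<times> Z) \<bullet> n) + (n \<bullet> Z) * ((W \<times> X) \<bullet> n))"
    by (simp add: cross_mult_left cross_mult_right left_diff_distrib right_diff_distrib
        Cross3.left_diff_distrib Cross3.right_diff_distrib inner_diff_left algebra_simps)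
  then show ?thesis unfolding 1 by simp
qed

lemma normal_parallel_cross:
  fixes X Y k :: "real^3"
  assumes ind: "\<And>a b. a *\<^sub>R X + b *\<^sub>R Y = 0 \<Longrightarrow> a = 0 \<and> b = 0" and k: "k \<bullet> X = 0" "k \<bullet> Y = 0"
  obtains c where "k = c *\<^sub>R (X \<times> Y)"
proof -
  let ?m = "X \<times> Y"
  have m0: "?m \<noteq> 0"
  proof
    assume "?m = 0"
    then have "collinear {0, X, Y}" by (simp add: cross_eq_0)
    then show False unfolding collinear_lemma
      using ind[of 1 0] ind[of 0 1] ind[of "- c" 1 for c] by auto
  qed
  have mX: "?m \<bullet> X = 0" "?m \<bullet> Y = 0" by (simp_all add: dot_cross_self)
  have ind3: "a = 0 \<and> b = 0 \<and> c = 0" if e: "a *\<^sub>R X + b *\<^sub>R Y + c *\<^sub>R ?m = 0" for a b c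
  proof -
    have "?m \<bullet> (a *\<^sub>R X + b *\<^sub>R Y + c *\<^sub>R ?m) = 0" using e by simp
    then have "c = 0" using m0 mX by (simp add: inner_add_right)
    then show ?thesis using e ind by simp
  qed
  obtain a b c where kk: "k = a *\<^sub>R X + b *\<^sub>R Y + c *\<^sub>R ?m" by (rule span3_UNIV[OF ind3]) auto
  have "k - c *\<^sub>R ?m = a *\<^sub>R X + b *\<^sub>R Y" using kk by simp
  then have "(k - c *\<^sub>R ?m) \<bullet> (k - c *\<^sub>R ?m) = (k - c *\<^sub>R ?m) \<bullet> (a *\<^sub>R X + b *\<^sub>R Y)" by simp
  also have "\<dots> = 0" using k mX by (simp add: inner_add_right inner_diff_left)
  finally have "k = c *\<^sub>R ?m" by simp
  then show ?thesis using that by blast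
qed

lemma odd_card_Int_pair: "a \<noteq> b \<Longrightarrow> odd (card (S \<inter> {a, b})) \<longleftrightarrow> (a \<in> S) \<noteq> (b \<in> S)"
  by (cases "a \<in> S"; cases "b \<in> S") auto

section \<open>Turning around a vertex, cuts and cocycles, the angle sum\<close>

context polyhedron3
begin

text \<open>Removing one edge does not disconnect the ring of facets around v. The functional
  exposing that edge is positive exactly at the other neighbours, so these form a set to which
  \<open>link_connected\<close> applies; and every facet at v, having two edges there, contains one
  of them. In this way one can turn about a vertex of the circuit without crossing the circuit edge
  that leaves it.\<close>

lemma facets_around_vertex:
  assumes x0: "x0 \<in> nbr v" and F: "F \<in> facets" "v \<in> F" and F': "F' \<in> facets" "v \<in> F'"
  shows "(F, F') \<in> {(G, G'). G \<in> facets \<and> G' \<in> facets \<and> (\<exists>x\<in>nbr v - {x0}. {v, x} \<subseteq> G \<inter> G')}\<^sup>*"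
    (is "_ \<in> ?R\<^sup>*")
proof -
  obtain k where k: "\<And>p. p \<in> P \<Longrightarrow> 0 \<le> k \<bullet> (p - v)" "\<And>p. p \<in> P \<Longrightarrow> k \<bullet> (p - v) = 0 \<longleftrightarrow> p \<in> closed_segment v x0"
    by (rule exposing_functional[OF polyP nbrD(2)[OF x0], of v]) auto
  define D where "D = {x \<in> nbr v. (- k) \<bullet> (x - v) < 0}"
  have D: "D = nbr v - {x0}"
  proof (intro set_eqI iffI)
    fix x assume x: "x \<in> D"
    then have "k \<bullet> (x - v) \<noteq> 0" "x \<in> nbr v" unfolding D_def by auto
    then show "x \<in> nbr v - {x0}" using k(2)[of x] nbrD(5) by auto
  next
    fix x assume x: "x \<in> nbr v - {x0}"
    then have "x \<notin> closed_segment v x0"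
      using extreme_in_segment_face[OF nbrD(2)[OF x0], of x] nbrD[of x v] by blast
    then have "k \<bullet> (x - v) \<noteq> 0" using k(2)[of x] nbrD(5)[of x v] x by auto
    then show "x \<in> D" unfolding D_def using x k(1)[of x] nbrD(5)[of x v] by auto
  qed
  have v: "v extreme_point_of P" using nbrD(4)[OF x0] .
  have ex: "\<exists>x\<in>D. x \<in> G" if G: "G \<in> facets" "v \<in> G" for G
  proof -
    obtain a b where "a \<noteq> b" "a \<in> nbr v" "b \<in> nbr v" "nbr v \<inter> G = {a, b}"
      by (rule facet_corner[OF G(1) v G(2)]) blast
    then show ?thesis unfolding D by blast
  qed
  obtain x x' where x: "x \<in> D" "x \<in> F" "x' \<in> D" "x' \<in> F'" using ex F F' by meson
  have "(x, x') \<in> (link v D)\<^sup>*" by (rule link_connected[OF v D_def x(1,3)])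
  then have "\<forall>G\<in>facets. {v, x'} \<subseteq> G \<longrightarrow> (F, G) \<in> ?R\<^sup>*"
  proof (induction rule: rtrancl_induct)
    case base
    then show ?case using F x D by blast
  next
    case (step y z)
    obtain G where G: "G \<in> facets" "{v, y, z} \<subseteq> G" using step(2) unfolding link_def by blast
    have "(F, G) \<in> ?R\<^sup>*" using step(3) G by blast
    moreover have "(G, G') \<in> ?R" if "G' \<in> facets" "{v, z} \<subseteq> G'" for G'
      using that G step(2) D unfolding link_def by blast
    ultimately show ?case by (meson rtrancl.rtrancl_into_rtrancl)
  qed
  then show ?thesis using F' x by blast
qed

text \<open>The first cohomology of the surface modulo 2 vanishes: sweep the vertices by a generic linear
  functional; the lower link of a vertex is connected, which makes the new value well defined.\<close>
lemma cocycle_is_cut: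
  assumes C: "C \<subseteq> poly_edges P" and even: "\<And>F. F \<in> facets \<Longrightarrow> even (card {e \<in> C. e \<subseteq> F})"
  obtains s :: "real^3 \<Rightarrow> bool" where "\<And>x y. y \<in> nbr x \<Longrightarrow> closed_segment x y \<in> C \<longleftrightarrow> s x \<noteq> s y"
proof -
  define V where "V = {x. x extreme_point_of P}"
  have fV: "finite V" unfolding V_def using finite_extreme_points[OF polyP] .
  obtain h where h: "\<And>x y. x \<in> V \<Longrightarrow> y \<in> V \<Longrightarrow> x \<noteq> y \<Longrightarrow> h \<bullet> x \<noteq> h \<bullet> y"
    by (rule separating_direction[OF fV]) blast
  \<comment> \<open>The sets A are the initial segments of the vertices in order of height; each
    step adds the topmost one.\<close>
  have "\<exists>s :: real^3 \<Rightarrow> bool. \<forall>x\<in>A. \<forall>y\<in>A. y \<in> nbr x \<longrightarrow> (closed_segment x y \<in> C \<longleftrightarrow> s x \<noteq> s y)"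
    if "A \<subseteq> V" "\<forall>a\<in>A. \<forall>u\<in>V. h \<bullet> u < h \<bullet> a \<longrightarrow> u \<in> A" for A
    using that
  proof (induction "card A" arbitrary: A)
    case 0
    then have "A = {}" using finite_subset[OF 0(2) fV] by simp
    then show ?case by simp
  next
    case (Suc n)
    have fA: "finite A" using finite_subset[OF Suc(3) fV] .
    then have Ane: "A \<noteq> {}" using Suc by auto
    have "Max ((\<bullet>) h ` A) \<in> (\<bullet>) h ` A" using fA Ane by (intro Max_in) auto
    then obtain v where v: "v \<in> A" "h \<bullet> v = Max ((\<bullet>) h ` A)" by auto
    have top: "h \<bullet> a \<le> h \<bullet> v" if "a \<in> A" for a unfolding v(2) using fA that by simp
    have vV: "v \<in> V" using v Suc by auto
    have top': "h \<bullet> a < h \<bullet> v" if "a \<in> A" "a \<noteq> v" for a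
      using top[OF that(1)] h[of a v] that vV Suc(3) by force
    define A' where "A' = A - {v}"
    have "card A' = n" unfolding A'_def using Suc v fA by simp
    moreover have "A' \<subseteq> V" unfolding A'_def using Suc by auto
    moreover have "\<forall>a\<in>A'. \<forall>u\<in>V. h \<bullet> u < h \<bullet> a \<longrightarrow> u \<in> A'"
      unfolding A'_def using Suc(4) top' by force
    ultimately have "\<exists>s :: real^3 \<Rightarrow> bool. \<forall>x\<in>A'. \<forall>y\<in>A'. y \<in> nbr x \<longrightarrow> (closed_segment x y \<in> C \<longleftrightarrow> s x \<noteq> s y)"
      using Suc(1)[of A'] by simp
    then obtain s :: "real^3 \<Rightarrow> bool" where s: "\<And>x y. x \<in> A' \<Longrightarrow> y \<in> A' \<Longrightarrow> y \<in> nbr x \<Longrightarrow> closed_segment x y \<in> C \<longleftrightarrow> s x \<noteq> s y"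
      by blast
    define D where "D = {x \<in> nbr v. h \<bullet> (x - v) < 0}"
    \<comment> \<open>The value that the edge from v to x forces upon v; all lower neighbours have
      to agree on it.\<close>
    define t where "t x \<longleftrightarrow> s x \<noteq> (closed_segment v x \<in> C)" for x
    have lowA: "u \<in> A'" if "u \<in> V" "h \<bullet> u < h \<bullet> v" for u
      using Suc(4)[rule_format, OF v(1) that] that(2) unfolding A'_def by auto
    \<comment> \<open>If both edges of a facet at v descend, v is its top, and s already explains
      \<open>C\<close> on its edges off v. Both \<open>C\<close> and the cut given by s, with v
      counted as false, meet the facet in an even number of edges; so their symmetric difference,
      which can only contain the two edges at v, contains both or none.\<close>
    have step: "t x = t y" if xy: "(x, y) \<in> link v D" for x y
    proof (cases "x = y")
      case False
      obtain F where F: "F \<in> facets" "{v, x, y} \<subseteq> F" using xy unfolding link_def by blast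
      have xD: "x \<in> D" "y \<in> D" using xy unfolding link_def by auto
      then have xn: "x \<in> nbr v" "y \<in> nbr v" "h \<bullet> (x - v) < 0" "h \<bullet> (y - v) < 0" unfolding D_def by auto
      obtain y' where y': "nbr v \<inter> F = {x, y'}"
        "\<And>p. p \<in> F \<Longrightarrow> \<exists>s t. 0 \<le> s \<and> 0 \<le> t \<and> p - v = s *\<^sub>R (x - v) + t *\<^sub>R (y' - v)"
        by (rule facet_corner_other[OF F(1) xn(1)]) (use F in auto)
      have "y \<in> nbr v \<inter> F" using F xn by simp
      then have "y = y'" unfolding y'(1) using False by simp
      note cone = y'(2)[folded this] and nF = y'(1)[folded this]
      have low: "h \<bullet> p < h \<bullet> v" if p: "p \<in> F" "p \<noteq> v" for p
      proof -
        obtain a b where ab: "0 \<le> a" "0 \<le> b" "p - v = a *\<^sub>R (x - v) + b *\<^sub>R (y - v)" using cone[OF p(1)] by blast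
        have "a \<noteq> 0 \<or> b \<noteq> 0" using ab p by auto
        then have "a * (h \<bullet> (x - v)) + b * (h \<bullet> (y - v)) < 0"
          using ab xn by (metis add_neg_nonpos add_nonpos_neg less_eq_real_def mult_nonneg_nonpos mult_pos_neg)
        then have "h \<bullet> (p - v) < 0" unfolding ab(3) by (simp add: inner_add_right)
        then show ?thesis by (simp add: inner_diff_right)
      qed
      define S where "S = {z. z extreme_point_of F \<and> z \<noteq> v \<and> s z}"
      define EF where "EF = {e. e face_of F \<and> aff_dim e = 1}"
      define Od where "Od = {e \<in> EF. odd (card (S \<inter> e))}"
      define K where "K = {e \<in> EF. e \<in> C}"
      have fEF: "finite EF" unfolding EF_def using finite_face_set[OF facetD(3)[OF F(1)]] .
      have evO: "even (card Od)"
        using polygon_cut_even[OF facetD(3,2)[OF F(1)], of S] unfolding S_def Od_def EF_def by (simp add: conj_assoc Collect_mono)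
      have "K = {e \<in> C. e \<subseteq> F}"
        unfolding K_def EF_def using C edge_in_face[OF _ _ facetD(1)[OF F(1)]] face_of_imp_subset
        unfolding poly_edges_def by blast
      then have evK: "even (card K)" using even[OF F(1)] by simp
      have fin: "finite Od" "finite K" unfolding Od_def K_def using fEF by auto
      have cO: "card Od = card (Od \<inter> K) + card (Od - K)" using fin by (simp add: card_Int_Diff)
      have cK: "card K = card (Od \<inter> K) + card (K - Od)" using fin card_Int_Diff[of K Od] by (simp add: Int_commute)
      define SD where "SD = (Od - K) \<union> (K - Od)"
      have "card SD = card (Od - K) + card (K - Od)" unfolding SD_def using fin by (intro card_Un_disjoint) auto
      then have evSD: "even (card SD)" using evO evK cO cK by presburger
      have exF: "z extreme_point_of F \<longleftrightarrow> z extreme_point_of P \<and> z \<in> F" for z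
        using extreme_point_of_face[OF facetD(1)[OF F(1)]] by auto
      have edge: "\<exists>a b. a \<noteq> b \<and> e = closed_segment a b \<and> a extreme_point_of F \<and> b extreme_point_of F"
        if e: "e \<in> EF" for e
        by (rule polytope_1_segment[OF facetD(3)[OF F(1)], of e]) (use e in \<open>auto simp: EF_def\<close>)
      have Se: "S \<inter> closed_segment a b = S \<inter> {a, b}" if "closed_segment a b \<in> EF" for a b
        using extreme_in_segment_face[of a b F] that unfolding EF_def S_def by auto
      have other: "e \<notin> SD" if e: "e \<in> EF" "v \<notin> e" for e
      proof -
        obtain a b where ab: "a \<noteq> b" "e = closed_segment a b" "a extreme_point_of F" "b extreme_point_of F"
          using edge[OF e(1)] by blast
        have nv: "a \<noteq> v" "b \<noteq> v" using ab e by auto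
        have A': "a \<in> A'" "b \<in> A'" using lowA low nv ab(3,4) exF unfolding V_def by auto
        have "b \<in> nbr a" unfolding nbr_def using poly_edge_face[OF facetD(1)[OF F(1)]] e ab unfolding EF_def by auto
        then have "e \<in> C \<longleftrightarrow> s a \<noteq> s b" using s A' ab by simp
        moreover have "odd (card (S \<inter> e)) \<longleftrightarrow> s a \<noteq> s b"
          using Se[of a b] odd_card_Int_pair[OF ab(1), of S] e ab nv unfolding S_def by auto
        ultimately show ?thesis unfolding SD_def Od_def K_def by auto
      qed
      have atv: "closed_segment v w \<in> SD \<longleftrightarrow> t w" if w: "w \<in> nbr v" "w \<in> F" for w
      proof -
        have wE: "closed_segment v w \<in> EF" unfolding EF_def
          using nbr_in_facet[OF w(1) F(1) w(2)] F aff_dim_segment[of v w] nbrD(1)[OF w(1)] by auto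
        have "w extreme_point_of F" using exF w nbrD by auto
        then have "odd (card (S \<inter> closed_segment v w)) \<longleftrightarrow> s w"
          using Se[OF wE] odd_card_Int_pair[of v w S] nbrD(1)[OF w(1)] unfolding S_def by auto
        then show ?thesis unfolding SD_def Od_def K_def t_def using wE by auto
      qed
      have "SD \<subseteq> {closed_segment v x, closed_segment v y}"
      proof
        fix e assume e: "e \<in> SD"
        then have eE: "e \<in> EF" unfolding SD_def Od_def K_def by auto
        then have ve: "v \<in> e" using other e by blast
        obtain a b where ab: "a \<noteq> b" "e = closed_segment a b" using edge[OF eE] by blast
        have "v = a \<or> v = b"
          using extreme_in_segment_face[of a b F v] eE ab ve exF vV F unfolding EF_def V_def by auto
        from this obtain w where w: "w \<noteq> v" "e = closed_segment v w"
        proof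
          assume "v = a" then show ?thesis using ab that[of b] by simp
        next
          assume "v = b" then show ?thesis using ab that[of a] by (simp add: closed_segment_commute)
        qed
        have "w \<in> nbr v" unfolding nbr_def using poly_edge_face[OF facetD(1)[OF F(1)]] eE w unfolding EF_def by auto
        moreover have "w \<in> F" using eE w face_of_imp_subset[of e F] unfolding EF_def by auto
        ultimately show "e \<in> {closed_segment v x, closed_segment v y}" using nF w by auto
      qed
      moreover have ne: "closed_segment v x \<noteq> closed_segment v y"
        using False by (auto simp: closed_segment_eq doubleton_eq_iff)
      moreover have "closed_segment v x \<in> SD \<longleftrightarrow> t x" "closed_segment v y \<in> SD \<longleftrightarrow> t y" using atv xn F by auto
      ultimately have "SD = (if t x then {closed_segment v x} else {}) \<union> (if t y then {closed_segment v y} else {})"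
        by auto
      then show ?thesis using evSD ne by (cases "t x"; cases "t y") auto
    qed auto
    have const: "t x = t y" if "x \<in> D" "y \<in> D" for x y
    proof -
      have "(x, y) \<in> (link v D)\<^sup>*"
        by (rule link_connected[OF _ D_def that]) (use vV V_def in auto)
      then show ?thesis by (induction rule: rtrancl_induct) (use step in auto)
    qed
    \<comment> \<open>Without lower neighbours nothing is prescribed at v, so s is kept.\<close>
    define s' where "s' = (if D = {} then s else s(v := t (SOME u. u \<in> D)))"
    have s'v: "s' v = t x" if "x \<in> D" for x
      using that const[OF that someI[of "\<lambda>u. u \<in> D", OF that]] unfolding s'_def by auto
    have s'o: "s' x = s x" if "x \<noteq> v" for x using that unfolding s'_def by auto
    have toD: "x \<in> D" if "x \<in> A" "x \<in> nbr v" for x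
      using top'[OF that(1)] nbrD(1)[OF that(2)] that unfolding D_def by (auto simp: inner_diff_right)
    have at_v: "closed_segment v x \<in> C \<longleftrightarrow> s' v \<noteq> s' x" if "x \<in> A" "x \<in> nbr v" for x
      using s'v[OF toD[OF that]] s'o[OF nbrD(1)[OF that(2)]] unfolding t_def by auto
    have "closed_segment x y \<in> C \<longleftrightarrow> s' x \<noteq> s' y" if "x \<in> A" "y \<in> A" "y \<in> nbr x" for x y
    proof -
      consider "x = v" | "y = v" | "x \<noteq> v" "y \<noteq> v" by blast
      then show ?thesis
      proof cases
        case 1 then show ?thesis using at_v that by blast
      next
        case 2 then show ?thesis using at_v[of x] nbrD(7)[OF that(3)] that by (auto simp: closed_segment_commute)
      next
        case 3 then show ?thesis using s[of x y] s'o that unfolding A'_def by auto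
      qed
    qed
    then show ?case by blast
  qed
  from this[of V] obtain s :: "real^3 \<Rightarrow> bool" where s: "\<forall>x\<in>V. \<forall>y\<in>V. y \<in> nbr x \<longrightarrow> (closed_segment x y \<in> C \<longleftrightarrow> s x \<noteq> s y)" by auto
  show ?thesis
  proof (rule that[of s])
    fix x y assume xy: "y \<in> nbr x"
    then have "x \<in> V" "y \<in> V" using nbrD(3,4)[OF xy] unfolding V_def by auto
    then show "closed_segment x y \<in> C \<longleftrightarrow> s x \<noteq> s y" using s xy by blast
  qed
qed

text \<open>By \<open>cocycle_is_cut\<close> an edge set with even faces separates two classes of
  vertices. A class cannot change along an edge of T, and T reaches every vertex, so no edge is left
  to separate.\<close>

lemma even_edge_set_meets_spanning:
  assumes C: "C \<subseteq> poly_edges P" "C \<inter> T = {}" and even: "\<And>F. F \<in> facets \<Longrightarrow> even (card {e \<in> C. e \<subseteq> F})"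
    and T: "T \<subseteq> poly_edges P" "\<And>u v. u \<in> poly_vertices P \<Longrightarrow> v \<in> poly_vertices P \<Longrightarrow> (u, v) \<in> (tree_link T)\<^sup>*"
  shows "C = {}"
proof (rule ccontr)
  assume "C \<noteq> {}"
  then obtain e where e: "e \<in> C" by blast
  obtain s :: "real^3 \<Rightarrow> bool" where s: "\<And>x y. y \<in> nbr x \<Longrightarrow> closed_segment x y \<in> C \<longleftrightarrow> s x \<noteq> s y"
    by (rule cocycle_is_cut[OF C(1) even]) blast+
  have "e face_of P" "aff_dim e = 1" using e C by (auto simp: poly_edges_def)
  then obtain x y where xy: "e = closed_segment x y" "x extreme_point_of P" "y extreme_point_of P"
    by (rule polytope_1_segment[OF polyP])
  have "s x = s z" if "(x, z) \<in> (tree_link T)\<^sup>*" for z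
    using that
  proof (induction rule: rtrancl_induct)
    case (step y z)
    have yz: "closed_segment y z \<in> T" using step(2) by (simp add: tree_link_def)
    then have "z \<in> nbr y" unfolding nbr_def using T by blast
    then show ?case using s[of z y] yz C step by blast
  qed auto
  then have "s x = s y" using T(2) xy by (simp add: poly_vertices_def)
  moreover have "y \<in> nbr x" unfolding nbr_def using e C xy by auto
  ultimately show False using s e xy by blast
qed

text \<open>The order of the two edges is chosen such that their cross product is the inner normal.
  These local choices fit together to an orientation of the vertex figure: each edge at v is the
  first one of one facet and the second one of the other.\<close>

lemma facet_oriented_corner:
  assumes F: "F \<in> facets" and v: "v extreme_point_of P" "v \<in> F"
  shows "\<exists>x y. x \<noteq> y \<and> x \<in> nbr v \<and> y \<in> nbr v \<and> nbr v \<inter> F = {x, y} \<and> face_angle F v = ang (x - v) (y - v) \<and>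
    (\<forall>a b. a *\<^sub>R (x - v) + b *\<^sub>R (y - v) = 0 \<longrightarrow> a = 0 \<and> b = 0) \<and>
    (\<forall>p\<in>P. 0 \<le> ((x - v) \<times> (y - v)) \<bullet> (p - v)) \<and>
    (\<forall>p\<in>P. ((x - v) \<times> (y - v)) \<bullet> (p - v) = 0 \<longleftrightarrow> p \<in> F)"
proof -
  obtain x y where xy: "x \<noteq> y" "x \<in> nbr v" "y \<in> nbr v" "nbr v \<inter> F = {x, y}"
    "face_angle F v = ang (x - v) (y - v)"
    "\<And>a b. a *\<^sub>R (x - v) + b *\<^sub>R (y - v) = 0 \<Longrightarrow> a = 0 \<and> b = 0"
    by (rule facet_corner[OF F v]) blast
  obtain k where k: "\<And>p. p \<in> P \<Longrightarrow> 0 \<le> k \<bullet> (p - v)" "\<And>p. p \<in> P \<Longrightarrow> k \<bullet> (p - v) = 0 \<longleftrightarrow> p \<in> F"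
    by (rule facet_normal[OF F v(2)]) blast
  have "x \<in> F" "y \<in> F" using xy(4) by auto
  then have "k \<bullet> (x - v) = 0" "k \<bullet> (y - v) = 0" using k(2) nbrD(5) xy by auto
  then obtain c where c: "k = c *\<^sub>R ((x - v) \<times> (y - v))" using normal_parallel_cross[OF xy(6)] by blast
  obtain p where "p \<in> P" "p \<notin> F" using facetD[OF F] dimP by (metis numeral_eq_iff num.distinct(5) subsetI subset_antisym)
  then have "c \<noteq> 0" using k(2)[of p] c by auto
  then consider "c > 0" | "c < 0" by linarith
  then show ?thesis
  proof cases
    case 1
    have "((x - v) \<times> (y - v)) = (1 / c) *\<^sub>R k" using 1 c by simp
    then have "((x - v) \<times> (y - v)) \<bullet> q = (1 / c) * (k \<bullet> q)" for q by simp
    then show ?thesis using xy k 1 by (intro exI[of _ x] exI[of _ y]) auto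
  next
    case 2
    have "((y - v) \<times> (x - v)) = (- 1 / c) *\<^sub>R k" using 2 c cross_skew[of "y - v" "x - v"] by simp
    then have e: "((y - v) \<times> (x - v)) \<bullet> q = (- 1 / c) * (k \<bullet> q)" for q by simp
    have "0 \<le> (- 1 / c) * (k \<bullet> (q - v))" if "q \<in> P" for q
      using k(1)[OF that] 2 by (intro mult_nonneg_nonneg) auto
    moreover have "(- 1 / c) * (k \<bullet> (q - v)) = 0 \<longleftrightarrow> q \<in> F" if "q \<in> P" for q
      using k(2)[OF that] 2 by auto
    moreover have "a = 0 \<and> b = 0" if "a *\<^sub>R (y - v) + b *\<^sub>R (x - v) = 0" for a b
      using xy(6)[of b a] that by (simp add: add.commute)
    ultimately show ?thesis using xy e
      by (intro exI[of _ y] exI[of _ x]) (auto simp: ang_commute)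
  qed
qed

text \<open>Telescoping: for a fixed facet N at v with inner normal n, let the plane of every other facet F at v,
  with oriented edge directions X and Y, meet the plane of N in the direction y F.  The
  potential A (B) of an edge is the angular distance from the edge, via y F for the facet F following (preceding) it, to the edge of
  N on which the remaining circuit around v starts.  The triangle inequality makes the potential drop at every edge.\<close>
theorem face_angle_sum_less:
  assumes v: "v extreme_point_of P"
  shows "(\<Sum>F | F \<in> facets \<and> v \<in> F. face_angle F v) < 2 * pi"
proof (cases "{F \<in> facets. v \<in> F} = {}")
  case True
  then show ?thesis by (simp only:) simp
next
  case False
  define Fv where "Fv = {F \<in> facets. v \<in> F}"
  obtain N where N: "N \<in> Fv" using False Fv_def by blast
  obtain fX fY where f: "\<And>F. F \<in> Fv \<Longrightarrow> fX F \<noteq> fY F \<and> fX F \<in> nbr v \<and> fY F \<in> nbr v \<and> nbr v \<inter> F = {fX F, fY F} \<and>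
     face_angle F v = ang (fX F - v) (fY F - v) \<and>
    (\<forall>a b. a *\<^sub>R (fX F - v) + b *\<^sub>R (fY F - v) = 0 \<longrightarrow> a = 0 \<and> b = 0) \<and>
    (\<forall>p\<in>P. 0 \<le> ((fX F - v) \<times> (fY F - v)) \<bullet> (p - v)) \<and>
    (\<forall>p\<in>P. ((fX F - v) \<times> (fY F - v)) \<bullet> (p - v) = 0 \<longleftrightarrow> p \<in> F)"
    using facet_oriented_corner[OF _ v] unfolding Fv_def mem_Collect_eq by metis
  have fin: "finite Fv" unfolding Fv_def using finite_facets by simp
  have inF: "fX F \<in> F" "fY F \<in> F" if "F \<in> Fv" for F using f[OF that] by auto
  have wedge: thesis if F: "F \<in> Fv" "x \<in> F" "x \<in> nbr v"
    and that: "\<And>G W Z. F \<noteq> G \<Longrightarrow> G \<in> Fv \<Longrightarrow> nbr v \<inter> F = {x, W} \<Longrightarrow> nbr v \<inter> G = {x, Z} \<Longrightarrow> W \<notin> G \<Longrightarrow> Z \<notin> F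
      \<Longrightarrow> W \<in> nbr v \<Longrightarrow> Z \<in> nbr v
      \<Longrightarrow> \<forall>a b c. a *\<^sub>R (x - v) + b *\<^sub>R (W - v) + c *\<^sub>R (Z - v) = 0 \<longrightarrow> a = 0 \<and> b = 0 \<and> c = 0
      \<Longrightarrow> \<forall>H\<in>Fv. x \<in> H \<longrightarrow> H = F \<or> H = G \<Longrightarrow> thesis" for F x thesis
  proof -
    obtain F1 F2 y1 y2 where E: "F1 \<in> facets" "F2 \<in> facets" "F1 \<noteq> F2" "{x, v, y1} \<subseteq> F1" "{x, v, y2} \<subseteq> F2"
      "y1 \<in> nbr v" "y2 \<in> nbr v" "y1 \<noteq> x" "y2 \<noteq> x"
      "\<And>a b c. a *\<^sub>R (x - v) + b *\<^sub>R (y1 - v) + c *\<^sub>R (y2 - v) = 0 \<Longrightarrow> a = 0 \<and> b = 0 \<and> c = 0"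
      "\<And>F. F \<in> facets \<Longrightarrow> x \<in> F \<Longrightarrow> v \<in> F \<Longrightarrow> F = F1 \<or> F = F2"
      by (rule edge_wedge[OF F(3)]) blast
    have n1: "nbr v \<inter> F1 = {x, y1}" 
      by (rule facet_corner_other[OF E(1) F(3)]) (use E in auto)
    have n2: "nbr v \<inter> F2 = {x, y2}" 
      by (rule facet_corner_other[OF E(2) F(3)]) (use E in auto)
    have "y1 \<noteq> y2" using E(10)[of 0 1 "-1"] by auto
    then have o: "y1 \<notin> F2" "y2 \<notin> F1" using n1 n2 E by auto
    have u: "\<forall>H\<in>Fv. x \<in> H \<longrightarrow> H = F1 \<or> H = F2" using E(11) unfolding Fv_def by blast
    have m: "F1 \<in> Fv" "F2 \<in> Fv" using E unfolding Fv_def by auto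
    have i: "\<forall>a b c. a *\<^sub>R (x - v) + b *\<^sub>R (y1 - v) + c *\<^sub>R (y2 - v) = 0 \<longrightarrow> a = 0 \<and> b = 0 \<and> c = 0"
      using E(10) by blast
    have i': "\<forall>a b c. a *\<^sub>R (x - v) + b *\<^sub>R (y2 - v) + c *\<^sub>R (y1 - v) = 0 \<longrightarrow> a = 0 \<and> b = 0 \<and> c = 0"
    proof (intro allI impI)
      fix a b c assume "a *\<^sub>R (x - v) + b *\<^sub>R (y2 - v) + c *\<^sub>R (y1 - v) = 0"
      then have "a *\<^sub>R (x - v) + c *\<^sub>R (y1 - v) + b *\<^sub>R (y2 - v) = 0" by (simp add: algebra_simps)
      from E(10)[OF this] show "a = 0 \<and> b = 0 \<and> c = 0" by blast
    qed
    have u': "\<forall>H\<in>Fv. x \<in> H \<longrightarrow> H = F2 \<or> H = F1" using u by blast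
    consider "F = F1" | "F = F2" using u F by blast
    then show ?thesis
    proof cases
      case 1
      show ?thesis by (rule that[of F2 y1 y2, unfolded 1]) (fact E(3) m n1 n2 o E(6,7) i u)+
    next
      case 2
      show ?thesis by (rule that[of F1 y2 y1, unfolded 2]) (fact E(3)[symmetric] m n1 n2 o E(6,7) i' u')+
    qed
  qed
  have cross_swap: "((a \<times> b) \<bullet> c) = - ((c \<times> b) \<bullet> a)" "((a \<times> b) \<bullet> c) = - ((a \<times> c) \<bullet> b)" for a b c :: "real^3"
    by (simp_all add: cross3_simps)
  \<comment> \<open>Two facets traverse their common edge in opposite directions. Otherwise one
    nonzero determinant would be nonnegative both before and after an exchange of two
    columns.\<close>
  have injX: "F = G" if FG: "F \<in> Fv" "G \<in> Fv" "fX F = fX G" for F G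
  proof (rule ccontr)
    assume ne: "F \<noteq> G"
    let ?x = "fX F"
    obtain G' W Z where w: "G' \<in> Fv" "nbr v \<inter> F = {?x, W}" "nbr v \<inter> G' = {?x, Z}" "W \<notin> G'" "Z \<notin> F"
      "\<forall>H\<in>Fv. ?x \<in> H \<longrightarrow> H = F \<or> H = G'"
      by (rule wedge[of F ?x]) (use f[OF FG(1)] inF[OF FG(1)] FG(1) in blast)+
    have "?x \<in> G" using inF FG by metis
    then have "G' = G" using w(6) ne FG by blast
    have "fY F = W" "fY G = Z" using w f FG \<open>G' = G\<close> by (metis doubleton_eq_iff)+
    then have "((?x - v) \<times> (W - v)) \<bullet> (Z - v) \<ge> 0" "((?x - v) \<times> (W - v)) \<bullet> (Z - v) \<noteq> 0"
      "((?x - v) \<times> (Z - v)) \<bullet> (W - v) \<ge> 0"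
      using f[OF FG(1)] f[OF FG(2)] FG(3) w nbrD(5) by metis+
    then show False using cross_swap(2)[of "?x - v" "W - v" "Z - v"] by linarith
  qed
  have injY: "F = G" if FG: "F \<in> Fv" "G \<in> Fv" "fY F = fY G" for F G
  proof (rule ccontr)
    assume ne: "F \<noteq> G"
    let ?x = "fY F"
    obtain G' W Z where w: "G' \<in> Fv" "nbr v \<inter> F = {?x, W}" "nbr v \<inter> G' = {?x, Z}" "W \<notin> G'" "Z \<notin> F"
      "\<forall>H\<in>Fv. ?x \<in> H \<longrightarrow> H = F \<or> H = G'"
      by (rule wedge[of F ?x]) (use f[OF FG(1)] inF[OF FG(1)] FG(1) in blast)+
    have "?x \<in> G" using inF FG by metis
    then have "G' = G" using w(6) ne FG by blast
    have "fX F = W" "fX G = Z" using w f FG \<open>G' = G\<close> by (metis doubleton_eq_iff)+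
    then have "((W - v) \<times> (?x - v)) \<bullet> (Z - v) \<ge> 0" "((W - v) \<times> (?x - v)) \<bullet> (Z - v) \<noteq> 0"
      "((Z - v) \<times> (?x - v)) \<bullet> (W - v) \<ge> 0"
      using f[OF FG(1)] f[OF FG(2)] FG(3) w nbrD(5) by metis+
    then show False using cross_swap(1)[of "W - v" "?x - v" "Z - v"] by linarith
  qed
  have surj: "\<exists>F\<in>Fv. fX F = x" "\<exists>F\<in>Fv. fY F = x" if x: "x \<in> nbr v" for x
  proof -
    have "closed_segment v x \<in> poly_edges P" using x by (simp add: nbr_def)
    then obtain F1 F2 where "F1 \<noteq> F2" "{F \<in> facets. closed_segment v x \<subseteq> F} = {F1, F2}"
      by (rule edge_two_facets)
    then have F: "F1 \<in> Fv" "F2 \<in> Fv" "x \<in> F1" "x \<in> F2" "F1 \<noteq> F2" unfolding Fv_def by auto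
    have "x = fX F1 \<or> x = fY F1" "x = fX F2 \<or> x = fY F2" using f[OF F(1)] f[OF F(2)] F x by auto
    then show "\<exists>F\<in>Fv. fX F = x" "\<exists>F\<in>Fv. fY F = x" using injX injY F by metis+
  qed
  define gX where "gX = inv_into Fv fX"
  define gY where "gY = inv_into Fv fY"
  have iX: "inj_on fX Fv" and iY: "inj_on fY Fv" using injX injY by (auto simp: inj_on_def)
  have imX: "fX ` Fv = nbr v" and imY: "fY ` Fv = nbr v" using f surj by (auto simp: image_iff) metis+
  define n where "n = (fX N - v) \<times> (fY N - v)"
  define y where "y F = ((fX F - v) \<times> (fY F - v)) \<times> n" for F
  have y_eq: "y F = (n \<bullet> (fX F - v)) *\<^sub>R (fY F - v) - (n \<bullet> (fY F - v)) *\<^sub>R (fX F - v)" for F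
    unfolding y_def by (rule cross_normal_eq)
  have npos: "0 \<le> n \<bullet> (p - v)" "n \<bullet> (p - v) = 0 \<longleftrightarrow> p \<in> N" if "p \<in> P" for p
    using f[OF N] that unfolding n_def by auto
  let ?x0 = "fY N" and ?xk = "fX N"
  have x0: "?x0 \<in> nbr v" "?xk \<in> nbr v" "?x0 \<noteq> ?xk" using f[OF N] by auto
  have nbrN: "x \<in> N \<longleftrightarrow> x = ?x0 \<or> x = ?xk" if "x \<in> nbr v" for x using f[OF N] that by auto
  have nN: "n \<bullet> (x - v) = 0 \<longleftrightarrow> x = ?x0 \<or> x = ?xk" if "x \<in> nbr v" for x
    using npos[of x] nbrN[OF that] nbrD(5)[OF that] by blast
  have nn: "n \<noteq> 0"
  proof
    assume "n = 0"
    then have "P \<subseteq> N" using npos by auto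
    then have "P = N" using N facetD unfolding Fv_def by blast
    then show False using N facetD dimP unfolding Fv_def by auto
  qed
  have ind: "a = 0 \<and> b = 0" if "F \<in> Fv" "a *\<^sub>R (fX F - v) + b *\<^sub>R (fY F - v) = 0" for F a b
    using f[OF that(1)] that(2) by blast
  have posX: "0 \<le> n \<bullet> (fX F - v)" "0 \<le> n \<bullet> (fY F - v)" if "F \<in> Fv" for F
    using npos(1) f[OF that] nbrD(5) by blast+
  have X0: "fX F - v \<noteq> 0" "fY F - v \<noteq> 0" if "F \<in> Fv" for F
    using f[OF that] nbrD(1) by auto
  \<comment> \<open>Otherwise F would share both of its edges at v with N, whereas the facet across
    the first of them has its second edge off N.\<close>
  have not_both: "n \<bullet> (fX F - v) \<noteq> 0 \<or> n \<bullet> (fY F - v) \<noteq> 0" if F: "F \<in> Fv" "F \<noteq> N" for F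
  proof (rule ccontr)
    assume "\<not> ?thesis"
    then have c: "fX F \<in> N" "fY F \<in> N" using nN nbrN f[OF F(1)] by auto
    obtain G W Z where "N \<noteq> G" "nbr v \<inter> G = {fX F, Z}" "Z \<notin> N" "\<forall>H\<in>Fv. fX F \<in> H \<longrightarrow> H = N \<or> H = G"
      by (rule wedge[OF N c(1)]) (use f[OF F(1)] in blast)+
    moreover have "fX F \<in> F" using inF F by blast
    ultimately have "nbr v \<inter> F = {fX F, Z}" using F by blast
    then have "fY F = Z" using f[OF F(1)] by (metis doubleton_eq_iff)
    then show False using c \<open>Z \<notin> N\<close> by blast
  qed
  have y0: "y F \<noteq> 0" if F: "F \<in> Fv" "F \<noteq> N" for F
  proof
    assume "y F = 0"
    then have "(- (n \<bullet> (fY F - v))) *\<^sub>R (fX F - v) + (n \<bullet> (fX F - v)) *\<^sub>R (fY F - v) = 0"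
      unfolding y_eq by simp
    from ind[OF F(1) this] show False using not_both[OF F] by simp
  qed
  \<comment> \<open>The edge \<open>fY F\<close> lies between \<open>fX F\<close> and the direction
    \<open>y F\<close>. If \<open>fX F\<close> belongs to N, then \<open>y F\<close> is opposite to
    it, and the angles add up to pi directly.\<close>
  have split: "ang (fX F - v) (y F) = face_angle F v + ang (fY F - v) (y F)" if F: "F \<in> Fv" "F \<noteq> N" for F
  proof -
    define \<alpha> where "\<alpha> = n \<bullet> (fX F - v)"
    define \<beta> where "\<beta> = n \<bullet> (fY F - v)"
    have ye: "y F = \<alpha> *\<^sub>R (fY F - v) - \<beta> *\<^sub>R (fX F - v)" unfolding y_eq \<alpha>_def \<beta>_def ..
    have ab: "0 \<le> \<alpha>" "0 \<le> \<beta>" using posX[OF F(1)] unfolding \<alpha>_def \<beta>_def by auto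
    have fa: "face_angle F v = ang (fX F - v) (fY F - v)" using f[OF F(1)] by blast
    show ?thesis
    proof (cases "\<alpha> = 0")
      case True
      then have "\<beta> > 0" using ab not_both[OF F] unfolding \<alpha>_def \<beta>_def by auto
      moreover have "y F = \<beta> *\<^sub>R (- (fX F - v))" unfolding ye True by (simp del: minus_diff_eq)
      ultimately show ?thesis unfolding fa
        using X0[OF F(1)] ang_minus_self[of "fX F - v"] ang_minus_right[of "fY F - v" "fX F - v"]
        by (simp add: ang_scale_right ang_commute del: minus_diff_eq scaleR_minus_right)
    next
      case False
      have "fY F - v = (\<beta> / \<alpha>) *\<^sub>R (fX F - v) + (1 / \<alpha>) *\<^sub>R y F"
        unfolding ye using False by (simp add: scaleR_right_diff_distrib)
      then show ?thesis unfolding fa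
        by (rule ang_add) (use ab False X0[OF F(1)] y0[OF F] in auto)
    qed
  qed
  define a0 where "a0 = ?x0 - v"
  have a00: "a0 \<noteq> 0" "a0 \<bullet> n = 0" unfolding a0_def using nbrD(1)[OF x0(1)] nN[OF x0(1)] by (auto simp: inner_commute)
  define A where "A F = ang (fX F - v) (y F) + ang a0 (y F)" for F
  define B where "B F = ang (fY F - v) (y F) + ang a0 (y F)" for F
  have faAB: "face_angle F v = A F - B F" if "F \<in> Fv" "F \<noteq> N" for F
    using split[OF that] unfolding A_def B_def by simp
  \<comment> \<open>Here h precedes and g follows the edge \<open>fX g = fY h\<close>. In the plane
    of N the direction \<open>y g\<close> lies between \<open>a0\<close> and \<open>y h\<close>, so
    the angles there add up; the strict triangle inequality for the edge, \<open>y h\<close> and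
    \<open>y g\<close> gives the rest.\<close>
  have drop: "A g < B h" if g: "g \<in> Fv" "g \<noteq> N" and h: "h \<in> Fv" "h \<noteq> N" and eq: "fX g = fY h" for g h
  proof -
    let ?p = "fY h"
    have hp: "?p \<in> h" "?p \<in> g" "?p \<in> nbr v" using inF g h eq f by metis+
    obtain G W Z where w: "nbr v \<inter> h = {?p, W}" "nbr v \<inter> G = {?p, Z}" "Z \<notin> h" "Z \<in> nbr v" "W \<in> nbr v"
      "\<forall>a b c. a *\<^sub>R (?p - v) + b *\<^sub>R (W - v) + c *\<^sub>R (Z - v) = 0 \<longrightarrow> a = 0 \<and> b = 0 \<and> c = 0"
      "\<forall>H\<in>Fv. ?p \<in> H \<longrightarrow> H = h \<or> H = G"
      by (rule wedge[OF h(1) hp(1,3)]) blast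
    have "g \<noteq> h" using f[OF h(1)] eq by metis
    then have "G = g" using w(7) g hp by blast
    have W: "fX h = W" using w(1) f[OF h(1)] by (metis doubleton_eq_iff)
    have Z: "fY g = Z" using w(2) f[OF g(1)] eq \<open>G = g\<close> by (metis doubleton_eq_iff)
    define x where "x = ?p - v"
    define w' where "w' = W - v"
    define z where "z = Z - v"
    have det: "(w' \<times> x) \<bullet> z > 0" 
      using f[OF h(1)] w(3) nbrD(5)[OF w(4)] unfolding W x_def w'_def z_def by (auto simp: order_less_le)
    have "?p \<noteq> ?x0" using injY[OF h(1) N] h by blast
    moreover have "?p \<noteq> ?xk" using injX[OF g(1) N] g eq by metis
    ultimately have nx: "n \<bullet> x > 0" unfolding x_def using npos(1)[of ?p] nN[OF hp(3)] nbrD(5)[OF hp(3)] by (auto simp: order_less_le)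
    define p where "p = y h"
    define q where "q = y g"
    have p: "p = (n \<bullet> w') *\<^sub>R x - (n \<bullet> x) *\<^sub>R w'" unfolding p_def y_eq W x_def w'_def ..
    have q: "q = (n \<bullet> x) *\<^sub>R z - (n \<bullet> z) *\<^sub>R x" unfolding q_def y_eq Z eq x_def z_def ..
    \<comment> \<open>Determinants in the plane of N: \<open>br1\<close> is positive by the
      orientation of the three edges involved; \<open>br2\<close> and \<open>br3\<close> are
      nonpositive because \<open>fY N\<close> lies on the inner side of the facets h and g. Then
      \<open>plane_relation\<close> writes q as a nonnegative combination of \<open>a0\<close> and
      p, unless \<open>br2\<close> is zero.\<close>
    define br1 where "br1 = (p \<times> q) \<bullet> n"
    define br2 where "br2 = (a0 \<times> p) \<bullet> n"
    define br3 where "br3 = (a0 \<times> q) \<bullet> n"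
    have br1: "br1 > 0" unfolding br1_def p q cross_consecutive using nx det nn by simp
    have lag: "(a0 \<times> (m \<times> n)) \<bullet> n = - (n \<bullet> n) * (m \<bullet> a0)" for m
    proof -
      have "(a0 \<times> (m \<times> n)) \<bullet> n = (a0 \<bullet> n) * (m \<bullet> n) - (n \<bullet> n) * (m \<bullet> a0)"
        by (simp add: cross3_simps)
      then show ?thesis using a00 by simp
    qed
    have x0P: "?x0 \<in> P" using nbrD(5)[OF x0(1)] .
    have "br2 = - (n \<bullet> n) * (((fX h - v) \<times> (fY h - v)) \<bullet> a0)" unfolding br2_def p_def y_def by (rule lag)
    moreover have "0 \<le> ((fX h - v) \<times> (fY h - v)) \<bullet> a0" using f[OF h(1)] x0P unfolding a0_def by blast
    ultimately have br2: "br2 \<le> 0" by (simp add: mult_nonneg_nonneg)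
    have "br3 = - (n \<bullet> n) * (((fX g - v) \<times> (fY g - v)) \<bullet> a0)" unfolding br3_def q_def y_def by (rule lag)
    moreover have "0 \<le> ((fX g - v) \<times> (fY g - v)) \<bullet> a0" using f[OF g(1)] x0P unfolding a0_def by blast
    ultimately have br3: "br3 \<le> 0" by (simp add: mult_nonneg_nonneg)
    have pn: "p \<bullet> n = 0" "q \<bullet> n = 0" unfolding p q by (simp_all add: inner_diff_right inner_commute[of _ n] mult.commute)
    have "br2 *\<^sub>R q + br1 *\<^sub>R a0 + ((q \<times> a0) \<bullet> n) *\<^sub>R p = 0"
      unfolding br1_def br2_def by (rule plane_relation) (use nn a00 pn in auto)
    moreover have "(q \<times> a0) \<bullet> n = - br3" unfolding br3_def using cross_skew[of q a0] by simp
    ultimately have rel: "br2 *\<^sub>R q + br1 *\<^sub>R a0 = br3 *\<^sub>R p" by simp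
    have p0: "p \<noteq> 0" "q \<noteq> 0" unfolding p_def q_def using y0 g h by auto
    have "ang a0 p = ang a0 q + ang q p"
    proof (cases "br2 = 0")
      case False
      then have "br2 < 0" using br2 by simp
      have "br2 *\<^sub>R q = br3 *\<^sub>R p - br1 *\<^sub>R a0" using rel by (simp add: algebra_simps)
      then have "(1 / br2) *\<^sub>R (br2 *\<^sub>R q) = (1 / br2) *\<^sub>R (br3 *\<^sub>R p - br1 *\<^sub>R a0)" by simp
      then have "q = (- br1 / br2) *\<^sub>R a0 + (br3 / br2) *\<^sub>R p"
        using False by (simp add: scaleR_right_diff_distrib)
      then show ?thesis by (rule ang_add)
        (use \<open>br2 < 0\<close> br1 br3 a00 p0 in \<open>auto simp: divide_nonpos_neg divide_nonneg_neg\<close>)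
    next
      case True
      then have e: "br1 *\<^sub>R a0 = br3 *\<^sub>R p" using rel by simp
      have "br3 \<noteq> 0" using e br1 a00 by auto
      then have neg: "br3 < 0" using br3 by simp
      have "p = (1 / br3) *\<^sub>R (br3 *\<^sub>R p)" using neg by simp
      also have "\<dots> = (- br1 / br3) *\<^sub>R (- a0)" unfolding e[symmetric] by simp
      finally have pe: "p = (- br1 / br3) *\<^sub>R (- a0)" .
      have c: "- br1 / br3 > 0" using br1 neg by (simp add: divide_pos_neg)
      have "ang a0 p = pi" unfolding pe ang_scale_right[OF c] using ang_minus_self a00 by blast
      moreover have "ang q p = pi - ang q a0" unfolding pe ang_scale_right[OF c] using ang_minus_right p0 a00 by blast
      ultimately show ?thesis by (simp add: ang_commute)
    qed
    moreover have "ang x q < ang x p + ang p q"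
    proof (rule ang_triangle_strict)
      fix a b c assume "a *\<^sub>R x + b *\<^sub>R p + c *\<^sub>R q = 0"
      then have "(a + b * (n \<bullet> w') - c * (n \<bullet> z)) *\<^sub>R x + (- b * (n \<bullet> x)) *\<^sub>R w' + (c * (n \<bullet> x)) *\<^sub>R z = 0"
        unfolding p q by (simp add: algebra_simps)
      then have "a + b * (n \<bullet> w') - c * (n \<bullet> z) = 0 \<and> - b * (n \<bullet> x) = 0 \<and> c * (n \<bullet> x) = 0"
        using w(6) unfolding x_def w'_def z_def by blast
      then show "a = 0 \<and> b = 0 \<and> c = 0" using nx by auto
    qed
    ultimately show ?thesis unfolding A_def B_def eq x_def[symmetric] p_def[symmetric] q_def[symmetric]
      by (simp add: ang_commute)
  qed
  \<comment> \<open>The edges off N, at which the potential drops. At the two edges of N it is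
    computed exactly: the chain starts with 2 pi at \<open>fY N\<close> and ends with the angle of N
    itself at \<open>fX N\<close>, which cancels the term of N in the sum.\<close>
  define M where "M = nbr v - {?x0, ?xk}"
  have fM: "finite M" unfolding M_def using finite_nbr by simp
  have "M \<noteq> {}"
  proof -
    obtain G W Z where "Z \<notin> N" "Z \<in> nbr v" by (rule wedge[OF N inF(2)[OF N] x0(1)]) blast
    then show ?thesis using nbrN unfolding M_def by blast
  qed
  have g: "gX x \<in> Fv" "fX (gX x) = x" "gY x \<in> Fv" "fY (gY x) = x" if "x \<in> nbr v" for x
    using that imX imY unfolding gX_def gY_def by (auto intro: inv_into_into f_inv_into_f)
  have "(\<Sum>x\<in>M. A (gX x)) < (\<Sum>x\<in>M. B (gY x))"
  proof (rule sum_strict_mono[OF fM \<open>M \<noteq> {}\<close>])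
    fix x assume x: "x \<in> M"
    then have xn: "x \<in> nbr v" "x \<noteq> ?x0" "x \<noteq> ?xk" unfolding M_def by auto
    show "A (gX x) < B (gY x)" by (rule drop) (use g[OF xn(1)] xn in metis)+
  qed
  moreover have "(\<Sum>F\<in>Fv - {N}. A F) = (\<Sum>x\<in>nbr v - {?xk}. A (gX x))"
  proof -
    have "bij_betw fX (Fv - {N}) (nbr v - {?xk})"
      using bij_betw_DiffI[of fX Fv "nbr v" "{N}" "{?xk}"] iX imX N x0 by (simp add: bij_betw_def)
    then have "(\<Sum>F\<in>Fv - {N}. A (gX (fX F))) = (\<Sum>x\<in>nbr v - {?xk}. A (gX x))"
      by (rule sum.reindex_bij_betw)
    moreover have "gX (fX F) = F" if "F \<in> Fv" for F unfolding gX_def using iX that by simp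
    ultimately show ?thesis by simp
  qed
  moreover have "(\<Sum>F\<in>Fv - {N}. B F) = (\<Sum>x\<in>nbr v - {?x0}. B (gY x))"
  proof -
    have "bij_betw fY (Fv - {N}) (nbr v - {?x0})"
      using bij_betw_DiffI[of fY Fv "nbr v" "{N}" "{?x0}"] iY imY N x0 by (simp add: bij_betw_def)
    then have "(\<Sum>F\<in>Fv - {N}. B (gY (fY F))) = (\<Sum>x\<in>nbr v - {?x0}. B (gY x))"
      by (rule sum.reindex_bij_betw)
    moreover have "gY (fY F) = F" if "F \<in> Fv" for F unfolding gY_def using iY that by simp
    ultimately show ?thesis by simp
  qed
  moreover have "nbr v - {?xk} = insert ?x0 M" "nbr v - {?x0} = insert ?xk M"
    unfolding M_def using x0 by auto
  moreover have "?x0 \<notin> M" "?xk \<notin> M" unfolding M_def by auto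
  moreover have "A (gX ?x0) = 2 * pi"
  proof -
    let ?G = "gX ?x0"
    have G: "?G \<in> Fv" "fX ?G = ?x0" using g x0 by auto
    have "?G \<noteq> N" using G x0 by metis
    have "n \<bullet> (fX ?G - v) = 0" using nN x0 G by auto
    then have yG: "y ?G = (n \<bullet> (fY ?G - v)) *\<^sub>R (- a0)" "n \<bullet> (fY ?G - v) > 0"
      unfolding y_eq a0_def using posX[OF G(1)] not_both[OF G(1) \<open>?G \<noteq> N\<close>] G by (auto simp del: minus_diff_eq)
    then show ?thesis unfolding A_def G(2) a0_def[symmetric]
      unfolding yG(1) ang_scale_right[OF yG(2)] using ang_minus_self[OF a00(1)] by simp
  qed
  moreover have "B (gY ?xk) = face_angle N v"
  proof -
    let ?H = "gY ?xk"
    have H: "?H \<in> Fv" "fY ?H = ?xk" using g x0 by auto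
    have "?H \<noteq> N" using H x0 by metis
    have "n \<bullet> (fY ?H - v) = 0" using nN x0 H by auto
    then have yH: "y ?H = (n \<bullet> (fX ?H - v)) *\<^sub>R (?xk - v)" "n \<bullet> (fX ?H - v) > 0"
      unfolding y_eq using posX[OF H(1)] not_both[OF H(1) \<open>?H \<noteq> N\<close>] H by auto
    have "ang (?xk - v) (y ?H) = 0" unfolding yH(1) ang_scale_right[OF yH(2)] using ang_self X0[OF N] by blast
    moreover have "ang a0 (y ?H) = face_angle N v"
      unfolding yH(1) ang_scale_right[OF yH(2)] a0_def using f[OF N] ang_commute by metis
    ultimately show ?thesis unfolding B_def H(2) by simp
  qed
  moreover have "(\<Sum>F\<in>Fv. face_angle F v) = face_angle N v + (\<Sum>F\<in>Fv - {N}. A F - B F)"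
    using faAB by (simp add: sum.remove[OF fin N])
  ultimately have "(\<Sum>F\<in>Fv. face_angle F v) < 2 * pi"
    using fM by (simp add: sum_subtractf)
  then show ?thesis unfolding Fv_def by simp
qed

end

unbundle no cross3_syntax

section \<open>Charts of polygons in the plane\<close>

text \<open>A chart of a planar set is recorded by its inverse, a linear isometry followed by a translation.\<close>
definition chart :: "(real^3) set \<Rightarrow> (real^3 \<Rightarrow> real^2) \<Rightarrow> bool" where
  "chart F h \<longleftrightarrow> (\<exists>J c. linear J \<and> (\<forall>z. norm (J z) = norm z) \<and> (\<forall>y\<in>F. y = c + J (h y)))"

text \<open>Passing to differences removes the translation; inner products are preserved by
  polarisation.\<close>

lemma chart_diff:
  assumes "chart F h"
  obtains J where "linear J" "\<And>z. norm (J z) = norm z" "\<And>x y. J x \<bullet> J y = x \<bullet> y"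
    "\<And>x y. x \<in> F \<Longrightarrow> y \<in> F \<Longrightarrow> y - x = J (h y - h x)"
proof -
  obtain J c where J: "linear J" "\<And>z. norm (J z) = norm z" "\<And>y. y \<in> F \<Longrightarrow> y = c + J (h y)"
    using assms unfolding chart_def by blast
  have "J x \<bullet> J y = x \<bullet> y" for x y
    using J(2)[of "x + y"] J(2)[of x] J(2)[of y] by (simp add: dot_norm linear_add[OF J(1), symmetric])
  moreover have "y - x = J (h y - h x)" if "x \<in> F" "y \<in> F" for x y
  proof -
    have "y - x = (c + J (h y)) - (c + J (h x))" using J(3)[OF that(1)] J(3)[OF that(2)] by presburger
    then show ?thesis by (simp add: linear_diff[OF J(1)])
  qed
  ultimately show ?thesis using that J by blast
qed

lemma chart_dist: "chart F h \<Longrightarrow> x \<in> F \<Longrightarrow> y \<in> F \<Longrightarrow> dist (h x) (h y) = dist x y"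
  by (rule chart_diff[of F h]) (auto simp: dist_norm)

lemma chart_inj: "chart F h \<Longrightarrow> x \<in> F \<Longrightarrow> y \<in> F \<Longrightarrow> h x = h y \<Longrightarrow> x = y"
  using chart_dist[of F h x y] by simp

lemma chart_ang:
  assumes "chart F h" "u \<in> F" "x \<in> F" "y \<in> F"
  shows "ang (h x - h u) (h y - h u) = ang (x - u) (y - u)"
proof -
  obtain J where J: "linear J" "\<And>z. norm (J z) = norm z" "\<And>x y. J x \<bullet> J y = x \<bullet> y"
    "\<And>x y. x \<in> F \<Longrightarrow> y \<in> F \<Longrightarrow> y - x = J (h y - h x)" by (rule chart_diff[OF assms(1)]) blast
  show ?thesis unfolding ang_def J(4)[OF assms(2,3)] J(4)[OF assms(2,4)] J(2,3) ..
qed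

text \<open>The adjoint of the isometry carries functionals from space to the plane, such as one
  that exposes an edge.\<close>

lemma chart_functional:
  assumes "chart F h"
  obtains m where "\<And>x y. x \<in> F \<Longrightarrow> y \<in> F \<Longrightarrow> m \<bullet> (h y - h x) = k \<bullet> (y - x)"
proof -
  obtain J where J: "linear J" "\<And>x y. x \<in> F \<Longrightarrow> y \<in> F \<Longrightarrow> y - x = J (h y - h x)"
    by (rule chart_diff[OF assms]) blast
  show ?thesis
  proof (rule that[of "adjoint J k"])
    fix x y assume xy: "x \<in> F" "y \<in> F"
    show "adjoint J k \<bullet> (h y - h x) = k \<bullet> (y - x)"
      unfolding J(2)[OF xy] by (metis adjoint_works[OF J(1)] inner_commute)
  qed
qed

lemma chart_affine:
  assumes "chart F h" "convex F" "u \<in> F" "v \<in> F" "0 \<le> t" "t \<le> 1"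
  shows "h ((1 - t) *\<^sub>R u + t *\<^sub>R v) = (1 - t) *\<^sub>R h u + t *\<^sub>R h v"
proof -
  obtain J where J: "linear J" "\<And>z. norm (J z) = norm z"
    "\<And>x y. x \<in> F \<Longrightarrow> y \<in> F \<Longrightarrow> y - x = J (h y - h x)" by (rule chart_diff[OF assms(1)]) blast
  let ?x = "(1 - t) *\<^sub>R u + t *\<^sub>R v"
  have x: "?x \<in> F" using assms by (simp add: convex_alt)
  have "J (h ?x - h u) = ?x - u" using J(3)[OF assms(3) x] by simp
  also have "\<dots> = t *\<^sub>R (v - u)" by (simp add: algebra_simps)
  also have "\<dots> = J (t *\<^sub>R (h v - h u))" using J(3)[OF assms(3,4)] by (simp add: linear_scale[OF J(1)])
  finally have "J ((h ?x - h u) - t *\<^sub>R (h v - h u)) = 0" by (simp add: linear_diff[OF J(1)])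
  then have "(h ?x - h u) - t *\<^sub>R (h v - h u) = 0" using J(2) by (metis norm_eq_zero)
  then have "h ?x = h u + t *\<^sub>R (h v - h u)" by (simp add: algebra_simps)
  also have "\<dots> = (1 - t) *\<^sub>R h u + t *\<^sub>R h v" by (simp add: algebra_simps)
  finally show ?thesis .
qed

lemma closed_segment_image: "closed_segment a b = (\<lambda>t. (1 - t) *\<^sub>R a + t *\<^sub>R b) ` {0..1}"
  by (auto simp: closed_segment_def)

lemma chart_segment:
  assumes "chart F h" "convex F" "u \<in> F" "v \<in> F"
  shows "h ` closed_segment u v = closed_segment (h u) (h v)"
  unfolding closed_segment_image using chart_affine[OF assms] by (simp add: image_image)

lemma chart_continuous: "chart F h \<Longrightarrow> continuous_on F h"
  unfolding continuous_on_iff using chart_dist by (metis dist_commute)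

lemma chart_convex:
  assumes "chart F h" "convex F" shows "convex (h ` F)"
  unfolding convex_contains_segment
proof (intro ballI)
  fix a b assume "a \<in> h ` F" "b \<in> h ` F"
  then obtain u v where uv: "u \<in> F" "v \<in> F" "a = h u" "b = h v" by auto
  have "closed_segment u v \<subseteq> F" using assms(2) uv by (simp add: closed_segment_subset)
  then show "closed_segment a b \<subseteq> h ` F" using chart_segment[OF assms uv(1,2)] uv by blast
qed

text \<open>\<open>polygon_corner\<close> with one of the two edges prescribed, as needed when a
  face is to be attached along it.\<close>

lemma polygon_edge_corner:
  fixes F :: "(real^3) set"
  assumes F: "polytope F" "aff_dim F = 2" and e: "closed_segment u v face_of F" "u \<noteq> v"
  obtains c where "c \<noteq> v" "c \<noteq> u" "closed_segment u c face_of F" "c \<notin> closed_segment u v"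
    "\<And>w. w \<noteq> u \<Longrightarrow> closed_segment u w face_of F \<Longrightarrow> w = v \<or> w = c"
    "\<And>a b. a *\<^sub>R (v - u) + b *\<^sub>R (c - u) = 0 \<Longrightarrow> a = 0 \<and> b = 0"
    "\<And>p. p \<in> F \<Longrightarrow> \<exists>s t. 0 \<le> s \<and> 0 \<le> t \<and> p - u = s *\<^sub>R (v - u) + t *\<^sub>R (c - u)"
    "face_angle F u = ang (v - u) (c - u)"
proof -
  have u: "u extreme_point_of F" using segment_face_extreme[OF e(1)] by simp
  obtain x y where xy: "x \<noteq> y" "x \<noteq> u" "y \<noteq> u" "closed_segment u x face_of F" "closed_segment u y face_of F"
    "\<And>w. w \<noteq> u \<Longrightarrow> closed_segment u w face_of F \<Longrightarrow> w = x \<or> w = y"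
    "\<And>a b. a *\<^sub>R (x - u) + b *\<^sub>R (y - u) = 0 \<Longrightarrow> a = 0 \<and> b = 0"
    "\<And>p. p \<in> F \<Longrightarrow> \<exists>s t. 0 \<le> s \<and> 0 \<le> t \<and> p - u = s *\<^sub>R (x - u) + t *\<^sub>R (y - u)"
    by (rule polygon_corner[OF F u]) blast
  have "v = x \<or> v = y" using xy(6)[of v] e by auto
  then obtain c where c: "c \<noteq> v" "c \<noteq> u" "closed_segment u c face_of F"
    "\<And>w. w \<noteq> u \<Longrightarrow> closed_segment u w face_of F \<Longrightarrow> w = v \<or> w = c"
    "\<And>a b. a *\<^sub>R (v - u) + b *\<^sub>R (c - u) = 0 \<Longrightarrow> a = 0 \<and> b = 0"
    "\<And>p. p \<in> F \<Longrightarrow> \<exists>s t. 0 \<le> s \<and> 0 \<le> t \<and> p - u = s *\<^sub>R (v - u) + t *\<^sub>R (c - u)"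
  proof
    assume "v = x" then show ?thesis using that[of y] xy by blast
  next
    assume vy: "v = y"
    have i: "a = 0 \<and> b = 0" if "a *\<^sub>R (v - u) + b *\<^sub>R (x - u) = 0" for a b
      using xy(7)[of b a] that vy by (simp add: add.commute)
    have c: "\<exists>s t. 0 \<le> s \<and> 0 \<le> t \<and> p - u = s *\<^sub>R (v - u) + t *\<^sub>R (x - u)" if "p \<in> F" for p
      using xy(8)[OF that] vy by (metis add.commute)
    show ?thesis by (rule that[of x]) (use xy vy i c in auto)
  qed
  have "c extreme_point_of F" using segment_face_extreme[OF c(3)] by simp
  then have "c \<notin> closed_segment u v" using extreme_in_segment_face[OF e(1)] c by blast
  then show ?thesis
    by (intro that[OF c(1-3) _ c(4-6)]) (use face_angle_eq[OF F _ e(2)[symmetric] c(2) e(1) c(3)] c(1) in auto)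
qed

text \<open>Two orthonormal frames are matched: \<open>\<epsilon>1\<close> along the edge and
  \<open>\<epsilon>2\<close> obtained by Gram-Schmidt from the other edge at u, against the
  direction from p to q and the given normal d. As the sign of d is free, the face can be put on
  either side of the line through p and q.\<close>

lemma chart_exists:
  fixes F :: "(real^3) set" and p q d :: "real^2"
  assumes F: "polytope F" "aff_dim F = 2" and e: "closed_segment u v face_of F" "u \<noteq> v"
    and pq: "dist p q = dist u v" and d: "norm d = 1" "d \<bullet> (q - p) = 0"
  obtains h where "chart F h" "h u = p" "h v = q"
    "\<And>y. y \<in> F \<Longrightarrow> 0 \<le> d \<bullet> (h y - p)" "\<And>y. y \<in> F \<Longrightarrow> d \<bullet> (h y - p) = 0 \<longleftrightarrow> y \<in> closed_segment u v"
proof -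
  obtain c where c: "c \<noteq> v" "c \<noteq> u" "closed_segment u c face_of F" "c \<notin> closed_segment u v"
    "\<And>a b. a *\<^sub>R (v - u) + b *\<^sub>R (c - u) = 0 \<Longrightarrow> a = 0 \<and> b = 0"
    "\<And>p. p \<in> F \<Longrightarrow> \<exists>s t. 0 \<le> s \<and> 0 \<le> t \<and> p - u = s *\<^sub>R (v - u) + t *\<^sub>R (c - u)"
    by (rule polygon_edge_corner[OF F e]) blast
  define L where "L = norm (v - u)"
  have L: "L > 0" "norm (q - p) = L" using e pq unfolding L_def by (auto simp: dist_norm norm_minus_commute)
  define \<epsilon>1 where "\<epsilon>1 = (1 / L) *\<^sub>R (v - u)"
  define d1 where "d1 = (1 / L) *\<^sub>R (q - p)"
  define \<gamma> where "\<gamma> = (c - u) \<bullet> \<epsilon>1"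
  define c' where "c' = (c - u) - \<gamma> *\<^sub>R \<epsilon>1"
  define \<delta> where "\<delta> = norm c'"
  have e1: "norm \<epsilon>1 = 1" "v - u = L *\<^sub>R \<epsilon>1" unfolding \<epsilon>1_def using L L_def by auto
  have d1: "norm d1 = 1" "q - p = L *\<^sub>R d1" "d1 \<bullet> d = 0" unfolding d1_def using L d by (auto simp: inner_commute)
  have "c' \<noteq> 0"
  proof
    assume "c' = 0"
    then have "(- \<gamma> / L) *\<^sub>R (v - u) + 1 *\<^sub>R (c - u) = 0" unfolding c'_def \<epsilon>1_def by simp
    from c(5)[OF this] show False by simp
  qed
  then have \<delta>: "\<delta> > 0" unfolding \<delta>_def by simp
  define \<epsilon>2 where "\<epsilon>2 = (1 / \<delta>) *\<^sub>R c'"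
  have e2: "norm \<epsilon>2 = 1" "c - u = \<gamma> *\<^sub>R \<epsilon>1 + \<delta> *\<^sub>R \<epsilon>2" unfolding \<epsilon>2_def using \<delta> by (auto simp: \<delta>_def c'_def)
  have e11: "\<epsilon>1 \<bullet> \<epsilon>1 = 1" "\<epsilon>2 \<bullet> \<epsilon>2 = 1" using e1 e2 by (auto simp: norm_eq_1)
  have e12: "\<epsilon>1 \<bullet> \<epsilon>2 = 0" unfolding \<epsilon>2_def c'_def \<gamma>_def using e11 by (simp add: inner_diff_right inner_commute)
  define J :: "real^2 \<Rightarrow> real^3" where "J z = (z \<bullet> d1) *\<^sub>R \<epsilon>1 + (z \<bullet> d) *\<^sub>R \<epsilon>2" for z
  have linJ: "linear J" unfolding J_def
    by (intro linearI) (auto simp: inner_add_left algebra_simps)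
  have nJ: "norm (J z) = norm z" for z
  proof -
    have "J z \<bullet> J z = (z \<bullet> d1)\<^sup>2 + (z \<bullet> d)\<^sup>2" unfolding J_def using e11 e12
      by (simp add: inner_add_left inner_add_right inner_commute power2_eq_square)
    also have "\<dots> = ((z \<bullet> d1) *\<^sub>R d1 + (z \<bullet> d) *\<^sub>R d) \<bullet> z"
      by (simp add: inner_add_left inner_add_right inner_commute[of _ z] power2_eq_square)
    also have "\<dots> = z \<bullet> z" using decomp_real2[OF d1(1) d(1) d1(3), of z] by simp
    finally show ?thesis by (simp add: norm_eq_sqrt_inner)
  qed
  define h where "h y = p + ((y - u) \<bullet> \<epsilon>1) *\<^sub>R d1 + ((y - u) \<bullet> \<epsilon>2) *\<^sub>R d" for y
  have dd: "d1 \<bullet> d1 = 1" "d \<bullet> d = 1" "d \<bullet> d1 = 0" using d d1 by (auto simp: norm_eq_1 inner_commute)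
  have coords: "\<exists>s t. 0 \<le> s \<and> 0 \<le> t \<and> y - u = s *\<^sub>R (v - u) + t *\<^sub>R (c - u) \<and> (y - u) \<bullet> \<epsilon>1 = s * L + t * \<gamma> \<and> (y - u) \<bullet> \<epsilon>2 = t * \<delta>"
    if y: "y \<in> F" for y
  proof -
    obtain s t where st: "0 \<le> s" "0 \<le> t" "y - u = s *\<^sub>R (v - u) + t *\<^sub>R (c - u)" using c(6)[OF y] by blast
    have "(y - u) \<bullet> \<epsilon>1 = s * L + t * \<gamma>" "(y - u) \<bullet> \<epsilon>2 = t * \<delta>"
      unfolding st(3) e1(2) e2(2) using e11 e12 by (simp_all add: inner_add_left inner_commute algebra_simps)
    with st show ?thesis by blast
  qed
  have J_h: "J (h y - p) = y - u" if y: "y \<in> F" for y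
  proof -
    obtain s t where st: "y - u = s *\<^sub>R (v - u) + t *\<^sub>R (c - u)" "(y - u) \<bullet> \<epsilon>1 = s * L + t * \<gamma>" "(y - u) \<bullet> \<epsilon>2 = t * \<delta>"
      using coords[OF y] by blast
    have "J (h y - p) = ((y - u) \<bullet> \<epsilon>1) *\<^sub>R \<epsilon>1 + ((y - u) \<bullet> \<epsilon>2) *\<^sub>R \<epsilon>2"
      unfolding h_def J_def using dd d1 by (simp add: inner_add_left)
    also have "\<dots> = y - u" unfolding st(2,3) unfolding st(1) e1(2) e2(2) by (simp add: algebra_simps)
    finally show ?thesis .
  qed
  have "chart F h" unfolding chart_def
  proof (intro exI conjI ballI allI)
    show "linear J" by (rule linJ)
    show "norm (J z) = norm z" for z by (rule nJ)
    fix y assume "y \<in> F"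
    then have "J (h y) - J p = y - u" using J_h linear_diff[OF linJ] by simp
    then show "y = (u - J p) + J (h y)" by (simp add: algebra_simps)
  qed
  moreover have "h u = p" unfolding h_def by simp
  moreover have "h v = q"
  proof -
    have "h v = p + L *\<^sub>R d1" unfolding h_def e1(2) using e11 e12 by simp
    then show ?thesis unfolding d1(2)[symmetric] by simp
  qed
  moreover have dh: "d \<bullet> (h y - p) = (y - u) \<bullet> \<epsilon>2" for y unfolding h_def using dd by (simp add: inner_add_right)
  moreover have "0 \<le> (y - u) \<bullet> \<epsilon>2" if "y \<in> F" for y using coords[OF that] \<delta> by auto
  \<comment> \<open>On F the functional exposing the edge is a nonzero multiple of the second
    coordinate, so both vanish at the same points.\<close>
  moreover have "(y - u) \<bullet> \<epsilon>2 = 0 \<longleftrightarrow> y \<in> closed_segment u v" if y: "y \<in> F" for y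
  proof
    obtain k where k: "\<And>p. p \<in> F \<Longrightarrow> 0 \<le> k \<bullet> (p - u)" "\<And>p. p \<in> F \<Longrightarrow> k \<bullet> (p - u) = 0 \<longleftrightarrow> p \<in> closed_segment u v"
      by (rule exposing_functional[OF F(1) e(1), of u]) auto
    obtain s t where st: "y - u = s *\<^sub>R (v - u) + t *\<^sub>R (c - u)" "(y - u) \<bullet> \<epsilon>2 = t * \<delta>"
      using coords[OF y] by blast
    have "v \<in> F" using e face_of_imp_subset by blast
    then have "k \<bullet> (v - u) = 0" using k(2) by simp
    then have ky: "k \<bullet> (y - u) = t * (k \<bullet> (c - u))" unfolding st by (simp add: inner_add_right)
    { assume "(y - u) \<bullet> \<epsilon>2 = 0"
      then have "t = 0" using st \<delta> by simp
      then show "y \<in> closed_segment u v" using ky k(2)[OF y] by simp }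
    { assume "y \<in> closed_segment u v"
      then have "t * (k \<bullet> (c - u)) = 0" using ky k(2)[OF y] by simp
      moreover have "c \<in> F" using c(3) face_of_imp_subset by blast
      then have "k \<bullet> (c - u) \<noteq> 0" using k(2) c(4) by blast
      ultimately show "(y - u) \<bullet> \<epsilon>2 = 0" using st by simp }
  qed
  ultimately show ?thesis using that[of h] by simp
qed

text \<open>Faces are extreme sets, so one that contains an inner point of a segment in
  \<open>P\<close> contains the whole segment. A midpoint therefore identifies its edge, and serves
  as a point of the boundary at which no other edge interferes.\<close>

lemma edge_midpoint:
  assumes P: "polytope P" and e: "closed_segment u v \<in> poly_edges P" and e': "e' \<in> poly_edges P"
    and m: "midpoint u v \<in> e'"
  shows "e' = closed_segment u v"
proof (rule ccontr)
  assume ne: "e' \<noteq> closed_segment u v"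
  have uv: "u \<noteq> v" using poly_edges_segment_ne[OF e] .
  have f: "e' face_of P" "aff_dim e' = 1" "closed_segment u v face_of P" "aff_dim (closed_segment u v) = 1"
    using e e' by (auto simp: poly_edges_def)
  have "u \<in> P" "v \<in> P" using face_of_imp_subset[OF f(3)] by auto
  moreover have "midpoint u v \<in> open_segment u v" using uv by simp
  ultimately have "u \<in> e' \<and> v \<in> e'" using face_ofD[OF f(1), of "midpoint u v" u v] m by blast
  then have "closed_segment u v \<subseteq> e'" using face_of_imp_convex[OF f(1)] by (simp add: closed_segment_subset)
  then have "closed_segment u v face_of e'" using edge_in_face f by blast
  then have "aff_dim (closed_segment u v) < aff_dim e'"
    using face_of_aff_dim_lt face_of_imp_convex[OF f(1)] ne by blast
  then show False using f by simp
qed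

text \<open>The common supporting lines at p and q force a segment from A to B to cross the line through p and q between them.\<close>
lemma convex_Un_across_segment:
  fixes A B :: "(real^2) set"
  assumes A: "convex A" and B: "convex B" and pq: "p \<noteq> q" and d: "norm d = 1" "d \<bullet> (q - p) = 0"
    and segA: "closed_segment p q \<subseteq> A" and segB: "closed_segment p q \<subseteq> B"
    and below: "\<And>z. z \<in> A \<Longrightarrow> d \<bullet> (z - p) \<le> 0" and above: "\<And>z. z \<in> B \<Longrightarrow> 0 \<le> d \<bullet> (z - p)"
    and np: "np \<bullet> (q - p) < 0" "\<And>z. z \<in> A \<union> B \<Longrightarrow> np \<bullet> (z - p) \<le> 0"
    and nq: "nq \<bullet> (p - q) < 0" "\<And>z. z \<in> A \<union> B \<Longrightarrow> nq \<bullet> (z - q) \<le> 0"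
  shows "convex (A \<union> B)"
proof -
  define L where "L = norm (q - p)"
  have L: "L > 0" using pq unfolding L_def by simp
  define a where "a = (1 / L) *\<^sub>R (q - p)"
  have a: "norm a = 1" "q - p = L *\<^sub>R a" "a \<bullet> d = 0" unfolding a_def using L L_def d by (auto simp: inner_commute)
  have cross: "closed_segment x y \<subseteq> A \<union> B" if x: "x \<in> A" and y: "y \<in> B" for x y
  proof -
    \<comment> \<open>The point where the segment crosses the line through p and q, found from the
      signed distances of its ends. If both distances vanish, x itself serves.\<close>
    obtain w where w: "w \<in> closed_segment x y" "d \<bullet> (w - p) = 0"
    proof -
      define \<alpha> where "\<alpha> = - (d \<bullet> (x - p))"
      define \<beta> where "\<beta> = d \<bullet> (y - p)"
      have ab: "0 \<le> \<alpha>" "0 \<le> \<beta>" using below[OF x] above[OF y] unfolding \<alpha>_def \<beta>_def by auto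
      show ?thesis
      proof (cases "\<alpha> + \<beta> = 0")
        case True
        then have "d \<bullet> (x - p) = 0" using ab unfolding \<alpha>_def by auto
        then show ?thesis using that[of x] by simp
      next
        case False
        define t where "t = \<alpha> / (\<alpha> + \<beta>)"
        have t: "0 \<le> t" "t \<le> 1" unfolding t_def using ab False by (auto simp: divide_le_eq)
        have "d \<bullet> (((1 - t) *\<^sub>R x + t *\<^sub>R y) - p) = (1 - t) * (d \<bullet> (x - p)) + t * (d \<bullet> (y - p))"
          by (simp add: algebra_simps)
        also have "\<dots> = t * (\<alpha> + \<beta>) - \<alpha>" unfolding \<alpha>_def \<beta>_def by (simp add: algebra_simps)
        also have "\<dots> = 0" unfolding t_def using False by simp
        finally show ?thesis using that[of "(1 - t) *\<^sub>R x + t *\<^sub>R y"] t unfolding closed_segment_def by auto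
      qed
    qed
    define s where "s = (w - p) \<bullet> a"
    have wp: "w - p = s *\<^sub>R a" using decomp_real2[OF a(1) d(1) a(3), of "w - p"] w(2) unfolding s_def by (simp add: inner_commute)
    have half: "n \<bullet> (w - r) \<le> 0" if "\<And>z. z \<in> A \<union> B \<Longrightarrow> n \<bullet> (z - r) \<le> 0" for n r
    proof -
      obtain t where t: "0 \<le> t" "t \<le> 1" "w = (1 - t) *\<^sub>R x + t *\<^sub>R y" using w(1) unfolding closed_segment_def by blast
      have "n \<bullet> (w - r) = (1 - t) * (n \<bullet> (x - r)) + t * (n \<bullet> (y - r))" unfolding t(3) by (simp add: algebra_simps)
      moreover have "n \<bullet> (x - r) \<le> 0" "n \<bullet> (y - r) \<le> 0" using that x y by auto
      ultimately show ?thesis using t by (simp add: add_nonpos_nonpos mult_nonneg_nonpos)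
    qed
    \<comment> \<open>The half-planes given by \<open>np\<close> and \<open>nq\<close> contain w as
      well; on the line through p and q they exclude the points beyond p and beyond q,
      respectively.\<close>
    have "np \<bullet> a < 0" using np(1) L unfolding a(2) by (simp add: mult_less_0_iff)
    moreover have "s * (np \<bullet> a) \<le> 0" using half[OF np(2)] unfolding wp by simp
    ultimately have s0: "0 \<le> s" by (simp add: mult_le_0_iff)
    have wq: "w - q = (s - L) *\<^sub>R a" using wp a(2) by (simp add: algebra_simps)
    have "p - q = - (L *\<^sub>R a)" using a(2) by (metis minus_diff_eq)
    then have "nq \<bullet> a > 0" using nq(1) L by (simp add: zero_less_mult_iff)
    moreover have "(s - L) * (nq \<bullet> a) \<le> 0" using half[OF nq(2)] unfolding wq by simp
    ultimately have sL: "s \<le> L" by (simp add: mult_le_0_iff)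
    have "w = p + (s / L) *\<^sub>R (q - p)" using wp a(2) L by (simp add: algebra_simps)
    then have "w = (1 - s / L) *\<^sub>R p + (s / L) *\<^sub>R q" by (simp add: algebra_simps)
    then have "w \<in> closed_segment p q" unfolding closed_segment_def using s0 sL L
      by (intro CollectI exI[of _ "s / L"]) auto
    then have wAB: "w \<in> A" "w \<in> B" using segA segB by auto
    have "closed_segment x y = closed_segment x w \<union> closed_segment w y" using Un_closed_segment[OF w(1)] by simp
    also have "\<dots> \<subseteq> A \<union> B" using A B x y wAB by (meson Un_mono closed_segment_subset)
    finally show ?thesis .
  qed
  show ?thesis unfolding convex_contains_segment
  proof (intro ballI)
    fix x y assume "x \<in> A \<union> B" "y \<in> A \<union> B"
    then consider "x \<in> A" "y \<in> A" | "x \<in> B" "y \<in> B" | "x \<in> A" "y \<in> B" | "x \<in> B" "y \<in> A" by blast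
    then show "closed_segment x y \<subseteq> A \<union> B"
    proof cases
      case 1 then show ?thesis using closed_segment_subset[OF _ _ A] by blast
    next
      case 2 then show ?thesis using closed_segment_subset[OF _ _ B] by blast
    next
      case 3 then show ?thesis using cross by blast
    next
      case 4 then show ?thesis using cross[of y x] by (simp add: closed_segment_commute)
    qed
  qed
qed

section \<open>Developing one side of the circuit\<close>

type_synonym sface = "(real^3) set \<times> bool"

text \<open>The common form of \<open>side_adj\<close> and \<open>uncut_adj\<close>: W are the edges
  that may be crossed, X is what such an edge must contain (\<open>{v}\<close> for turning about v,
  \<open>{}\<close> for no condition), and S are the available faces, which vary during the
  development.\<close>

definition adj :: "(real^3) set set \<Rightarrow> (real^3) set \<Rightarrow> sface set \<Rightarrow> (sface \<times> sface) set" where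
  "adj W X S = {(\<phi>, \<psi>). \<phi> \<in> S \<and> \<psi> \<in> S \<and> \<phi> \<noteq> \<psi> \<and> (\<exists>e\<in>W. X \<subseteq> e \<and> e \<subseteq> fst \<phi> \<and> e \<subseteq> fst \<psi>)}"

lemma sym_adj: "sym (adj W X S)"
  unfolding adj_def sym_def by blast

lemma adj_rtrancl_sym: "(\<phi>, \<psi>) \<in> (adj W X S)\<^sup>* \<Longrightarrow> (\<psi>, \<phi>) \<in> (adj W X S)\<^sup>*"
  using sym_rtrancl[OF sym_adj] by (meson symD)

lemma adj_mono:
  assumes "S \<subseteq> S'" "W \<subseteq> W'" "X' \<subseteq> X"
  shows "adj W X S \<subseteq> adj W' X' S'"
proof (rule subrelI)
  fix \<phi> \<psi> assume "(\<phi>, \<psi>) \<in> adj W X S"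
  then obtain e where e: "\<phi> \<in> S" "\<psi> \<in> S" "\<phi> \<noteq> \<psi>" "e \<in> W" "X \<subseteq> e" "e \<subseteq> fst \<phi>" "e \<subseteq> fst \<psi>"
    unfolding adj_def by auto
  then have "\<phi> \<in> S'" "\<psi> \<in> S'" "e \<in> W'" "X' \<subseteq> e" using assms by auto
  then show "(\<phi>, \<psi>) \<in> adj W' X' S'" unfolding adj_def using e by auto
qed

lemma adj_rtrancl_mono:
  assumes "S \<subseteq> S'" "W \<subseteq> W'" "X' \<subseteq> X" "p \<in> (adj W X S)\<^sup>*"
  shows "p \<in> (adj W' X' S')\<^sup>*"
  by (rule subsetD[OF rtrancl_mono[OF adj_mono[OF assms(1-3)]] assms(4)])

lemma chart_comb:
  assumes "chart F h" "u \<in> F" "v \<in> F" "c \<in> F" "y \<in> F" and y: "y - u = s *\<^sub>R (v - u) + t *\<^sub>R (c - u)"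
  shows "h y - h u = s *\<^sub>R (h v - h u) + t *\<^sub>R (h c - h u)"
proof -
  obtain J where J: "linear J" "\<And>z. norm (J z) = norm z"
    "\<And>x y. x \<in> F \<Longrightarrow> y \<in> F \<Longrightarrow> y - x = J (h y - h x)" by (rule chart_diff[OF assms(1)]) blast
  have "J (h y - h u) = s *\<^sub>R J (h v - h u) + t *\<^sub>R J (h c - h u)"
    using y unfolding J(3)[OF assms(2,5)] J(3)[OF assms(2,3)] J(3)[OF assms(2,4)] .
  then have "J ((h y - h u) - (s *\<^sub>R (h v - h u) + t *\<^sub>R (h c - h u))) = 0"
    by (simp only: linear_diff[OF J(1)] linear_add[OF J(1)] linear_scale[OF J(1)]) simp
  then have "(h y - h u) - (s *\<^sub>R (h v - h u) + t *\<^sub>R (h c - h u)) = 0" using J(2) by (metis norm_eq_zero)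
  then show ?thesis by simp
qed

text \<open>U is the set of edges off the circuit, e0 the one edge of the circuit which will not be cut.\<close>
locale slit_surface =
  fixes P :: "(real^3) set" and U :: "(real^3) set set" and e0 :: "(real^3) set"
  assumes polyP: "polytope P"
    and face: "\<And>\<phi>. \<phi> \<in> surf_faces P \<Longrightarrow> fst \<phi> face_of P" "\<And>\<phi>. \<phi> \<in> surf_faces P \<Longrightarrow> aff_dim (fst \<phi>) = 2"
    and finite_faces: "finite (surf_faces P)"
    and U: "insert e0 U \<subseteq> poly_edges P" "e0 \<notin> U"
    and two_faces: "\<And>e. e \<in> poly_edges P \<Longrightarrow> \<exists>\<phi> \<psi>. \<phi> \<noteq> \<psi> \<and> {\<omega> \<in> surf_faces P. e \<subseteq> fst \<omega>} = {\<phi>, \<psi>}"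
    and acyclic: "\<And>C. C \<subseteq> insert e0 U \<Longrightarrow> (\<And>\<phi>. \<phi> \<in> surf_faces P \<Longrightarrow> even (card {e \<in> C. e \<subseteq> fst \<phi>})) \<Longrightarrow> C = {}"
    and side: "\<And>\<phi> v. \<phi> \<in> surf_faces P \<Longrightarrow> v \<in> poly_vertices P \<Longrightarrow> v \<in> fst \<phi> \<Longrightarrow>
      (\<Sum>\<psi> | \<psi> \<in> surf_faces P \<and> v \<in> fst \<psi> \<and> (\<phi>, \<psi>) \<in> (adj U {v} (surf_faces P))\<^sup>*. face_angle (fst \<psi>) v) \<le> pi"
begin

section \<open>Faces of the slit surface and parities of paths through them\<close>

abbreviation faces :: "sface set" where "faces \<equiv> surf_faces P"

lemma faceD:
  assumes "\<phi> \<in> faces"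
  shows "polytope (fst \<phi>)" "convex (fst \<phi>)" "fst \<phi> \<subseteq> P" "compact (fst \<phi>)"
  using face_of_polytope_polytope[OF polyP face(1)[OF assms]] face_of_imp_convex[OF face(1)[OF assms]]
    face_of_imp_subset[OF face(1)[OF assms]] polytope_imp_compact by auto

lemma edge_of_face:
  assumes "\<phi> \<in> faces" "e \<in> poly_edges P" "e \<subseteq> fst \<phi>" shows "e face_of fst \<phi>"
  using assms edge_in_face face unfolding poly_edges_def by blast

lemma edge_segment:
  assumes "e \<in> poly_edges P"
  obtains u v where "u \<noteq> v" "e = closed_segment u v" "u \<in> poly_vertices P" "v \<in> poly_vertices P"
  using assms polytope_1_segment[OF polyP, of e] unfolding poly_edges_def poly_vertices_def by blast

lemma vertex_of_face: "\<phi> \<in> faces \<Longrightarrow> v \<in> poly_vertices P \<Longrightarrow> v \<in> fst \<phi> \<Longrightarrow> v extreme_point_of fst \<phi>"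
  using extreme_point_of_face[OF face(1)] unfolding poly_vertices_def by blast

lemma third_face:
  assumes "e \<in> poly_edges P" "\<phi> \<in> faces" "\<psi> \<in> faces" "\<omega> \<in> faces" "\<phi> \<noteq> \<psi>"
    "e \<subseteq> fst \<phi>" "e \<subseteq> fst \<psi>" "e \<subseteq> fst \<omega>"
  shows "\<omega> = \<phi> \<or> \<omega> = \<psi>"
proof -
  obtain a b where "{\<omega> \<in> faces. e \<subseteq> fst \<omega>} = {a, b}" using two_faces[OF assms(1)] by blast
  then have "\<phi> \<in> {a, b}" "\<psi> \<in> {a, b}" "\<omega> \<in> {a, b}" using assms by blast+
  then show ?thesis using assms(5) by auto
qed

lemma finite_edges: "finite (poly_edges P)"
  unfolding poly_edges_def using finite_face_set[OF polyP] .

lemma finite_sub_U: "C \<subseteq> U \<Longrightarrow> finite C"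
  by (rule finite_subset[OF _ finite_edges]) (use U in auto)

lemma face_angle_pos: "\<phi> \<in> faces \<Longrightarrow> v \<in> poly_vertices P \<Longrightarrow> v \<in> fst \<phi> \<Longrightarrow> 0 < face_angle (fst \<phi>) v"
  and face_angle_less: "\<phi> \<in> faces \<Longrightarrow> v \<in> poly_vertices P \<Longrightarrow> v \<in> fst \<phi> \<Longrightarrow> face_angle (fst \<phi>) v < pi"
  using face_angle_bounds[OF faceD(1) face(2) vertex_of_face] by auto

text \<open>\<open>C\<close> holds the edges that the path crosses an odd number of times. Each
  crossing changes the parity at the two faces it joins, so only the ends of the path remain odd.
  That all faces at the edges of \<open>C\<close> belong to S keeps \<open>C\<close> apart from
  edges leading out of S.\<close>

lemma path_parity:
  assumes S: "S \<subseteq> faces" and p: "(\<phi>, \<psi>) \<in> (adj U {} S)\<^sup>*"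
  shows "\<exists>C\<subseteq>U. (\<forall>e\<in>C. \<forall>\<omega>\<in>faces. e \<subseteq> fst \<omega> \<longrightarrow> \<omega> \<in> S) \<and>
    (\<forall>\<omega>\<in>faces. odd (card {e \<in> C. e \<subseteq> fst \<omega>}) \<longleftrightarrow> (\<omega> = \<phi>) \<noteq> (\<omega> = \<psi>))"
  using p
proof (induction rule: rtrancl_induct)
  case base
  show ?case by (intro exI[of _ "{}"]) auto
next
  case (step \<psi> \<psi>')
  obtain C where C: "C \<subseteq> U" "\<forall>e\<in>C. \<forall>\<omega>\<in>faces. e \<subseteq> fst \<omega> \<longrightarrow> \<omega> \<in> S"
    "\<forall>\<omega>\<in>faces. odd (card {e \<in> C. e \<subseteq> fst \<omega>}) \<longleftrightarrow> (\<omega> = \<phi>) \<noteq> (\<omega> = \<psi>)" using step.IH by blast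
  obtain e where e: "e \<in> U" "e \<subseteq> fst \<psi>" "e \<subseteq> fst \<psi>'" "\<psi> \<noteq> \<psi>'" "\<psi> \<in> S" "\<psi>' \<in> S"
    using step.hyps(2) unfolding adj_def by blast
  have eE: "e \<in> poly_edges P" using e U by blast
  have ef: "\<omega> = \<psi> \<or> \<omega> = \<psi>'" if "\<omega> \<in> faces" "e \<subseteq> fst \<omega>" for \<omega>
  proof -
    have "\<psi> \<in> faces" "\<psi>' \<in> faces" using e S by auto
    then show ?thesis using third_face[OF eE _ _ that(1) e(4,2,3) that(2)] by simp
  qed
  \<comment> \<open>Addition of the crossed edge modulo 2: an edge crossed for the second time is
    removed again.\<close>
  define C' where "C' = (if e \<in> C then C - {e} else insert e C)"
  have fC: "finite C" using finite_sub_U[OF C(1)] .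
  have par: "odd (card {x \<in> C'. x \<subseteq> fst \<omega>}) \<longleftrightarrow> odd (card {x \<in> C. x \<subseteq> fst \<omega>}) \<noteq> (e \<subseteq> fst \<omega>)" for \<omega>
  proof (cases "e \<subseteq> fst \<omega>")
    case False
    then have "{x \<in> C'. x \<subseteq> fst \<omega>} = {x \<in> C. x \<subseteq> fst \<omega>}" unfolding C'_def by auto
    then show ?thesis using False by simp
  next
    case True
    have f: "finite {x \<in> C. x \<subseteq> fst \<omega>}" using fC by simp
    show ?thesis
    proof (cases "e \<in> C")
      case in_C: True
      then have "{x \<in> C. x \<subseteq> fst \<omega>} = insert e {x \<in> C'. x \<subseteq> fst \<omega>}" "e \<notin> {x \<in> C'. x \<subseteq> fst \<omega>}"
        using True unfolding C'_def by auto
      then have "card {x \<in> C. x \<subseteq> fst \<omega>} = Suc (card {x \<in> C'. x \<subseteq> fst \<omega>})"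
        using fC by (simp only:) (intro card_insert_disjoint; auto simp: C'_def)
      then show ?thesis using True by simp
    next
      case False
      then have "{x \<in> C'. x \<subseteq> fst \<omega>} = insert e {x \<in> C. x \<subseteq> fst \<omega>}" "e \<notin> {x \<in> C. x \<subseteq> fst \<omega>}"
        using True unfolding C'_def by auto
      then show ?thesis using True f by simp
    qed
  qed
  have "C' \<subseteq> U" using C(1) e(1) unfolding C'_def by auto
  moreover have "\<forall>x\<in>C'. \<forall>\<omega>\<in>faces. x \<subseteq> fst \<omega> \<longrightarrow> \<omega> \<in> S"
    using C(2) ef e unfolding C'_def by (auto split: if_splits)
  moreover have "odd (card {x \<in> C'. x \<subseteq> fst \<omega>}) \<longleftrightarrow> (\<omega> = \<phi>) \<noteq> (\<omega> = \<psi>')" if "\<omega> \<in> faces" for \<omega>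
    using par[of \<omega>] C(3) ef[OF that] e that by blast
  ultimately show ?case by blast
qed

text \<open>Two edges from f into the connected part S would close a cycle: together with the parity
  set of a path in S from \<open>\<phi>1\<close> to \<open>\<phi>2\<close> they are even at every
  face. Neither edge cancels, since the parity set has no edge of f.\<close>

lemma unique_link:
  assumes S: "S \<subseteq> faces" and p: "(\<phi>1, \<phi>2) \<in> (adj U {} S)\<^sup>*" and f: "f \<in> faces" "f \<notin> S"
    and \<phi>: "\<phi>1 \<in> S" "\<phi>2 \<in> S"
    and e: "e1 \<in> U" "e2 \<in> U" "e1 \<subseteq> fst \<phi>1" "e2 \<subseteq> fst \<phi>2" "e1 \<subseteq> fst f" "e2 \<subseteq> fst f"
  shows "e1 = e2"
proof (rule ccontr)
  assume ne: "e1 \<noteq> e2"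
  obtain C where C: "C \<subseteq> U" "\<forall>e\<in>C. \<forall>\<omega>\<in>faces. e \<subseteq> fst \<omega> \<longrightarrow> \<omega> \<in> S"
    "\<forall>\<omega>\<in>faces. odd (card {e \<in> C. e \<subseteq> fst \<omega>}) \<longleftrightarrow> (\<omega> = \<phi>1) \<noteq> (\<omega> = \<phi>2)" using path_parity[OF S p] by blast
  have fC: "finite C" using finite_sub_U[OF C(1)] .
  have eC: "e1 \<notin> C" "e2 \<notin> C" using C(2) e f by blast+
  have ef: "e1 \<subseteq> fst \<omega> \<longleftrightarrow> \<omega> = \<phi>1 \<or> \<omega> = f" "e2 \<subseteq> fst \<omega> \<longleftrightarrow> \<omega> = \<phi>2 \<or> \<omega> = f" if "\<omega> \<in> faces" for \<omega>
  proof -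
    have "e1 \<in> poly_edges P" "e2 \<in> poly_edges P" "\<phi>1 \<in> faces" "\<phi>2 \<in> faces" "\<phi>1 \<noteq> f" "\<phi>2 \<noteq> f"
      using e U \<phi> S f by auto
    then show "e1 \<subseteq> fst \<omega> \<longleftrightarrow> \<omega> = \<phi>1 \<or> \<omega> = f" "e2 \<subseteq> fst \<omega> \<longleftrightarrow> \<omega> = \<phi>2 \<or> \<omega> = f"
      using third_face[of e1 \<phi>1 f \<omega>] third_face[of e2 \<phi>2 f \<omega>] that e f(1) by auto
  qed
  have "even (card {e \<in> insert e1 (insert e2 C). e \<subseteq> fst \<omega>})" if \<omega>: "\<omega> \<in> faces" for \<omega>
  proof -
    have "{e \<in> insert e1 (insert e2 C). e \<subseteq> fst \<omega>} =
        {e. e = e1 \<and> e \<subseteq> fst \<omega>} \<union> {e. e = e2 \<and> e \<subseteq> fst \<omega>} \<union> {e \<in> C. e \<subseteq> fst \<omega>}" by auto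
    moreover have "card \<dots> = card {e. e = e1 \<and> e \<subseteq> fst \<omega>} + card {e. e = e2 \<and> e \<subseteq> fst \<omega>} + card {e \<in> C. e \<subseteq> fst \<omega>}"
      using ne eC fC by (subst card_Un_disjoint; (subst card_Un_disjoint)?) auto
    moreover have "card {e. e = e1 \<and> e \<subseteq> fst \<omega>} = (if e1 \<subseteq> fst \<omega> then 1 else 0)" 
      by (cases "e1 \<subseteq> fst \<omega>") (auto simp: conj_commute cong: conj_cong)
    moreover have "card {e. e = e2 \<and> e \<subseteq> fst \<omega>} = (if e2 \<subseteq> fst \<omega> then 1 else 0)" 
      by (cases "e2 \<subseteq> fst \<omega>") (auto simp: conj_commute cong: conj_cong)
    moreover have "odd (card {e \<in> C. e \<subseteq> fst \<omega>}) \<longleftrightarrow> (\<omega> = \<phi>1) \<noteq> (\<omega> = \<phi>2)" using C(3) \<omega> by blast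
    moreover have "f \<noteq> \<phi>1" "f \<noteq> \<phi>2" using f \<phi> by auto
    ultimately show ?thesis using ef[OF \<omega>] by (cases "\<omega> = f"; cases "\<omega> = \<phi>1"; cases "\<omega> = \<phi>2") auto
  qed
  then have "insert e1 (insert e2 C) = {}" using C(1) e by (intro acyclic) auto
  then show False by simp
qed

text \<open>A path off the circuit between the two faces at e0 would close up through e0: its parity
  set with e0 added is even at every face and not empty. This takes the place of the Jordan curve
  theorem.\<close>

lemma sides_separate:
  assumes e0: "e0 \<subseteq> fst \<phi>" "e0 \<subseteq> fst \<psi>" and \<phi>: "\<phi> \<in> faces" "\<psi> \<in> faces" "\<phi> \<noteq> \<psi>"
  shows "(\<phi>, \<psi>) \<notin> (adj U {} faces)\<^sup>*"
proof
  assume a: "(\<phi>, \<psi>) \<in> (adj U {} faces)\<^sup>*"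
  obtain C where C: "C \<subseteq> U"
    "\<forall>\<omega>\<in>faces. odd (card {e \<in> C. e \<subseteq> fst \<omega>}) \<longleftrightarrow> (\<omega> = \<phi>) \<noteq> (\<omega> = \<psi>)" using path_parity[OF order_refl a] by blast
  have fC: "finite C" using finite_sub_U[OF C(1)] .
  have eC: "e0 \<notin> C" using C U by blast
  have ef: "e0 \<subseteq> fst \<omega> \<longleftrightarrow> \<omega> = \<phi> \<or> \<omega> = \<psi>" if "\<omega> \<in> faces" for \<omega>
  proof -
    have "e0 \<in> poly_edges P" using U by simp
    then show ?thesis using third_face[of e0 \<phi> \<psi> \<omega>] that e0 \<phi> by auto
  qed
  have "even (card {e \<in> insert e0 C. e \<subseteq> fst \<omega>})" if \<omega>: "\<omega> \<in> faces" for \<omega>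
  proof (cases "e0 \<subseteq> fst \<omega>")
    case True
    then have "{e \<in> insert e0 C. e \<subseteq> fst \<omega>} = insert e0 {e \<in> C. e \<subseteq> fst \<omega>}" by auto
    moreover have "odd (card {e \<in> C. e \<subseteq> fst \<omega>})" using C(2) \<omega> ef[OF \<omega>] True \<phi>(3) by blast
    ultimately show ?thesis using fC eC by simp
  next
    case False
    then have "{e \<in> insert e0 C. e \<subseteq> fst \<omega>} = {e \<in> C. e \<subseteq> fst \<omega>}" by auto
    then show ?thesis using C(2) \<omega> ef[OF \<omega>] False by auto
  qed
  then have "insert e0 C = {}" using C(1) by (intro acyclic) auto
  then show False by simp
qed

section \<open>The invariant of the development and its supporting lines\<close>

definition fan :: "sface set \<Rightarrow> sface \<Rightarrow> real^3 \<Rightarrow> sface set" where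
  "fan S \<phi> v = {\<psi>. (\<phi>, \<psi>) \<in> (adj U {v} S)\<^sup>*}"

text \<open>A boundary edge of the development: it lies on the circuit, or the face across it is not
  in S. It is considered together with its face, since an edge of the circuit is free in both of its
  faces.\<close>

definition free_edge :: "sface set \<Rightarrow> sface \<Rightarrow> real^3 \<Rightarrow> real^3 \<Rightarrow> bool" where
  "free_edge S \<phi> v w \<longleftrightarrow> closed_segment v w \<in> poly_edges P \<and> closed_segment v w \<subseteq> fst \<phi> \<and>
     \<not> (closed_segment v w \<in> U \<and> (\<exists>\<psi>\<in>S. \<psi> \<noteq> \<phi> \<and> closed_segment v w \<subseteq> fst \<psi>))"

definition region :: "sface set \<Rightarrow> (sface \<Rightarrow> real^3 \<Rightarrow> real^2) \<Rightarrow> (real^2) set" where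
  "region S g = (\<Union>\<phi>\<in>S. g \<phi> ` fst \<phi>)"

text \<open>A vertex of P may a priori occur at several corners of the development of S; a corner is a fan, not a vertex.\<close>
definition corner :: "sface set \<Rightarrow> (sface \<Rightarrow> real^3 \<Rightarrow> real^2) \<Rightarrow> sface \<Rightarrow> real^3 \<Rightarrow> bool" where
  "corner S g \<phi> v \<longleftrightarrow> (\<exists>\<phi>1 w1 \<phi>2 w2. \<phi>1 \<in> fan S \<phi> v \<and> \<phi>2 \<in> fan S \<phi> v \<and> free_edge S \<phi>1 v w1 \<and> free_edge S \<phi>2 v w2 \<and>
     ang (g \<phi>1 w1 - g \<phi> v) (g \<phi>2 w2 - g \<phi> v) = (\<Sum>\<psi>\<in>fan S \<phi> v. face_angle (fst \<psi>) v) \<and>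
     (\<forall>\<psi>\<in>fan S \<phi> v. \<forall>w. free_edge S \<psi> v w \<longrightarrow> (\<psi>, w) = (\<phi>1, w1) \<or> (\<psi>, w) = (\<phi>2, w2)))"

text \<open>The induction hypothesis. The clauses on gluing and injectivity are those of
  \<open>edge_unfolding\<close> and \<open>is_net\<close>, for the part S and with all of the
  circuit cut; convexity and the corner condition are added to make the next attachment
  possible.\<close>

definition developed :: "sface set \<Rightarrow> (sface \<Rightarrow> real^3 \<Rightarrow> real^2) \<Rightarrow> bool" where
  "developed S g \<longleftrightarrow> S \<subseteq> faces \<and> (\<forall>\<phi>\<in>S. chart (fst \<phi>) (g \<phi>)) \<and>
     (\<forall>\<phi>\<in>S. \<forall>\<psi>\<in>S. (\<phi>, \<psi>) \<in> (adj U {} S)\<^sup>*) \<and>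
     (\<forall>e\<in>U. \<forall>\<phi>\<in>S. \<forall>\<psi>\<in>S. \<phi> \<noteq> \<psi> \<longrightarrow> e \<subseteq> fst \<phi> \<longrightarrow> e \<subseteq> fst \<psi> \<longrightarrow>
        (\<forall>x\<in>e. g \<phi> x = g \<psi> x) \<and> interior (g \<phi> ` fst \<phi>) \<inter> interior (g \<psi> ` fst \<psi>) = {}) \<and>
     convex (region S g) \<and>
     (\<forall>\<phi>\<in>S. \<forall>\<psi>\<in>S. \<forall>x\<in>fst \<phi>. \<forall>y\<in>fst \<psi>. g \<phi> x = g \<psi> y \<longrightarrow> x = y \<and> (\<phi>, \<psi>) \<in> (adj U {x} S)\<^sup>*) \<and>
     (\<forall>\<phi>\<in>S. \<forall>v\<in>poly_vertices P. v \<in> fst \<phi> \<longrightarrow> corner S g \<phi> v)"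

lemma developedD:
  assumes "developed S g"
  shows "S \<subseteq> faces" "\<And>\<phi>. \<phi> \<in> S \<Longrightarrow> chart (fst \<phi>) (g \<phi>)"
    "\<And>\<phi> \<psi>. \<phi> \<in> S \<Longrightarrow> \<psi> \<in> S \<Longrightarrow> (\<phi>, \<psi>) \<in> (adj U {} S)\<^sup>*"
    "\<And>e \<phi> \<psi> x. e \<in> U \<Longrightarrow> \<phi> \<in> S \<Longrightarrow> \<psi> \<in> S \<Longrightarrow> \<phi> \<noteq> \<psi> \<Longrightarrow> e \<subseteq> fst \<phi> \<Longrightarrow> e \<subseteq> fst \<psi> \<Longrightarrow> x \<in> e \<Longrightarrow> g \<phi> x = g \<psi> x"
    "\<And>e \<phi> \<psi>. e \<in> U \<Longrightarrow> \<phi> \<in> S \<Longrightarrow> \<psi> \<in> S \<Longrightarrow> \<phi> \<noteq> \<psi> \<Longrightarrow> e \<subseteq> fst \<phi> \<Longrightarrow> e \<subseteq> fst \<psi> \<Longrightarrow>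
      interior (g \<phi> ` fst \<phi>) \<inter> interior (g \<psi> ` fst \<psi>) = {}"
    "convex (region S g)"
    "\<And>\<phi> \<psi> x y. \<phi> \<in> S \<Longrightarrow> \<psi> \<in> S \<Longrightarrow> x \<in> fst \<phi> \<Longrightarrow> y \<in> fst \<psi> \<Longrightarrow> g \<phi> x = g \<psi> y \<Longrightarrow> x = y"
    "\<And>\<phi> \<psi> x. \<phi> \<in> S \<Longrightarrow> \<psi> \<in> S \<Longrightarrow> x \<in> fst \<phi> \<Longrightarrow> x \<in> fst \<psi> \<Longrightarrow> g \<phi> x = g \<psi> x \<Longrightarrow> (\<phi>, \<psi>) \<in> (adj U {x} S)\<^sup>*"
    "\<And>\<phi> v. \<phi> \<in> S \<Longrightarrow> v \<in> poly_vertices P \<Longrightarrow> v \<in> fst \<phi> \<Longrightarrow> corner S g \<phi> v"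
proof -
  note d = assms[unfolded developed_def]
  note d1 = d[THEN conjunct1] and r1 = d[THEN conjunct2]
  note d2 = r1[THEN conjunct1] and r2 = r1[THEN conjunct2]
  note d3 = r2[THEN conjunct1] and r3 = r2[THEN conjunct2]
  note d4 = r3[THEN conjunct1] and r4 = r3[THEN conjunct2]
  note d5 = r4[THEN conjunct1] and r5 = r4[THEN conjunct2]
  note d6 = r5[THEN conjunct1] and d7 = r5[THEN conjunct2]
  show "S \<subseteq> faces" using d1 .
  show "\<And>\<phi>. \<phi> \<in> S \<Longrightarrow> chart (fst \<phi>) (g \<phi>)" using d2 by simp
  show "\<And>\<phi> \<psi>. \<phi> \<in> S \<Longrightarrow> \<psi> \<in> S \<Longrightarrow> (\<phi>, \<psi>) \<in> (adj U {} S)\<^sup>*" using d3 by simp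
  show "convex (region S g)" using d5 .
  show "\<And>\<phi> v. \<phi> \<in> S \<Longrightarrow> v \<in> poly_vertices P \<Longrightarrow> v \<in> fst \<phi> \<Longrightarrow> corner S g \<phi> v" using d7 by simp
  fix \<phi> \<psi> assume S: "\<phi> \<in> S" "\<psi> \<in> S"
  note d4' = d4[rule_format, OF _ S] and d6' = d6[rule_format, OF S]
  show "g \<phi> x = g \<psi> x" if "e \<in> U" "\<phi> \<noteq> \<psi>" "e \<subseteq> fst \<phi>" "e \<subseteq> fst \<psi>" "x \<in> e" for e x
    using d4'[OF that(1-4)] that(5) by simp
  show "interior (g \<phi> ` fst \<phi>) \<inter> interior (g \<psi> ` fst \<psi>) = {}" if "e \<in> U" "\<phi> \<noteq> \<psi>" "e \<subseteq> fst \<phi>" "e \<subseteq> fst \<psi>" for e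
    using d4'[OF that] by simp
  show "x = y" if "x \<in> fst \<phi>" "y \<in> fst \<psi>" "g \<phi> x = g \<psi> y" for x y
    using d6'[OF that] by simp
  show "(\<phi>, \<psi>) \<in> (adj U {x} S)\<^sup>*" if "x \<in> fst \<phi>" "x \<in> fst \<psi>" "g \<phi> x = g \<psi> x" for x
    using d6'[OF that] by simp
qed

lemma fan_self: "\<phi> \<in> fan S \<phi> v"
  by (simp add: fan_def)

lemma fan_eq: "\<psi> \<in> fan S \<phi> v \<Longrightarrow> fan S \<psi> v = fan S \<phi> v"
  unfolding fan_def using adj_rtrancl_sym by (blast intro: rtrancl_trans)

lemma fan_subset:
  assumes "\<phi> \<in> S" "v \<in> fst \<phi>" "\<psi> \<in> fan S \<phi> v"
  shows "\<psi> \<in> S" "v \<in> fst \<psi>"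
proof -
  have "(\<phi>, \<psi>) \<in> (adj U {v} S)\<^sup>*" using assms by (simp add: fan_def)
  then have "\<psi> \<in> S \<and> v \<in> fst \<psi>"
    by (induction rule: rtrancl_induct) (use assms in \<open>auto simp: adj_def\<close>)
  then show "\<psi> \<in> S" "v \<in> fst \<psi>" by auto
qed

lemma fan_image:
  assumes "developed S g" "\<phi> \<in> S" "\<psi> \<in> fan S \<phi> v"
  shows "g \<psi> v = g \<phi> v"
proof -
  have "(\<phi>, \<psi>) \<in> (adj U {v} S)\<^sup>*" using assms by (simp add: fan_def)
  then show ?thesis
  proof (induction rule: rtrancl_induct)
    case (step y z)
    then obtain e where "e \<in> U" "v \<in> e" "y \<in> S" "z \<in> S" "y \<noteq> z" "e \<subseteq> fst y" "e \<subseteq> fst z"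
      unfolding adj_def by auto
    then have "g y v = g z v" using developedD(4)[OF assms(1)] by blast
    then show ?case using step by simp
  qed auto
qed

lemma finite_fan: "\<phi> \<in> S \<Longrightarrow> S \<subseteq> faces \<Longrightarrow> v \<in> fst \<phi> \<Longrightarrow> finite (fan S \<phi> v)"
  using fan_subset(1) finite_faces by (meson finite_subset subsetI subset_trans)

lemma fan_sum_pos:
  assumes "\<phi> \<in> S" "S \<subseteq> faces" "v \<in> poly_vertices P" "v \<in> fst \<phi>"
  shows "0 < (\<Sum>\<psi>\<in>fan S \<phi> v. face_angle (fst \<psi>) v)"
proof (rule sum_pos)
  show "finite (fan S \<phi> v)" using finite_fan assms by blast
  show "fan S \<phi> v \<noteq> {}" using fan_self by blast
  show "0 < face_angle (fst \<psi>) v" if "\<psi> \<in> fan S \<phi> v" for \<psi>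
    using fan_subset[OF assms(1,4) that] face_angle_pos assms by blast
qed

text \<open>Either bounding edge of a corner may be taken as the first one. The two are different,
  because the angle between them is a positive sum while an edge makes the angle 0 with
  itself.\<close>

lemma corner_other:
  assumes dev: "developed S g" and \<phi>: "\<phi> \<in> S" "v \<in> poly_vertices P" "v \<in> fst \<phi>" and w: "free_edge S \<phi> v w"
  obtains \<phi>2 w2 where "\<phi>2 \<in> fan S \<phi> v" "free_edge S \<phi>2 v w2" "(\<phi>2, w2) \<noteq> (\<phi>, w)"
    "ang (g \<phi> w - g \<phi> v) (g \<phi>2 w2 - g \<phi> v) = (\<Sum>\<psi>\<in>fan S \<phi> v. face_angle (fst \<psi>) v)"
    "\<And>\<psi> w'. \<psi> \<in> fan S \<phi> v \<Longrightarrow> free_edge S \<psi> v w' \<Longrightarrow> (\<psi>, w') = (\<phi>, w) \<or> (\<psi>, w') = (\<phi>2, w2)"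
proof -
  obtain \<phi>1 w1 \<phi>2 w2 where c: "\<phi>1 \<in> fan S \<phi> v" "\<phi>2 \<in> fan S \<phi> v" "free_edge S \<phi>1 v w1" "free_edge S \<phi>2 v w2"
     "ang (g \<phi>1 w1 - g \<phi> v) (g \<phi>2 w2 - g \<phi> v) = (\<Sum>\<psi>\<in>fan S \<phi> v. face_angle (fst \<psi>) v)"
     "\<And>\<psi> w. \<psi> \<in> fan S \<phi> v \<Longrightarrow> free_edge S \<psi> v w \<Longrightarrow> (\<psi>, w) = (\<phi>1, w1) \<or> (\<psi>, w) = (\<phi>2, w2)"
    using developedD(9)[OF dev \<phi>] unfolding corner_def by blast
  have pos: "0 < (\<Sum>\<psi>\<in>fan S \<phi> v. face_angle (fst \<psi>) v)"
    using fan_sum_pos[OF \<phi>(1) developedD(1)[OF dev] \<phi>(2,3)] .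
  have "w \<noteq> v" "w \<in> fst \<phi>" using w poly_edges_segment_ne[of v w P] unfolding free_edge_def by auto
  then have "g \<phi> w - g \<phi> v \<noteq> 0" using chart_inj[OF developedD(2)[OF dev \<phi>(1)]] \<phi> by auto
  then have self: "ang (g \<phi> w - g \<phi> v) (g \<phi> w - g \<phi> v) = 0" by (rule ang_self)
  consider "(\<phi>, w) = (\<phi>1, w1)" | "(\<phi>, w) = (\<phi>2, w2)" using c(6)[OF fan_self w] by blast
  then show ?thesis
  proof cases
    case 1
    have "(\<phi>2, w2) \<noteq> (\<phi>, w)" using self c(5) 1 pos by auto
    then show ?thesis using that[of \<phi>2 w2] c 1 by blast
  next
    case 2
    have "(\<phi>1, w1) \<noteq> (\<phi>, w)" using self c(5) 2 pos by auto
    moreover have "ang (g \<phi> w - g \<phi> v) (g \<phi>1 w1 - g \<phi> v) = (\<Sum>\<psi>\<in>fan S \<phi> v. face_angle (fst \<psi>) v)"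
      using c(5) 2 by (simp add: ang_commute)
    ultimately show ?thesis using that[of \<phi>1 w1] c(1,3,6) 2 by auto
  qed
qed

text \<open>Near the midpoint of a free edge the region consists of the image of \<phi> alone. So
  the functional exposing the edge in \<phi> is nonnegative on the region near that point, and by
  convexity on the entire region.\<close>

lemma free_support:
  assumes dev: "developed S g" and \<phi>: "\<phi> \<in> S" and f: "free_edge S \<phi> u v"
  obtains d where "norm d = 1" "d \<bullet> (g \<phi> v - g \<phi> u) = 0" "\<And>z. z \<in> region S g \<Longrightarrow> d \<bullet> (z - g \<phi> u) \<le> 0"
proof -
  have e: "closed_segment u v \<in> poly_edges P" "closed_segment u v \<subseteq> fst \<phi>" using f by (auto simp: free_edge_def)
  have \<phi>f: "\<phi> \<in> faces" using \<phi> developedD(1)[OF dev] by blast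
  have uv: "u \<in> fst \<phi>" "v \<in> fst \<phi>" using e by auto
  have ch: "chart (fst \<phi>) (g \<phi>)" using developedD(2)[OF dev \<phi>] .
  have ef: "closed_segment u v face_of fst \<phi>" using edge_of_face[OF \<phi>f e] .
  obtain k where k: "\<And>p. p \<in> fst \<phi> \<Longrightarrow> 0 \<le> k \<bullet> (p - u)" "\<And>p. p \<in> fst \<phi> \<Longrightarrow> k \<bullet> (p - u) = 0 \<longleftrightarrow> p \<in> closed_segment u v"
    by (rule exposing_functional[OF faceD(1)[OF \<phi>f] ef, of u]) auto
  obtain m where m: "\<And>x y. x \<in> fst \<phi> \<Longrightarrow> y \<in> fst \<phi> \<Longrightarrow> m \<bullet> (g \<phi> y - g \<phi> x) = k \<bullet> (y - x)"
    by (rule chart_functional[OF ch]) blast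
  let ?x = "midpoint u v"
  have xe: "?x \<in> closed_segment u v" by simp
  then have x\<phi>: "?x \<in> fst \<phi>" using e by blast
  \<comment> \<open>By injectivity a second face covering this point would be joined to \<phi>
    through an uncut edge that contains the midpoint; this can only be the given edge, which is
    free.\<close>
  have away: "g \<phi> ?x \<notin> g \<psi> ` fst \<psi>" if \<psi>: "\<psi> \<in> S" "\<psi> \<noteq> \<phi>" for \<psi>
  proof
    assume "g \<phi> ?x \<in> g \<psi> ` fst \<psi>"
    then obtain y where y: "y \<in> fst \<psi>" "g \<psi> y = g \<phi> ?x" by auto
    then have yx: "y = ?x" using developedD(7)[OF dev \<psi>(1) \<phi> y(1) x\<phi>] by simp
    then have "(\<psi>, \<phi>) \<in> (adj U {?x} S)\<^sup>*" using developedD(8)[OF dev \<psi>(1) \<phi>, of ?x] x\<phi> y by simp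
    then obtain \<omega> where "(\<omega>, \<phi>) \<in> adj U {?x} S" using \<psi>(2) by (metis rtranclE)
    then obtain e' where e': "e' \<in> U" "?x \<in> e'" "e' \<subseteq> fst \<omega>" "\<omega> \<in> S" "\<omega> \<noteq> \<phi>" unfolding adj_def by auto
    have "e' = closed_segment u v" using edge_midpoint[OF polyP e(1) _ e'(2)] e' U by blast
    then show False using f e' unfolding free_edge_def by blast
  qed
  define B where "B = (\<Union>\<psi>\<in>S - {\<phi>}. g \<psi> ` fst \<psi>)"
  have "finite S" using developedD(1)[OF dev] finite_faces finite_subset by blast
  moreover have "closed (g \<psi> ` fst \<psi>)" if "\<psi> \<in> S" for \<psi>
    using compact_continuous_image[OF chart_continuous[OF developedD(2)[OF dev that]]] faceD(4) that developedD(1)[OF dev]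
      compact_imp_closed by blast
  ultimately have "closed B" unfolding B_def by (intro closed_UN) auto
  moreover have "g \<phi> ?x \<in> - B" unfolding B_def using away by auto
  ultimately obtain \<epsilon> where \<epsilon>: "\<epsilon> > 0" "ball (g \<phi> ?x) \<epsilon> \<subseteq> - B"
    using open_contains_ball[of "- B"] by auto
  have RB: "region S g \<subseteq> B \<union> g \<phi> ` fst \<phi>" unfolding region_def B_def by auto
  have xW: "g \<phi> ?x \<in> region S g" unfolding region_def using \<phi> x\<phi> by blast
  have mx: "m \<bullet> (g \<phi> ?x - g \<phi> u) = 0" using m[OF uv(1) x\<phi>] k(2)[OF x\<phi>] xe by simp
  have ge: "0 \<le> m \<bullet> (z - g \<phi> u)" if z: "z \<in> region S g" for z
  proof -
    define D where "D = norm (z - g \<phi> ?x)"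
    \<comment> \<open>Small enough for the point at fraction t of the way to z to stay in the ball;
      \<open>D + 1\<close> avoids a division by zero.\<close>
    define t where "t = min 1 (\<epsilon> / (2 * (D + 1)))"
    have D: "D \<ge> 0" unfolding D_def by simp
    have t: "0 < t" "t \<le> 1" unfolding t_def using \<epsilon> D by auto
    have "t * D < \<epsilon>"
    proof -
      have "t * D \<le> \<epsilon> / (2 * (D + 1)) * D" using D by (intro mult_right_mono) (auto simp: t_def)
      also have "\<dots> < \<epsilon>" using D \<epsilon>(1) by (simp add: divide_less_eq) 
      finally show ?thesis .
    qed
    let ?w = "(1 - t) *\<^sub>R g \<phi> ?x + t *\<^sub>R z"
    have "?w - g \<phi> ?x = t *\<^sub>R (z - g \<phi> ?x)" by (simp add: algebra_simps)
    then have "dist ?w (g \<phi> ?x) = t * D" using t unfolding D_def dist_norm by simp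
    then have "?w \<in> ball (g \<phi> ?x) \<epsilon>" using \<open>t * D < \<epsilon>\<close> by (simp add: dist_commute)
    moreover have "?w \<in> region S g" using developedD(6)[OF dev] xW z t by (simp add: convex_alt)
    ultimately have "?w \<in> g \<phi> ` fst \<phi>" using \<epsilon>(2) RB by blast
    then obtain y where y: "y \<in> fst \<phi>" "?w = g \<phi> y" by auto
    have "0 \<le> m \<bullet> (?w - g \<phi> u)" unfolding y(2) using m[OF uv(1) y(1)] k(1)[OF y(1)] by simp
    also have "m \<bullet> (?w - g \<phi> u) = (1 - t) * (m \<bullet> (g \<phi> ?x - g \<phi> u)) + t * (m \<bullet> (z - g \<phi> u))"
      by (simp add: algebra_simps)
    finally show ?thesis using mx t by (simp add: zero_le_mult_iff)
  qed
  have uvne: "u \<noteq> v" using poly_edges_segment_ne[OF e(1)] .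
  obtain c where c: "closed_segment u c face_of fst \<phi>" "c \<notin> closed_segment u v"
    by (rule polygon_edge_corner[OF faceD(1)[OF \<phi>f] face(2)[OF \<phi>f] ef uvne]) blast
  have "c \<in> fst \<phi>" using face_of_imp_subset[OF c(1)] by auto
  then have "m \<bullet> (g \<phi> c - g \<phi> u) \<noteq> 0" using m[OF uv(1)] k(2) c by simp
  then have m0: "m \<noteq> 0" by auto
  show ?thesis
  proof (rule that[of "- (1 / norm m) *\<^sub>R m"])
    show "norm (- (1 / norm m) *\<^sub>R m) = 1" using m0 by simp
    show "(- (1 / norm m) *\<^sub>R m) \<bullet> (g \<phi> v - g \<phi> u) = 0" using m[OF uv] k(2)[OF uv(2)] by simp
    show "(- (1 / norm m) *\<^sub>R m) \<bullet> (z - g \<phi> u) \<le> 0" if "z \<in> region S g" for z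
      using ge[OF that] by simp
  qed
qed

end

context slit_surface
begin

text \<open>The quasigeodesic bound \<open>side\<close> for any set of faces on one side at v, by
  positivity of the face angles.\<close>

lemma fan_sum_le:
  assumes S: "S \<subseteq> faces" and \<phi>: "\<phi> \<in> faces" "v \<in> poly_vertices P" "v \<in> fst \<phi>" and X: "X \<subseteq> fan faces \<phi> v"
  shows "(\<Sum>\<psi>\<in>X. face_angle (fst \<psi>) v) \<le> pi"
proof -
  have sub: "fan faces \<phi> v \<subseteq> {\<psi>. \<psi> \<in> faces \<and> v \<in> fst \<psi> \<and> (\<phi>, \<psi>) \<in> (adj U {v} faces)\<^sup>*}"
    using fan_subset[OF \<phi>(1,3)] unfolding fan_def by blast
  have "(\<Sum>\<psi>\<in>X. face_angle (fst \<psi>) v) \<le> (\<Sum>\<psi> | \<psi> \<in> faces \<and> v \<in> fst \<psi> \<and> (\<phi>, \<psi>) \<in> (adj U {v} faces)\<^sup>*. face_angle (fst \<psi>) v)"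
  proof (rule sum_mono2)
    show "finite {\<psi>. \<psi> \<in> faces \<and> v \<in> fst \<psi> \<and> (\<phi>, \<psi>) \<in> (adj U {v} faces)\<^sup>*}" using finite_faces by simp
    show "X \<subseteq> {\<psi>. \<psi> \<in> faces \<and> v \<in> fst \<psi> \<and> (\<phi>, \<psi>) \<in> (adj U {v} faces)\<^sup>*}" using X sub by blast
    show "0 \<le> face_angle (fst \<psi>) v" if "\<psi> \<in> {\<psi>. \<psi> \<in> faces \<and> v \<in> fst \<psi> \<and> (\<phi>, \<psi>) \<in> (adj U {v} faces)\<^sup>*} - X" for \<psi>
      using face_angle_pos[of \<psi> v] \<phi>(2) that by simp
  qed
  also have "\<dots> \<le> pi" using side[OF \<phi>] .
  finally show ?thesis .
qed

lemma fan_mono: "S \<subseteq> S' \<Longrightarrow> fan S \<phi> v \<subseteq> fan S' \<phi> v"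
proof
  fix \<psi> assume S: "S \<subseteq> S'" and "\<psi> \<in> fan S \<phi> v"
  then have "(\<phi>, \<psi>) \<in> (adj U {v} S)\<^sup>*" by (simp add: fan_def)
  from adj_rtrancl_mono[OF S order_refl order_refl this] show "\<psi> \<in> fan S' \<phi> v" by (simp add: fan_def)
qed

text \<open>In coordinates with first axis a along the free edge and d the outer normal, the other free edge of the fan points in the
  direction of angle - \<theta>; the new supporting line is turned outwards by \<eta>.\<close>
lemma corner_support:
  assumes dev: "developed S g" and \<phi>: "\<phi> \<in> S" "v \<in> poly_vertices P" "v \<in> fst \<phi>" and w: "free_edge S \<phi> v w"
    and a: "norm a = 1" "g \<phi> w - g \<phi> v = L *\<^sub>R a" "L > 0"
    and d: "norm d = 1" "a \<bullet> d = 0" "\<And>z. z \<in> region S g \<Longrightarrow> d \<bullet> (z - g \<phi> v) \<le> 0"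
    and \<eta>: "0 < \<eta>" "(\<Sum>\<psi>\<in>fan S \<phi> v. face_angle (fst \<psi>) v) + \<eta> \<le> pi" and z: "z \<in> region S g"
  shows "(cos \<eta> *\<^sub>R d - sin \<eta> *\<^sub>R a) \<bullet> (z - g \<phi> v) \<le> 0"
proof -
  define \<theta> where "\<theta> = (\<Sum>\<psi>\<in>fan S \<phi> v. face_angle (fst \<psi>) v)"
  obtain \<phi>2 w2 where c: "\<phi>2 \<in> fan S \<phi> v" "free_edge S \<phi>2 v w2"
    "ang (g \<phi> w - g \<phi> v) (g \<phi>2 w2 - g \<phi> v) = \<theta>"
    unfolding \<theta>_def by (rule corner_other[OF dev \<phi> w]) blast
  have \<phi>2: "\<phi>2 \<in> S" "v \<in> fst \<phi>2" using fan_subset[OF \<phi>(1,3) c(1)] by auto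
  have gv: "g \<phi>2 v = g \<phi> v" using fan_image[OF dev \<phi>(1) c(1)] .
  define b where "b = g \<phi>2 w2 - g \<phi> v"
  have th: "0 < \<theta>" "\<theta> < pi" using fan_sum_pos[OF \<phi>(1) developedD(1)[OF dev] \<phi>(2,3)] \<eta> unfolding \<theta>_def by auto
  have sth: "sin \<theta> > 0" using th by (rule sin_gt_zero)
  have angb: "ang a b = \<theta>" using c(3) unfolding a(2) b_def[symmetric] using ang_scale_left[OF a(3)] by metis
  obtain m where m: "norm m = 1" "m \<bullet> (g \<phi>2 w2 - g \<phi>2 v) = 0" "\<And>z. z \<in> region S g \<Longrightarrow> m \<bullet> (z - g \<phi>2 v) \<le> 0"
    by (rule free_support[OF dev \<phi>2(1) c(2)]) blast
  have w2: "w2 \<in> fst \<phi>2" "w2 \<noteq> v" and wf: "w \<in> fst \<phi>" using c(2) w poly_edges_segment_ne[of v w2 P] unfolding free_edge_def by auto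
  have "g \<phi>2 w2 \<in> region S g" unfolding region_def using \<phi>2 w2 by blast
  then have bd: "b \<bullet> d \<le> 0" using d(3) unfolding b_def by (simp add: inner_commute)
  have "g \<phi> w \<in> region S g" unfolding region_def using \<phi> wf by blast
  then have "m \<bullet> (L *\<^sub>R a) \<le> 0" using m(3) gv a(2) by metis
  then have ma: "m \<bullet> a \<le> 0" using a(3) by (simp add: mult_le_0_iff)
  have b0: "b \<noteq> 0" using chart_inj[OF developedD(2)[OF dev \<phi>2(1)] w2(1) \<phi>2(2)] w2(2) gv unfolding b_def by auto
  have "b = (norm b * cos (ang a b)) *\<^sub>R a + (norm b * sin (ang a b)) *\<^sub>R (- d)"
    using polar_real2[of a "- d" b] a d bd by auto
  then have be: "b = norm b *\<^sub>R (cos \<theta> *\<^sub>R a - sin \<theta> *\<^sub>R d)" unfolding angb by (simp add: algebra_simps)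
  define x where "x = m \<bullet> a"
  define y where "y = m \<bullet> d"
  \<comment> \<open>As a unit vector orthogonal to b, the second supporting normal m is one of two
    vectors; \<open>m \<bullet> a \<le> 0\<close> decides which.\<close>
  have me: "m = x *\<^sub>R a + y *\<^sub>R d" unfolding x_def y_def using decomp_real2 a(1) d(1,2) by blast
  have aa: "a \<bullet> a = 1" "d \<bullet> d = 1" "d \<bullet> a = 0" using a d by (auto simp: norm_eq_1 inner_commute)
  have "m \<bullet> b = 0" using m(2) unfolding gv b_def .
  moreover have "m \<bullet> b = norm b * (m \<bullet> (cos \<theta> *\<^sub>R a - sin \<theta> *\<^sub>R d))"
    using arg_cong[OF be, of "\<lambda>z. m \<bullet> z"] by simp
  ultimately have "m \<bullet> (cos \<theta> *\<^sub>R a - sin \<theta> *\<^sub>R d) = 0" using b0 by simp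
  then have xy: "x * cos \<theta> = y * sin \<theta>" unfolding x_def y_def by (simp add: inner_diff_right mult.commute)
  have "m \<bullet> m = 1" using m(1) by (simp add: norm_eq_1)
  then have "x * x + y * y = 1" unfolding me using aa d(2) by (simp add: inner_add_left inner_add_right)
  then have "(x * x + y * y) * (sin \<theta> * sin \<theta>) = sin \<theta> * sin \<theta>" by simp
  then have "x * x * (sin \<theta> * sin \<theta>) + (y * sin \<theta>) * (y * sin \<theta>) = sin \<theta> * sin \<theta>" by (simp add: algebra_simps)
  then have "x * x * (sin \<theta> * sin \<theta>) + (x * cos \<theta>) * (x * cos \<theta>) = sin \<theta> * sin \<theta>" unfolding xy .
  moreover have "x * x * (sin \<theta> * sin \<theta>) + (x * cos \<theta>) * (x * cos \<theta>) = x * x * ((sin \<theta>)\<^sup>2 + (cos \<theta>)\<^sup>2)"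
    by (simp only: power2_eq_square) (simp only: algebra_simps)
  ultimately have "x * x = sin \<theta> * sin \<theta>" by (simp only: sin_cos_squared_add mult_1_right)
  then have "x = - sin \<theta>" using ma sth unfolding x_def square_eq_iff by linarith
  moreover have "y = - cos \<theta>"
  proof -
    have "(y + cos \<theta>) * sin \<theta> = 0" using xy \<open>x = - sin \<theta>\<close> by (simp add: algebra_simps)
    then show ?thesis using sth by simp
  qed
  ultimately have m': "m = - (sin \<theta> *\<^sub>R a) - cos \<theta> *\<^sub>R d" using me by simp
  \<comment> \<open>The turned normal is, up to the factor \<open>sin \<theta>\<close>, a
    combination of the supporting normals m and d. Its coefficients are nonnegative because
    \<open>\<theta> + \<eta>\<close> is at most pi.\<close>
  have key: "sin \<theta> *\<^sub>R (cos \<eta> *\<^sub>R d - sin \<eta> *\<^sub>R a) = sin \<eta> *\<^sub>R m + sin (\<theta> + \<eta>) *\<^sub>R d"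
    unfolding m' sin_add by (simp add: algebra_simps)
  have "0 \<le> sin \<eta>" "0 \<le> sin (\<theta> + \<eta>)" using \<eta> th unfolding \<theta>_def[symmetric] by (auto intro!: sin_ge_zero)
  moreover have "m \<bullet> (z - g \<phi> v) \<le> 0" "d \<bullet> (z - g \<phi> v) \<le> 0" using m(3)[OF z] d(3)[OF z] gv by auto
  ultimately have "(sin \<eta> *\<^sub>R m + sin (\<theta> + \<eta>) *\<^sub>R d) \<bullet> (z - g \<phi> v) \<le> 0"
    by (simp add: inner_add_left add_nonpos_nonpos mult_nonneg_nonpos)
  then have "sin \<theta> * ((cos \<eta> *\<^sub>R d - sin \<eta> *\<^sub>R a) \<bullet> (z - g \<phi> v)) \<le> 0" unfolding key[symmetric] by simp
  then show ?thesis using sth by (simp add: mult_le_0_iff)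
qed

text \<open>The start of the induction: every edge is still free, and each fan consists of the face
  alone.\<close>

lemma developed_single:
  assumes \<phi>: "\<phi> \<in> faces" and h: "chart (fst \<phi>) (g \<phi>)"
  shows "developed {\<phi>} g"
proof -
  have fan: "fan {\<phi>} \<phi> v = {\<phi>}" for v
  proof -
    have "adj U {v} {\<phi>} = {}" unfolding adj_def by auto
    then show ?thesis unfolding fan_def by auto
  qed
  have cor: "corner {\<phi>} g \<phi> v" if v: "v \<in> poly_vertices P" "v \<in> fst \<phi>" for v
  proof -
    obtain x y where xy: "x \<noteq> y" "x \<noteq> v" "y \<noteq> v" "closed_segment v x face_of fst \<phi>" "closed_segment v y face_of fst \<phi>"
      "\<And>w. w \<noteq> v \<Longrightarrow> closed_segment v w face_of fst \<phi> \<Longrightarrow> w = x \<or> w = y"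
      by (rule polygon_corner[OF faceD(1)[OF \<phi>] face(2)[OF \<phi>] vertex_of_face[OF \<phi> v]]) blast
    have fe: "free_edge {\<phi>} \<phi> v w" if "w \<noteq> v" "closed_segment v w face_of fst \<phi>" for w
      unfolding free_edge_def using poly_edge_face[OF face(1)[OF \<phi>] that(2) aff_dim_segment] that face_of_imp_subset[OF that(2)] by auto
    have in\<phi>: "x \<in> fst \<phi>" "y \<in> fst \<phi>" using face_of_imp_subset[OF xy(4)] face_of_imp_subset[OF xy(5)] by auto
    have "ang (g \<phi> x - g \<phi> v) (g \<phi> y - g \<phi> v) = face_angle (fst \<phi>) v"
      using chart_ang[OF h v(2) in\<phi>] face_angle_eq[OF faceD(1)[OF \<phi>] face(2)[OF \<phi>] xy(1-5)] by simp
    moreover have "w = x \<or> w = y" if "free_edge {\<phi>} \<phi> v w" for w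
      using xy(6)[of w] that edge_of_face[OF \<phi>] poly_edges_segment_ne[of v w P] unfolding free_edge_def by blast
    ultimately show ?thesis unfolding corner_def fan
      by (intro exI[of _ \<phi>] exI[of _ x] exI[of _ \<phi>] exI[of _ y]) (use fe xy in auto)
  qed
  have cv: "convex (region {\<phi>} g)" unfolding region_def using chart_convex[OF h faceD(2)[OF \<phi>]] by simp
  show ?thesis unfolding developed_def
    using \<phi> h cv cor chart_inj[OF h] by auto
qed

end

section \<open>Attaching one face along an edge\<close>

text \<open>The vector d is the outer normal of the development of S along the edge from u to v of the face \<phi>; the chart h puts the new face f
  on the other side of that edge.\<close>
locale attachment = slit_surface +
  fixes S :: "sface set" and g :: "sface \<Rightarrow> real^3 \<Rightarrow> real^2" and \<phi> f :: sface and u v :: "real^3"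
    and d :: "real^2" and h :: "real^3 \<Rightarrow> real^2"
  assumes dev: "developed S g" and \<phi>S: "\<phi> \<in> S" and f: "f \<in> faces" "f \<notin> S"
    and eU: "closed_segment u v \<in> U" and e\<phi>: "closed_segment u v \<subseteq> fst \<phi>" and ef: "closed_segment u v \<subseteq> fst f"
    and d: "norm d = 1" "d \<bullet> (g \<phi> v - g \<phi> u) = 0" "\<And>z. z \<in> region S g \<Longrightarrow> d \<bullet> (z - g \<phi> u) \<le> 0"
    and h: "chart (fst f) h" "h u = g \<phi> u" "h v = g \<phi> v"
    "\<And>y. y \<in> fst f \<Longrightarrow> 0 \<le> d \<bullet> (h y - g \<phi> u)"
    "\<And>y. y \<in> fst f \<Longrightarrow> d \<bullet> (h y - g \<phi> u) = 0 \<longleftrightarrow> y \<in> closed_segment u v"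
begin

text \<open>The situation is symmetric in the two ends of the edge, so that whatever is shown at u
  can be used at v by interpreting the locale again.\<close>

lemma swapped: "attachment P U e0 S g \<phi> f v u d h"
proof
  have e: "d \<bullet> (z - g \<phi> v) = d \<bullet> (z - g \<phi> u)" for z
    using d(2) by (simp add: inner_diff_right)
  show "d \<bullet> (g \<phi> u - g \<phi> v) = 0" using d(2) by (simp add: inner_diff_right)
  show "d \<bullet> (z - g \<phi> v) \<le> 0" if "z \<in> region S g" for z using d(3)[OF that] e by simp
  show "0 \<le> d \<bullet> (h y - g \<phi> v)" if "y \<in> fst f" for y using h(4)[OF that] e by simp
  show "d \<bullet> (h y - g \<phi> v) = 0 \<longleftrightarrow> y \<in> closed_segment v u" if "y \<in> fst f" for y
    using h(5)[OF that] e by (simp add: closed_segment_commute)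
qed (use dev \<phi>S f eU e\<phi> ef d h in \<open>auto simp: closed_segment_commute\<close>)

lemma basics:
  "closed_segment u v \<in> poly_edges P" "u \<noteq> v" "\<phi> \<in> faces" "u \<in> fst \<phi>" "v \<in> fst \<phi>" "u \<in> fst f" "v \<in> fst f"
  "u \<in> poly_vertices P" "v \<in> poly_vertices P" "\<phi> \<noteq> f" "chart (fst \<phi>) (g \<phi>)" "S \<subseteq> faces"
  "closed_segment u v face_of fst f"
proof -
  show e: "closed_segment u v \<in> poly_edges P" using eU U by auto
  show "u \<noteq> v" using poly_edges_segment_ne[OF e] .
  show "S \<subseteq> faces" using developedD(1)[OF dev] .
  then show "\<phi> \<in> faces" using \<phi>S by auto
  show "u \<in> fst \<phi>" "v \<in> fst \<phi>" "u \<in> fst f" "v \<in> fst f" using e\<phi> ef by auto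
  have "closed_segment u v face_of P" using e by (auto simp: poly_edges_def)
  then show "u \<in> poly_vertices P" "v \<in> poly_vertices P" using segment_face_extreme unfolding poly_vertices_def by auto
  show "\<phi> \<noteq> f" using \<phi>S f by auto
  show "chart (fst \<phi>) (g \<phi>)" using developedD(2)[OF dev \<phi>S] .
  show "closed_segment u v face_of fst f" using edge_of_face[OF f(1) e ef] .
qed

lemma only_faces: "\<psi> \<in> faces \<Longrightarrow> closed_segment u v \<subseteq> fst \<psi> \<Longrightarrow> \<psi> = \<phi> \<or> \<psi> = f"
  using third_face[OF basics(1,3) f(1) _ basics(10) e\<phi> ef] by blast

text \<open>By acyclicity f meets the developed part along one uncut edge only. Along a second one
  the chart h, which is fixed by the first, could disagree with g.\<close>

lemma only_link:
  assumes "e' \<in> U" "\<psi> \<in> S" "e' \<subseteq> fst \<psi>" "e' \<subseteq> fst f"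
  shows "e' = closed_segment u v" "\<psi> = \<phi>"
proof -
  show e: "e' = closed_segment u v"
    by (rule unique_link[OF basics(12) developedD(3)[OF dev assms(2) \<phi>S] f assms(2) \<phi>S assms(1) eU assms(3) e\<phi> assms(4) ef])
  show "\<psi> = \<phi>" using only_faces[of \<psi>] assms(2,3) e basics(12) f by blast
qed

lemma free_uv: "free_edge S \<phi> u v"
  unfolding free_edge_def using basics only_faces e\<phi> f(2) by blast

lemma h_on_edge: "x \<in> closed_segment u v \<Longrightarrow> h x = g \<phi> x"
proof -
  assume "x \<in> closed_segment u v"
  then obtain t where t: "0 \<le> t" "t \<le> 1" "x = (1 - t) *\<^sub>R u + t *\<^sub>R v" unfolding closed_segment_def by blast
  show ?thesis unfolding t(3)
    using chart_affine[OF h(1) faceD(2)[OF f(1)] basics(6,7) t(1,2)]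
      chart_affine[OF basics(11) faceD(2)[OF basics(3)] basics(4,5) t(1,2)] h(2,3) by simp
qed

text \<open>The glued edge is not on the circuit, so crossing it does not change sides at u: f and
  the fan of \<phi> share the same bound pi.\<close>

lemma angle_sum_le: "(\<Sum>\<psi>\<in>fan S \<phi> u. face_angle (fst \<psi>) u) + face_angle (fst f) u \<le> pi"
proof -
  have fin: "finite (fan S \<phi> u)" using finite_fan \<phi>S basics by blast
  have nf: "f \<notin> fan S \<phi> u" using fan_subset[OF \<phi>S basics(4)] f(2) by blast
  have "(\<phi>, f) \<in> adj U {u} faces" unfolding adj_def using basics f eU e\<phi> ef by auto
  then have "f \<in> fan faces \<phi> u" unfolding fan_def by auto
  then have "insert f (fan S \<phi> u) \<subseteq> fan faces \<phi> u" using fan_mono[OF basics(12)] by blast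
  from fan_sum_le[OF order_refl basics(3,8,4) this] show ?thesis using fin nf by (simp add: add.commute)
qed

text \<open>The supporting line is the one through the other edge of f at u, whose normal n is d
  turned by the angle \<eta> of f. It supports f, which lies in the cone of its two edges, and it
  supports the old region by \<open>corner_support\<close>, whose condition on \<eta> is
  \<open>angle_sum_le\<close>.\<close>

lemma end_support: "\<exists>n. n \<bullet> (g \<phi> v - g \<phi> u) < 0 \<and> (\<forall>z \<in> region S g \<union> h ` fst f. n \<bullet> (z - g \<phi> u) \<le> 0)"
proof -
  define L where "L = norm (g \<phi> v - g \<phi> u)"
  have "g \<phi> v \<noteq> g \<phi> u" using chart_inj[OF basics(11,5,4)] basics(2) by auto
  then have L: "L > 0" unfolding L_def by simp
  define a where "a = (1 / L) *\<^sub>R (g \<phi> v - g \<phi> u)"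
  have a: "norm a = 1" "g \<phi> v - g \<phi> u = L *\<^sub>R a" "a \<bullet> d = 0" unfolding a_def using L L_def d(2) by (auto simp: inner_commute)
  define \<eta> where "\<eta> = face_angle (fst f) u"
  have \<eta>: "0 < \<eta>" "\<eta> < pi" unfolding \<eta>_def using face_angle_pos face_angle_less f(1) basics by auto
  define n where "n = cos \<eta> *\<^sub>R d - sin \<eta> *\<^sub>R a"
  have aa: "a \<bullet> a = 1" "d \<bullet> d = 1" "d \<bullet> a = 0" using a d by (auto simp: norm_eq_1 inner_commute)
  have na: "n \<bullet> a = - sin \<eta>" unfolding n_def using aa by (simp add: inner_diff_left)
  have s\<eta>: "0 < sin \<eta>" using \<eta> by (rule sin_gt_zero)
  have 1: "n \<bullet> (z - g \<phi> u) \<le> 0" if "z \<in> region S g" for z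
    unfolding n_def
    by (rule corner_support[OF dev \<phi>S basics(8,4) free_uv a(1,2) L d(1) a(3) d(3) \<eta>(1) _ that])
      (use angle_sum_le \<eta>_def in auto)
  have 2: "n \<bullet> (h y - g \<phi> u) \<le> 0" if y: "y \<in> fst f" for y
  proof -
    obtain c where c: "c \<noteq> v" "c \<noteq> u" "closed_segment u c face_of fst f"
      "\<And>p. p \<in> fst f \<Longrightarrow> \<exists>s t. 0 \<le> s \<and> 0 \<le> t \<and> p - u = s *\<^sub>R (v - u) + t *\<^sub>R (c - u)"
      "face_angle (fst f) u = ang (v - u) (c - u)"
      by (rule polygon_edge_corner[OF faceD(1)[OF f(1)] face(2)[OF f(1)] basics(13,2)]) blast
    have cf: "c \<in> fst f" using face_of_imp_subset[OF c(3)] by auto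
    obtain s t where st: "0 \<le> s" "0 \<le> t" "y - u = s *\<^sub>R (v - u) + t *\<^sub>R (c - u)" using c(4)[OF y] by blast
    have he: "h y - g \<phi> u = s *\<^sub>R (L *\<^sub>R a) + t *\<^sub>R (h c - g \<phi> u)"
      using chart_comb[OF h(1) basics(6,7) cf y st(3)] h(2,3) a(2) by simp
    have "ang (L *\<^sub>R a) (h c - g \<phi> u) = \<eta>"
      using chart_ang[OF h(1) basics(6,7) cf] h(2,3) a(2) c(5) unfolding \<eta>_def by simp
    then have an: "ang a (h c - g \<phi> u) = \<eta>" using ang_scale_left[OF L] by metis
    have "h c - g \<phi> u = norm (h c - g \<phi> u) *\<^sub>R (cos \<eta> *\<^sub>R a + sin \<eta> *\<^sub>R d)"
      using polar_real2[OF a(1) d(1) a(3), of "h c - g \<phi> u"] h(4)[OF cf] an by (simp add: inner_commute algebra_simps)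
    then have "n \<bullet> (h c - g \<phi> u) = norm (h c - g \<phi> u) * (n \<bullet> (cos \<eta> *\<^sub>R a + sin \<eta> *\<^sub>R d))" by (metis inner_scaleR_right)
    also have "n \<bullet> (cos \<eta> *\<^sub>R a + sin \<eta> *\<^sub>R d) = 0" unfolding n_def using aa a(3) by (simp add: inner_diff_left inner_add_right)
    finally have "n \<bullet> (h y - g \<phi> u) = s * (L * (n \<bullet> a))" unfolding he by (simp add: inner_add_right)
    then show ?thesis unfolding na using st(1) L s\<eta> by (simp add: mult_nonneg_nonneg)
  qed
  show ?thesis using 1 2 na s\<eta> L a(2) by (intro exI[of _ n]) auto
qed

lemma region_Un: "region (insert f S) (g(f := h)) = region S g \<union> h ` fst f"
proof -
  have "(g(f := h)) \<psi> = g \<psi>" if "\<psi> \<in> S" for \<psi> using that f(2) by auto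
  then have "(\<Union>\<psi>\<in>S. (g(f := h)) \<psi> ` fst \<psi>) = region S g" unfolding region_def by (intro SUP_cong) auto
  then show ?thesis unfolding region_def by auto
qed

text \<open>The supporting lines at both ends of the glued edge, the second one obtained by
  symmetry, force any segment from the old region to the new face to pass through that edge.\<close>

lemma convex_attached: "convex (region (insert f S) (g(f := h)))"
proof -
  interpret sw: attachment P U e0 S g \<phi> f v u d h by (rule swapped)
  obtain np where np: "np \<bullet> (g \<phi> v - g \<phi> u) < 0" "\<And>z. z \<in> region S g \<union> h ` fst f \<Longrightarrow> np \<bullet> (z - g \<phi> u) \<le> 0"
    using end_support by blast
  obtain nq where nq: "nq \<bullet> (g \<phi> u - g \<phi> v) < 0" "\<And>z. z \<in> region S g \<union> h ` fst f \<Longrightarrow> nq \<bullet> (z - g \<phi> v) \<le> 0"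
    using sw.end_support by blast
  have seg: "closed_segment (g \<phi> u) (g \<phi> v) = g \<phi> ` closed_segment u v"
    using chart_segment[OF basics(11) faceD(2)[OF basics(3)] basics(4,5)] by simp
  show ?thesis unfolding region_Un
  proof (rule convex_Un_across_segment[OF developedD(6)[OF dev] chart_convex[OF h(1) faceD(2)[OF f(1)]] _ d(1,2) _ _ d(3) _ np nq])
    show "g \<phi> u \<noteq> g \<phi> v" using np by auto
    show "closed_segment (g \<phi> u) (g \<phi> v) \<subseteq> region S g" unfolding seg region_def using e\<phi> \<phi>S by blast
    have "g \<phi> ` closed_segment u v = h ` closed_segment u v" using h_on_edge by auto
    then show "closed_segment (g \<phi> u) (g \<phi> v) \<subseteq> h ` fst f" unfolding seg using ef by blast
    show "0 \<le> d \<bullet> (z - g \<phi> u)" if "z \<in> h ` fst f" for z using that h(4) by auto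
  qed
qed

lemma adj_insert: "(\<psi>, \<omega>) \<in> adj U {x} (insert f S) \<longleftrightarrow> (\<psi>, \<omega>) \<in> adj U {x} S \<or>
    x \<in> closed_segment u v \<and> ((\<psi>, \<omega>) = (\<phi>, f) \<or> (\<psi>, \<omega>) = (f, \<phi>))"
proof
  assume "(\<psi>, \<omega>) \<in> adj U {x} (insert f S)"
  then obtain e where e: "e \<in> U" "x \<in> e" "e \<subseteq> fst \<psi>" "e \<subseteq> fst \<omega>" "\<psi> \<noteq> \<omega>" "\<psi> = f \<or> \<psi> \<in> S" "\<omega> = f \<or> \<omega> \<in> S"
    unfolding adj_def by auto
  then consider "\<psi> \<in> S" "\<omega> \<in> S" | "\<psi> = f" "\<omega> \<in> S" | "\<psi> \<in> S" "\<omega> = f" by blast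
  then show "(\<psi>, \<omega>) \<in> adj U {x} S \<or> x \<in> closed_segment u v \<and> ((\<psi>, \<omega>) = (\<phi>, f) \<or> (\<psi>, \<omega>) = (f, \<phi>))"
  proof cases
    case 1 then show ?thesis unfolding adj_def using e by blast
  next
    case 2 then show ?thesis using only_link[of e \<omega>] e by auto
  next
    case 3 then show ?thesis using only_link[of e \<psi>] e by auto
  qed
next
  assume "(\<psi>, \<omega>) \<in> adj U {x} S \<or> x \<in> closed_segment u v \<and> ((\<psi>, \<omega>) = (\<phi>, f) \<or> (\<psi>, \<omega>) = (f, \<phi>))"
  then show "(\<psi>, \<omega>) \<in> adj U {x} (insert f S)"
    unfolding adj_def using eU e\<phi> ef \<phi>S basics(10) by auto
qed

lemma adj_link: "x \<in> closed_segment u v \<Longrightarrow> (\<phi>, f) \<in> adj U {x} (insert f S)"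
  unfolding adj_insert by blast

lemma adj_S: "p \<in> (adj U X S)\<^sup>* \<Longrightarrow> p \<in> (adj U X (insert f S))\<^sup>*"
  by (rule adj_rtrancl_mono[of S _ U U X X]) auto

text \<open>The old region and the new face lie on different sides of the line of the glued edge,
  and the new face meets this line in the edge only. So a common image point comes from the edge,
  where h agrees with the chart of \<phi>, and the injectivity of the old development
  applies.\<close>

lemma injective_attached:
  assumes "\<psi> \<in> insert f S" "\<omega> \<in> insert f S" "x \<in> fst \<psi>" "y \<in> fst \<omega>" "(g(f := h)) \<psi> x = (g(f := h)) \<omega> y"
  shows "x = y \<and> (\<psi>, \<omega>) \<in> (adj U {x} (insert f S))\<^sup>*"
proof -
  have cross: "x = y \<and> (\<psi>, f) \<in> (adj U {x} (insert f S))\<^sup>*"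
    if "\<psi> \<in> S" "x \<in> fst \<psi>" "y \<in> fst f" "g \<psi> x = h y" for \<psi> x y
  proof -
    have "g \<psi> x \<in> region S g" unfolding region_def using that by blast
    then have "d \<bullet> (h y - g \<phi> u) = 0" using d(3)[of "h y"] h(4)[OF that(3)] that(4) by simp
    then have ye: "y \<in> closed_segment u v" using h(5)[OF that(3)] by simp
    then have eq: "g \<psi> x = g \<phi> y" using that(4) h_on_edge by simp
    have y\<phi>: "y \<in> fst \<phi>" using ye e\<phi> by blast
    have xy: "x = y" using developedD(7)[OF dev that(1) \<phi>S that(2) y\<phi> eq] .
    then have "(\<psi>, \<phi>) \<in> (adj U {x} S)\<^sup>*" using developedD(8)[OF dev that(1) \<phi>S that(2)] y\<phi> eq by simp
    then have "(\<psi>, \<phi>) \<in> (adj U {x} (insert f S))\<^sup>*" by (rule adj_S)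
    then show ?thesis using xy adj_link ye by (meson rtrancl.rtrancl_into_rtrancl)
  qed
  consider "\<psi> = f" "\<omega> = f" | "\<psi> = f" "\<omega> \<in> S" "\<omega> \<noteq> f" | "\<psi> \<in> S" "\<psi> \<noteq> f" "\<omega> = f" | "\<psi> \<in> S" "\<psi> \<noteq> f" "\<omega> \<in> S" "\<omega> \<noteq> f"
    using assms(1,2) f(2) by blast
  then show ?thesis
  proof cases
    case 1
    then show ?thesis using chart_inj[OF h(1)] assms by simp
  next
    case 2
    then have "g \<omega> y = h x" using assms(5) by simp
    then have "y = x \<and> (\<omega>, f) \<in> (adj U {y} (insert f S))\<^sup>*" using 2 assms by (intro cross) auto
    then have yx: "y = x" and m: "(\<omega>, f) \<in> (adj U {y} (insert f S))\<^sup>*" by blast+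
    show ?thesis using adj_rtrancl_sym[OF m] 2(1) unfolding yx by simp
  next
    case 3
    then have "x = y \<and> (\<psi>, f) \<in> (adj U {x} (insert f S))\<^sup>*" using assms by (intro cross) auto
    then show ?thesis unfolding 3(3) .
  next
    case 4
    then have eq: "g \<psi> x = g \<omega> y" using assms(5) by simp
    have "x = y" using developedD(7)[OF dev 4(1,3) assms(3,4) eq] .
    moreover have "(\<psi>, \<omega>) \<in> (adj U {x} S)\<^sup>*" using developedD(8)[OF dev 4(1,3) assms(3)] assms(4) eq \<open>x = y\<close> by simp
    ultimately show ?thesis using adj_S by blast
  qed
qed

lemma glue_attached:
  assumes "e \<in> U" "\<psi> \<in> insert f S" "\<omega> \<in> insert f S" "\<psi> \<noteq> \<omega>" "e \<subseteq> fst \<psi>" "e \<subseteq> fst \<omega>"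
  shows "(\<forall>x\<in>e. (g(f := h)) \<psi> x = (g(f := h)) \<omega> x) \<and>
    interior ((g(f := h)) \<psi> ` fst \<psi>) \<inter> interior ((g(f := h)) \<omega> ` fst \<omega>) = {}"
proof -
  have d0: "d \<noteq> 0" using d(1) by auto
  have "g \<phi> ` fst \<phi> \<subseteq> region S g" unfolding region_def using \<phi>S by blast
  then have "g \<phi> ` fst \<phi> \<subseteq> {z. d \<bullet> z \<le> d \<bullet> g \<phi> u}" using d(3) by (force simp: inner_diff_right)
  then have i1: "interior (g \<phi> ` fst \<phi>) \<subseteq> {z. d \<bullet> z < d \<bullet> g \<phi> u}"
    using interior_mono interior_halfspace_le[OF d0] by metis
  have "h ` fst f \<subseteq> {z. d \<bullet> z \<ge> d \<bullet> g \<phi> u}" using h(4) by (force simp: inner_diff_right)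
  then have i2: "interior (h ` fst f) \<subseteq> {z. d \<bullet> z > d \<bullet> g \<phi> u}"
    using interior_mono interior_halfspace_ge[OF d0] by metis
  have int: "interior (g \<phi> ` fst \<phi>) \<inter> interior (h ` fst f) = {}"
    using i1 i2 by force
  consider "\<psi> = f" "\<omega> \<in> S" "\<omega> \<noteq> f" | "\<psi> \<in> S" "\<psi> \<noteq> f" "\<omega> = f" | "\<psi> \<in> S" "\<psi> \<noteq> f" "\<omega> \<in> S" "\<omega> \<noteq> f"
    using assms(2,3,4) f(2) by blast
  then show ?thesis
  proof cases
    case 1
    then have "e = closed_segment u v" "\<omega> = \<phi>" using only_link[of e \<omega>] assms by auto
    then show ?thesis using 1 h_on_edge int by auto
  next
    case 2
    then have "e = closed_segment u v" "\<psi> = \<phi>" using only_link[of e \<psi>] assms by auto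
    then show ?thesis using 2 h_on_edge int by auto
  next
    case 3
    then show ?thesis using developedD(4,5)[OF dev assms(1) 3(1,3) assms(4,5,6)] by simp
  qed
qed

lemma free_insert_S: "\<psi> \<in> S \<Longrightarrow> free_edge (insert f S) \<psi> x w \<longleftrightarrow>
    free_edge S \<psi> x w \<and> \<not> (\<psi> = \<phi> \<and> closed_segment x w = closed_segment u v)"
proof -
  assume \<psi>: "\<psi> \<in> S"
  have "closed_segment x w \<in> U \<and> f \<noteq> \<psi> \<and> closed_segment x w \<subseteq> fst f \<and> closed_segment x w \<subseteq> fst \<psi> \<longleftrightarrow>
      \<psi> = \<phi> \<and> closed_segment x w = closed_segment u v"
  proof
    assume a: "closed_segment x w \<in> U \<and> f \<noteq> \<psi> \<and> closed_segment x w \<subseteq> fst f \<and> closed_segment x w \<subseteq> fst \<psi>"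
    then show "\<psi> = \<phi> \<and> closed_segment x w = closed_segment u v" using only_link[of "closed_segment x w" \<psi>] \<psi> by blast
  next
    assume "\<psi> = \<phi> \<and> closed_segment x w = closed_segment u v"
    then have sw: "\<psi> = \<phi>" "closed_segment x w = closed_segment u v" by blast+
    show "closed_segment x w \<in> U \<and> f \<noteq> \<psi> \<and> closed_segment x w \<subseteq> fst f \<and> closed_segment x w \<subseteq> fst \<psi>"
      unfolding sw using eU basics(10) ef e\<phi> by auto
  qed
  then show ?thesis unfolding free_edge_def by blast
qed

lemma free_insert_f: "free_edge (insert f S) f x w \<longleftrightarrow>
    closed_segment x w \<in> poly_edges P \<and> closed_segment x w \<subseteq> fst f \<and> closed_segment x w \<noteq> closed_segment u v"
proof -
  have "closed_segment x w \<in> U \<and> (\<exists>\<psi>\<in>S. closed_segment x w \<subseteq> fst \<psi>) \<longleftrightarrow> closed_segment x w = closed_segment u v"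
    if "closed_segment x w \<subseteq> fst f"
  proof
    assume "closed_segment x w \<in> U \<and> (\<exists>\<psi>\<in>S. closed_segment x w \<subseteq> fst \<psi>)"
    then obtain \<psi> where "closed_segment x w \<in> U" "\<psi> \<in> S" "closed_segment x w \<subseteq> fst \<psi>" by blast
    from only_link(1)[OF this that] show "closed_segment x w = closed_segment u v" .
  next
    assume sw: "closed_segment x w = closed_segment u v"
    show "closed_segment x w \<in> U \<and> (\<exists>\<psi>\<in>S. closed_segment x w \<subseteq> fst \<psi>)" unfolding sw using eU e\<phi> \<phi>S by auto
  qed
  moreover have "(\<exists>\<psi>\<in>insert f S. \<psi> \<noteq> f \<and> closed_segment x w \<subseteq> fst \<psi>) \<longleftrightarrow> (\<exists>\<psi>\<in>S. closed_segment x w \<subseteq> fst \<psi>)"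
    using f(2) by auto
  ultimately show ?thesis unfolding free_edge_def by argo
qed

lemma fan_off_edge:
  assumes "x \<notin> closed_segment u v"
  shows "fan (insert f S) \<psi> x = fan S \<psi> x"
proof -
  have "adj U {x} (insert f S) = adj U {x} S" using adj_insert[of _ _ x] assms by (auto simp: set_eq_iff)
  then show ?thesis unfolding fan_def by simp
qed

text \<open>Even if x is an end of the glued edge it may occur at further corners of the
  development; a corner whose fan does not contain \<phi> stays as it was.\<close>

lemma fan_other:
  assumes \<psi>: "\<psi> \<in> S" "\<psi> \<notin> fan S \<phi> x"
  shows "fan (insert f S) \<psi> x = fan S \<psi> x"
proof
  show "fan S \<psi> x \<subseteq> fan (insert f S) \<psi> x" by (rule fan_mono) auto
  show "fan (insert f S) \<psi> x \<subseteq> fan S \<psi> x"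
  proof
    fix \<omega> assume "\<omega> \<in> fan (insert f S) \<psi> x"
    then have "(\<psi>, \<omega>) \<in> (adj U {x} (insert f S))\<^sup>*" by (simp add: fan_def)
    then have "\<omega> \<in> fan S \<psi> x \<and> \<omega> \<in> S"
    proof (induction rule: rtrancl_induct)
      case base
      then show ?case using fan_self \<psi>(1) by blast
    next
      case (step y z)
      have "\<phi> \<notin> fan S \<psi> x" using fan_eq[of \<phi> S \<psi> x] fan_self[of \<psi> S x] \<psi>(2) by auto
      then have "y \<noteq> \<phi>" "y \<noteq> f" using step.IH f(2) by auto
      then have yz: "(y, z) \<in> adj U {x} S" using step.hyps(2) unfolding adj_insert by auto
      have "(\<psi>, y) \<in> (adj U {x} S)\<^sup>*" using step.IH by (simp add: fan_def)
      then have "(\<psi>, z) \<in> (adj U {x} S)\<^sup>*" using yz by (rule rtrancl.rtrancl_into_rtrancl)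
      moreover have "z \<in> S" using yz unfolding adj_def by auto
      ultimately show ?case by (simp add: fan_def)
    qed
    then show "\<omega> \<in> fan S \<psi> x" by simp
  qed
qed

lemma fan_at_edge: "x \<in> closed_segment u v \<Longrightarrow> fan (insert f S) \<phi> x = insert f (fan S \<phi> x)"
proof
  assume x: "x \<in> closed_segment u v"
  have "fan S \<phi> x \<subseteq> fan (insert f S) \<phi> x" by (rule fan_mono) auto
  moreover have "f \<in> fan (insert f S) \<phi> x" using adj_link[OF x] by (auto simp: fan_def)
  ultimately show "insert f (fan S \<phi> x) \<subseteq> fan (insert f S) \<phi> x" by blast
  show "fan (insert f S) \<phi> x \<subseteq> insert f (fan S \<phi> x)"
  proof
    fix \<omega> assume "\<omega> \<in> fan (insert f S) \<phi> x"
    then have "(\<phi>, \<omega>) \<in> (adj U {x} (insert f S))\<^sup>*" by (simp add: fan_def)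
    then show "\<omega> \<in> insert f (fan S \<phi> x)"
    proof (induction rule: rtrancl_induct)
      case base then show ?case using fan_self by blast
    next
      case (step y z)
      consider "(y, z) \<in> adj U {x} S" | "z = f" | "z = \<phi>" using step.hyps(2) unfolding adj_insert by auto
      then show ?case
      proof cases
        case 1
        then have "y \<noteq> f" using f(2) unfolding adj_def by auto
        then have "(\<phi>, y) \<in> (adj U {x} S)\<^sup>*" using step.IH by (simp add: fan_def)
        then have "(\<phi>, z) \<in> (adj U {x} S)\<^sup>*" using 1 by (rule rtrancl.rtrancl_into_rtrancl)
        then show ?thesis by (simp add: fan_def)
      qed (use fan_self in auto)
    qed
  qed
qed

lemma corner_unchanged:
  assumes \<psi>: "\<psi> \<in> S" "x \<in> poly_vertices P" "x \<in> fst \<psi>"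
    and fan: "fan (insert f S) \<psi> x = fan S \<psi> x"
    and no: "x \<notin> closed_segment u v \<or> \<phi> \<notin> fan S \<psi> x"
  shows "corner (insert f S) (g(f := h)) \<psi> x"
proof -
  obtain \<phi>1 w1 \<phi>2 w2 where c: "\<phi>1 \<in> fan S \<psi> x" "\<phi>2 \<in> fan S \<psi> x" "free_edge S \<phi>1 x w1" "free_edge S \<phi>2 x w2"
     "ang (g \<phi>1 w1 - g \<psi> x) (g \<phi>2 w2 - g \<psi> x) = (\<Sum>\<omega>\<in>fan S \<psi> x. face_angle (fst \<omega>) x)"
     "\<And>\<omega> w. \<omega> \<in> fan S \<psi> x \<Longrightarrow> free_edge S \<omega> x w \<Longrightarrow> (\<omega>, w) = (\<phi>1, w1) \<or> (\<omega>, w) = (\<phi>2, w2)"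
    using developedD(9)[OF dev \<psi>] unfolding corner_def by blast
  have inS: "\<omega> \<in> S" if "\<omega> \<in> fan S \<psi> x" for \<omega> using fan_subset(1)[OF \<psi>(1,3) that] .
  have gS: "(g(f := h)) \<omega> = g \<omega>" if "\<omega> \<in> S" for \<omega> using that f(2) by auto
  have fr: "free_edge (insert f S) \<omega> x w \<longleftrightarrow> free_edge S \<omega> x w" if "\<omega> \<in> fan S \<psi> x" for \<omega> w
  proof -
    have "\<not> (\<omega> = \<phi> \<and> closed_segment x w = closed_segment u v)"
    proof
      assume a: "\<omega> = \<phi> \<and> closed_segment x w = closed_segment u v"
      then have "x \<in> closed_segment u v" using ends_in_segment(1)[of x w] by blast
      then show False using no that a by blast
    qed
    then show ?thesis using free_insert_S[OF inS[OF that]] by blast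
  qed
  show ?thesis unfolding corner_def fan
    using c inS[OF c(1)] inS[OF c(2)] \<psi>(1) gS fr
    by (intro exI[of _ \<phi>1] exI[of _ w1] exI[of _ \<phi>2] exI[of _ w2]) simp
qed

lemma corner_new:
  assumes x: "x \<in> poly_vertices P" "x \<in> fst f" "x \<notin> closed_segment u v"
  shows "corner (insert f S) (g(f := h)) f x"
proof -
  have fan: "fan (insert f S) f x = {f}"
  proof -
    have "\<psi> = f" if "(f, \<psi>) \<in> (adj U {x} S)\<^sup>*" for \<psi>
      using that by (induction rule: rtrancl_induct) (use f(2) in \<open>auto simp: adj_def\<close>)
    then have "fan S f x = {f}" by (auto simp: fan_def)
    then show ?thesis using fan_off_edge[OF x(3)] by simp
  qed
  obtain p q where pq: "p \<noteq> q" "p \<noteq> x" "q \<noteq> x" "closed_segment x p face_of fst f" "closed_segment x q face_of fst f"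
    "\<And>w. w \<noteq> x \<Longrightarrow> closed_segment x w face_of fst f \<Longrightarrow> w = p \<or> w = q"
    by (rule polygon_corner[OF faceD(1)[OF f(1)] face(2)[OF f(1)] vertex_of_face[OF f(1) x(1,2)]]) blast
  have ne: "closed_segment x w \<noteq> closed_segment u v" for w using x(3) ends_in_segment(1)[of x w] by blast
  have fe: "free_edge (insert f S) f x w" if "w \<noteq> x" "closed_segment x w face_of fst f" for w
    unfolding free_insert_f using poly_edge_face[OF face(1)[OF f(1)] that(2) aff_dim_segment] that face_of_imp_subset[OF that(2)] ne by auto
  have inf: "p \<in> fst f" "q \<in> fst f" using face_of_imp_subset[OF pq(4)] face_of_imp_subset[OF pq(5)] by auto
  have "ang (h p - h x) (h q - h x) = face_angle (fst f) x"
    using chart_ang[OF h(1) x(2) inf] face_angle_eq[OF faceD(1)[OF f(1)] face(2)[OF f(1)] pq(1-5)] by simp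
  moreover have "w = p \<or> w = q" if "free_edge (insert f S) f x w" for w
    using pq(6)[of w] that edge_of_face[OF f(1)] poly_edges_segment_ne[of x w P] unfolding free_edge_def by blast
  ultimately show ?thesis unfolding corner_def fan
    by (intro exI[of _ f] exI[of _ p] exI[of _ f] exI[of _ q]) (use fe pq in auto)
qed

text \<open>The fan at u gains f, and the free edge towards v is replaced by the other edge of f at
  u. The remaining old free edge and the new one lie on different sides of the line of the glued
  edge, and their angles with it add up to at most pi, so \<open>ang_add_opposite_sides\<close>
  gives the new angle as a sum.\<close>

lemma corner_extended:
  assumes \<psi>: "\<psi> \<in> insert f (fan S \<phi> u)"
  shows "corner (insert f S) (g(f := h)) \<psi> u"
proof -
  have ue: "u \<in> closed_segment u v" by simp
  have fan\<phi>: "fan (insert f S) \<phi> u = insert f (fan S \<phi> u)" using fan_at_edge[OF ue] .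
  then have fan: "fan (insert f S) \<psi> u = insert f (fan S \<phi> u)" using fan_eq \<psi> by metis
  have nf: "f \<notin> fan S \<phi> u" using fan_subset[OF \<phi>S basics(4)] f(2) by blast
  have gu: "(g(f := h)) \<psi> u = g \<phi> u"
    using \<psi> h(2) fan_image[OF dev \<phi>S] nf by (cases "\<psi> = f") auto
  obtain \<phi>2 w2 where c: "\<phi>2 \<in> fan S \<phi> u" "free_edge S \<phi>2 u w2" "(\<phi>2, w2) \<noteq> (\<phi>, v)"
    "ang (g \<phi> v - g \<phi> u) (g \<phi>2 w2 - g \<phi> u) = (\<Sum>\<psi>\<in>fan S \<phi> u. face_angle (fst \<psi>) u)"
    "\<And>\<psi> w'. \<psi> \<in> fan S \<phi> u \<Longrightarrow> free_edge S \<psi> u w' \<Longrightarrow> (\<psi>, w') = (\<phi>, v) \<or> (\<psi>, w') = (\<phi>2, w2)"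
    by (rule corner_other[OF dev \<phi>S basics(8,4) free_uv]) blast
  have \<phi>2: "\<phi>2 \<in> S" "u \<in> fst \<phi>2" using fan_subset[OF \<phi>S basics(4) c(1)] by auto
  have w2: "w2 \<in> fst \<phi>2" "w2 \<noteq> u" using c(2) poly_edges_segment_ne[of u w2 P] unfolding free_edge_def by auto
  have gu2: "g \<phi>2 u = g \<phi> u" using fan_image[OF dev \<phi>S c(1)] .
  obtain q where q: "q \<noteq> v" "q \<noteq> u" "closed_segment u q face_of fst f"
    "\<And>w. w \<noteq> u \<Longrightarrow> closed_segment u w face_of fst f \<Longrightarrow> w = v \<or> w = q"
    "face_angle (fst f) u = ang (v - u) (q - u)"
    by (rule polygon_edge_corner[OF faceD(1)[OF f(1)] face(2)[OF f(1)] basics(13,2)]) blast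
  have qf: "q \<in> fst f" using face_of_imp_subset[OF q(3)] by auto
  define L where "L = norm (g \<phi> v - g \<phi> u)"
  have "g \<phi> v \<noteq> g \<phi> u" using chart_inj[OF basics(11,5,4)] basics(2) by auto
  then have L: "L > 0" unfolding L_def by simp
  define a where "a = (1 / L) *\<^sub>R (g \<phi> v - g \<phi> u)"
  have a: "norm a = 1" "a \<bullet> d = 0" unfolding a_def using L L_def d(2) by (auto simp: inner_commute)
  have a_ang: "ang a z = ang (g \<phi> v - g \<phi> u) z" for z unfolding a_def using L by (intro ang_scale_left) simp
  have angq: "ang a (h q - g \<phi> u) = face_angle (fst f) u"
    unfolding a_ang q(5) using chart_ang[OF h(1) basics(6,7) qf] h(2,3) by simp
  have "ang (g \<phi>2 w2 - g \<phi> u) (h q - g \<phi> u) = ang a (g \<phi>2 w2 - g \<phi> u) + ang a (h q - g \<phi> u)"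
  proof (rule ang_add_opposite_sides[OF a(1) d(1) a(2)])
    show "0 \<le> (h q - g \<phi> u) \<bullet> d" using h(4)[OF qf] by (simp add: inner_commute)
    have "g \<phi>2 w2 \<in> region S g" unfolding region_def using \<phi>2 w2 by blast
    then show "(g \<phi>2 w2 - g \<phi> u) \<bullet> d \<le> 0" using d(3) by (simp add: inner_commute)
    show "g \<phi>2 w2 - g \<phi> u \<noteq> 0" using chart_inj[OF developedD(2)[OF dev \<phi>2(1)] w2(1) \<phi>2(2)] w2(2) gu2 by auto
    show "h q - g \<phi> u \<noteq> 0" using chart_inj[OF h(1) qf basics(6)] q(2) h(2) by auto
    show "ang a (g \<phi>2 w2 - g \<phi> u) + ang a (h q - g \<phi> u) \<le> pi"
      unfolding angq unfolding a_ang c(4) by (rule angle_sum_le)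
  qed
  also have "\<dots> = (\<Sum>\<omega>\<in>insert f (fan S \<phi> u). face_angle (fst \<omega>) u)"
    unfolding angq unfolding a_ang c(4) using nf finite_fan[OF \<phi>S basics(12,4)] by (simp add: add.commute)
  finally have angle: "ang (g \<phi>2 w2 - g \<phi> u) (h q - g \<phi> u) = (\<Sum>\<omega>\<in>insert f (fan S \<phi> u). face_angle (fst \<omega>) u)" .
  have segne: "closed_segment u w \<noteq> closed_segment u v" if "w \<noteq> v" for w
    using that by (auto simp: closed_segment_eq doubleton_eq_iff)
  have f1: "free_edge (insert f S) \<phi>2 u w2"
    unfolding free_insert_S[OF \<phi>2(1)] using c(2,3) segne[of w2] by blast
  have f2: "free_edge (insert f S) f u q"
    unfolding free_insert_f using poly_edge_face[OF face(1)[OF f(1)] q(3) aff_dim_segment] q(2) face_of_imp_subset[OF q(3)] segne[OF q(1)] by auto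
  have all: "(\<omega>, w) = (\<phi>2, w2) \<or> (\<omega>, w) = (f, q)" if \<omega>: "\<omega> \<in> insert f (fan S \<phi> u)" "free_edge (insert f S) \<omega> u w" for \<omega> w
  proof (cases "\<omega> = f")
    case True
    then have e: "closed_segment u w \<in> poly_edges P" "closed_segment u w \<subseteq> fst f" "closed_segment u w \<noteq> closed_segment u v"
      using \<omega>(2) unfolding True free_insert_f by auto
    have "w = v \<or> w = q" using q(4)[of w] poly_edges_segment_ne[OF e(1)] edge_of_face[OF f(1) e(1,2)] by blast
    then show ?thesis using e(3) True by blast
  next
    case False
    then have "\<omega> \<in> fan S \<phi> u" using \<omega>(1) by blast
    then have "free_edge S \<omega> u w" "\<not> (\<omega> = \<phi> \<and> closed_segment u w = closed_segment u v)"
      using \<omega>(2) free_insert_S[OF fan_subset(1)[OF \<phi>S basics(4)]] by blast+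
    then show ?thesis using c(5)[OF \<open>\<omega> \<in> fan S \<phi> u\<close>] by blast
  qed
  have g2: "(g(f := h)) \<phi>2 w2 = g \<phi>2 w2" "(g(f := h)) f q = h q" using \<phi>2(1) f(2) by auto
  show ?thesis unfolding corner_def fan gu
  proof (rule exI[of _ \<phi>2], rule exI[of _ w2], rule exI[of _ f], rule exI[of _ q], intro conjI ballI allI impI)
    show "\<phi>2 \<in> insert f (fan S \<phi> u)" using c(1) by blast
    show "f \<in> insert f (fan S \<phi> u)" by blast
    show "ang ((g(f := h)) \<phi>2 w2 - g \<phi> u) ((g(f := h)) f q - g \<phi> u) = (\<Sum>\<psi>\<in>insert f (fan S \<phi> u). face_angle (fst \<psi>) u)"
      unfolding g2 by (rule angle)
  qed (fact f1 f2 | rule all, assumption+)+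
qed

theorem developed_attached: "developed (insert f S) (g(f := h))"
proof -
  have sub: "insert f S \<subseteq> faces" using basics f by auto
  have ch: "chart (fst \<psi>) ((g(f := h)) \<psi>)" if "\<psi> \<in> insert f S" for \<psi>
    using that h(1) developedD(2)[OF dev, of \<psi>] by (cases "\<psi> = f") auto
  have con: "(\<psi>, \<omega>) \<in> (adj U {} (insert f S))\<^sup>*" if "\<psi> \<in> insert f S" "\<omega> \<in> insert f S" for \<psi> \<omega>
  proof -
    have l: "(\<phi>, f) \<in> (adj U {} (insert f S))\<^sup>*"
      using adj_link[of u] adj_mono[of "insert f S" "insert f S" U U "{}" "{u}"] by auto
    have *: "(\<phi>, \<psi>) \<in> (adj U {} (insert f S))\<^sup>*" if "\<psi> \<in> insert f S" for \<psi>
      using that l adj_S[OF developedD(3)[OF dev \<phi>S]] by blast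
    show ?thesis using adj_rtrancl_sym[OF *[OF that(1)]] *[OF that(2)] by (rule rtrancl_trans)
  qed
  have cor: "corner (insert f S) (g(f := h)) \<psi> x" if \<psi>: "\<psi> \<in> insert f S" and x: "x \<in> poly_vertices P" "x \<in> fst \<psi>" for \<psi> x
  proof (cases "x \<in> closed_segment u v")
    case False
    then show ?thesis using corner_new[OF x(1)] corner_unchanged[of \<psi> x] fan_off_edge[OF False] \<psi> x by auto
  next
    case True
    have "closed_segment u v face_of P" using basics(1) by (auto simp: poly_edges_def)
    then have "x = u \<or> x = v" using extreme_in_segment_face[OF _ _ True] x(1) by (auto simp: poly_vertices_def)
    interpret sw: attachment P U e0 S g \<phi> f v u d h by (rule swapped)
    consider "\<psi> \<in> insert f (fan S \<phi> x)" | "\<psi> \<in> S" "\<psi> \<notin> fan S \<phi> x" using \<psi> by blast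
    then show ?thesis
    proof cases
      case 1
      then show ?thesis using corner_extended sw.corner_extended \<open>x = u \<or> x = v\<close> by blast
    next
      case 2
      have "\<phi> \<notin> fan S \<psi> x" using fan_eq[of \<phi> S \<psi> x] fan_self[of \<psi> S x] 2(2) by auto
      then show ?thesis using corner_unchanged[OF 2(1) x fan_other[OF 2]] by blast
    qed
  qed
  show ?thesis unfolding developed_def
  proof (intro conjI)
    show "\<forall>\<psi>\<in>insert f S. chart (fst \<psi>) ((g(f := h)) \<psi>)" using ch by blast
    show "\<forall>\<psi>\<in>insert f S. \<forall>\<omega>\<in>insert f S. (\<psi>, \<omega>) \<in> (adj U {} (insert f S))\<^sup>*" using con by blast
    show "\<forall>e\<in>U. \<forall>\<psi>\<in>insert f S. \<forall>\<omega>\<in>insert f S. \<psi> \<noteq> \<omega> \<longrightarrow> e \<subseteq> fst \<psi> \<longrightarrow> e \<subseteq> fst \<omega> \<longrightarrow>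
        (\<forall>x\<in>e. (g(f := h)) \<psi> x = (g(f := h)) \<omega> x) \<and> interior ((g(f := h)) \<psi> ` fst \<psi>) \<inter> interior ((g(f := h)) \<omega> ` fst \<omega>) = {}"
      by (intro ballI impI glue_attached)
    show "\<forall>\<psi>\<in>insert f S. \<forall>\<omega>\<in>insert f S. \<forall>x\<in>fst \<psi>. \<forall>y\<in>fst \<omega>. (g(f := h)) \<psi> x = (g(f := h)) \<omega> y \<longrightarrow>
        x = y \<and> (\<psi>, \<omega>) \<in> (adj U {x} (insert f S))\<^sup>*"
      by (intro ballI impI injective_attached)
    show "\<forall>\<psi>\<in>insert f S. \<forall>v\<in>poly_vertices P. v \<in> fst \<psi> \<longrightarrow> corner (insert f S) (g(f := h)) \<psi> v" using cor by blast
  qed (fact sub convex_attached)+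
qed

end

section \<open>Gluing the two sides\<close>

context slit_surface
begin

lemma extend_development:
  assumes dev: "developed S g" and \<phi>: "\<phi> \<in> S" and f: "f \<in> faces" "f \<notin> S" and e: "e \<in> U" "e \<subseteq> fst \<phi>" "e \<subseteq> fst f"
  obtains h where "developed (insert f S) (g(f := h))"
proof -
  have eE: "e \<in> poly_edges P" using e U by auto
  obtain u v where uv: "u \<noteq> v" "e = closed_segment u v" by (rule edge_segment[OF eE]) blast
  have S: "S \<subseteq> faces" using developedD(1)[OF dev] .
  have "\<psi> = \<phi>" if "\<psi> \<in> S" "e \<subseteq> fst \<psi>" for \<psi>
    using third_face[OF eE _ f(1) _ _ e(2,3) that(2)] that \<phi> S f(2) by blast
  then have fr: "free_edge S \<phi> u v" unfolding free_edge_def using eE e uv by blast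
  obtain d where d: "norm d = 1" "d \<bullet> (g \<phi> v - g \<phi> u) = 0" "\<And>z. z \<in> region S g \<Longrightarrow> d \<bullet> (z - g \<phi> u) \<le> 0"
    by (rule free_support[OF dev \<phi> fr]) blast
  have "u \<in> fst \<phi>" "v \<in> fst \<phi>" using e uv by auto
  then have "dist (g \<phi> u) (g \<phi> v) = dist u v" using chart_dist[OF developedD(2)[OF dev \<phi>]] by blast
  then obtain h where h: "chart (fst f) h" "h u = g \<phi> u" "h v = g \<phi> v"
    "\<And>y. y \<in> fst f \<Longrightarrow> 0 \<le> d \<bullet> (h y - g \<phi> u)" "\<And>y. y \<in> fst f \<Longrightarrow> d \<bullet> (h y - g \<phi> u) = 0 \<longleftrightarrow> y \<in> closed_segment u v"
    by (rule chart_exists[OF faceD(1)[OF f(1)] face(2)[OF f(1)] edge_of_face[OF f(1) eE e(3), unfolded uv(2)] uv(1) _ d(1,2)]) blast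
  interpret attachment P U e0 S g \<phi> f u v d h
    by unfold_locales (use dev \<phi> f e d h uv in auto)
  show ?thesis using that developed_attached .
qed

text \<open>The number of missing faces decreases. The chart of the initial face is kept, because
  the second half of the surface has to start from a prescribed position.\<close>

lemma maximal_development:
  assumes "developed S0 g0" "\<phi>0 \<in> S0"
  obtains S g where "developed S g" "\<phi>0 \<in> S" "g \<phi>0 = g0 \<phi>0"
    "\<And>\<phi> f e. \<phi> \<in> S \<Longrightarrow> f \<in> faces \<Longrightarrow> e \<in> U \<Longrightarrow> e \<subseteq> fst \<phi> \<Longrightarrow> e \<subseteq> fst f \<Longrightarrow> f \<in> S"
proof -
  have "\<exists>S g. developed S g \<and> \<phi>0 \<in> S \<and> g \<phi>0 = g0 \<phi>0 \<and>
    (\<forall>\<phi>\<in>S. \<forall>f\<in>faces. \<forall>e\<in>U. e \<subseteq> fst \<phi> \<longrightarrow> e \<subseteq> fst f \<longrightarrow> f \<in> S)" using assms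
  proof (induction "card (faces - S0)" arbitrary: S0 g0 rule: less_induct)
    case less
    show ?case
    proof (cases "\<forall>\<phi>\<in>S0. \<forall>f\<in>faces. \<forall>e\<in>U. e \<subseteq> fst \<phi> \<longrightarrow> e \<subseteq> fst f \<longrightarrow> f \<in> S0")
      case True
      then show ?thesis using less.prems by blast
    next
      case False
      then obtain \<phi> f e where e: "\<phi> \<in> S0" "f \<in> faces" "f \<notin> S0" "e \<in> U" "e \<subseteq> fst \<phi>" "e \<subseteq> fst f" by blast
      obtain h where h: "developed (insert f S0) (g0(f := h))"
        by (rule extend_development[OF less.prems(1) e(1,2,3,4,5,6)])
      have "faces - insert f S0 \<subset> faces - S0" using e by blast
      then have "card (faces - insert f S0) < card (faces - S0)" using finite_faces by (intro psubset_card_mono) auto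
      moreover have "\<phi>0 \<in> insert f S0" "(g0(f := h)) \<phi>0 = g0 \<phi>0" using less.prems(2) e(3) by auto
      ultimately show ?thesis using less.hyps[of "insert f S0" "g0(f := h)"] h by metis
    qed
  qed
  then show ?thesis using that by metis
qed

text \<open>With an angle below pi at u, \<open>corner_support\<close> may be applied with all the
  slack \<open>pi - \<theta>\<close>, which turns the line onto the second free edge. Since that
  edge is not the continuation of the first, no point of the region lies on the line beyond
  u.\<close>

lemma end_bound:
  assumes dev: "developed S g" and \<phi>: "\<phi> \<in> S" "u \<in> poly_vertices P" "u \<in> fst \<phi>" and w: "free_edge S \<phi> u v"
    and d: "norm d = 1" "d \<bullet> (g \<phi> v - g \<phi> u) = 0" "\<And>z. z \<in> region S g \<Longrightarrow> d \<bullet> (z - g \<phi> u) \<le> 0"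
    and z: "z \<in> region S g" "d \<bullet> (z - g \<phi> u) = 0"
    and less: "(\<Sum>\<psi>\<in>fan S \<phi> u. face_angle (fst \<psi>) u) < pi"
  shows "0 \<le> (z - g \<phi> u) \<bullet> (g \<phi> v - g \<phi> u)"
proof -
  define L where "L = norm (g \<phi> v - g \<phi> u)"
  have "u \<noteq> v" "v \<in> fst \<phi>" using w poly_edges_segment_ne[of u v P] unfolding free_edge_def by auto
  then have "g \<phi> v \<noteq> g \<phi> u" using chart_inj[OF developedD(2)[OF dev \<phi>(1)] _ \<phi>(3)] by auto
  then have L: "L > 0" unfolding L_def by simp
  define a where "a = (1 / L) *\<^sub>R (g \<phi> v - g \<phi> u)"
  have a: "norm a = 1" "g \<phi> v - g \<phi> u = L *\<^sub>R a" "a \<bullet> d = 0" unfolding a_def using L L_def d(2) by (auto simp: inner_commute)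
  define \<theta> where "\<theta> = (\<Sum>\<psi>\<in>fan S \<phi> u. face_angle (fst \<psi>) u)"
  have th: "0 < \<theta>" using fan_sum_pos[OF \<phi>(1) developedD(1)[OF dev] \<phi>(2,3)] unfolding \<theta>_def .
  have "(cos (pi - \<theta>) *\<^sub>R d - sin (pi - \<theta>) *\<^sub>R a) \<bullet> (z - g \<phi> u) \<le> 0"
    by (rule corner_support[OF dev \<phi> w a(1,2) L d(1) a(3) d(3) _ _ z(1)]) (use less in \<open>auto simp: \<theta>_def\<close>)
  then have "0 \<le> sin \<theta> * (a \<bullet> (z - g \<phi> u))" using z(2) by (simp add: inner_diff_left)
  moreover have "0 < sin \<theta>" using th less unfolding \<theta>_def by (intro sin_gt_zero) auto
  ultimately have "0 \<le> a \<bullet> (z - g \<phi> u)" by (simp add: zero_le_mult_iff)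
  then show ?thesis unfolding a(2) using L by (simp add: inner_commute)
qed

lemma on_line_between:
  fixes p q d z :: "real^2"
  assumes "p \<noteq> q" "norm d = 1" "d \<bullet> (q - p) = 0" "d \<bullet> (z - p) = 0"
    "0 \<le> (z - p) \<bullet> (q - p)" "0 \<le> (z - q) \<bullet> (p - q)"
  shows "z \<in> closed_segment p q"
proof -
  define L where "L = norm (q - p)"
  have L: "L > 0" unfolding L_def using assms(1) by simp
  define a where "a = (1 / L) *\<^sub>R (q - p)"
  have a: "norm a = 1" "q - p = L *\<^sub>R a" "a \<bullet> d = 0" unfolding a_def using L L_def assms(3) by (auto simp: inner_commute)
  define s where "s = (z - p) \<bullet> a"
  have zp: "z - p = s *\<^sub>R a" using decomp_real2[OF a(1) assms(2) a(3), of "z - p"] assms(4) unfolding s_def by (simp add: inner_commute)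
  have aa: "a \<bullet> a = 1" using a(1) by (simp add: norm_eq_1)
  have "0 \<le> s * L" using assms(5) unfolding zp a(2) using aa by (simp add: mult.commute)
  then have s0: "0 \<le> s" using L by (simp add: zero_le_mult_iff)
  have e: "z - q = (s - L) *\<^sub>R a" "p - q = - L *\<^sub>R a"
    using zp a(2) by (auto simp: algebra_simps)
  have "0 \<le> (L - s) * L" using assms(6) unfolding e using aa by (simp add: algebra_simps)
  then have sL: "s \<le> L" using L by (simp add: zero_le_mult_iff)
  have "z = p + (s / L) *\<^sub>R (q - p)" using zp a(2) L by (simp add: algebra_simps)
  then have "z = (1 - s / L) *\<^sub>R p + (s / L) *\<^sub>R q" by (simp add: algebra_simps)
  then show ?thesis unfolding closed_segment_def using s0 sL L by (intro CollectI exI[of _ "s / L"]) auto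
qed

lemma uncut_adj_eq: "poly_edges P - T = insert e0 U \<Longrightarrow> uncut_adj P T X = adj (insert e0 U) X faces"
  unfolding uncut_adj_def adj_def by simp

text \<open>The two halves of the surface develop to convex polygons on opposite sides of the line through the image of e0. As the
  angles at an end of e0 do not sum up to 2 pi, one of them is less than pi there, so that the polygons meet in that segment only.\<close>
theorem net_exists:
  assumes T: "poly_edges P - T = insert e0 U" "spanning_tree P T"
    and conn: "\<And>\<phi> \<psi>. \<phi> \<in> faces \<Longrightarrow> \<psi> \<in> faces \<Longrightarrow> (\<phi>, \<psi>) \<in> (adj (insert e0 U) {} faces)\<^sup>*"
    and total: "\<And>v. v \<in> poly_vertices P \<Longrightarrow> (\<Sum>\<phi> | \<phi> \<in> faces \<and> v \<in> fst \<phi>. face_angle (fst \<phi>) v) < 2 * pi"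
  obtains g where "edge_unfolding P T g" "is_net P T g"
proof -
  have e0E: "e0 \<in> poly_edges P" using U by simp
  obtain u v where uv: "u \<noteq> v" "e0 = closed_segment u v" "u \<in> poly_vertices P" "v \<in> poly_vertices P"
    by (rule edge_segment[OF e0E])
  obtain \<phi>0 \<psi>0 where fp: "\<phi>0 \<noteq> \<psi>0" "{\<omega> \<in> faces. e0 \<subseteq> fst \<omega>} = {\<phi>0, \<psi>0}" using two_faces[OF e0E] by blast
  have f0: "\<phi>0 \<in> faces" "e0 \<subseteq> fst \<phi>0" "\<psi>0 \<in> faces" "e0 \<subseteq> fst \<psi>0" using fp(2) by blast+
  have uvf: "u \<in> fst \<phi>0" "v \<in> fst \<phi>0" "u \<in> fst \<psi>0" "v \<in> fst \<psi>0" using f0 uv by auto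
  have ef: "closed_segment u v face_of fst \<phi>0" "closed_segment u v face_of fst \<psi>0"
    using edge_of_face[OF f0(1) e0E f0(2)] edge_of_face[OF f0(3) e0E f0(4)] uv by auto
  \<comment> \<open>An arbitrary first position: e0 on the first coordinate axis, starting at the
    origin, with the face above it.\<close>
  obtain h0 where h0: "chart (fst \<phi>0) h0"
  proof (rule chart_exists[OF faceD(1)[OF f0(1)] face(2)[OF f0(1)] ef(1) uv(1), of 0 "dist u v *\<^sub>R axis 1 1" "axis 2 1"])
    show "dist 0 (dist u v *\<^sub>R axis 1 1 :: real^2) = dist u v" by (simp add: norm_axis_1)
    show "norm (axis 2 1 :: real^2) = 1" by (simp add: norm_axis_1)
    show "axis 2 1 \<bullet> (dist u v *\<^sub>R axis 1 1 - 0 :: real^2) = 0" by (simp add: inner_axis_axis)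
  qed
  obtain A g where A: "developed A g" "\<phi>0 \<in> A"
    "\<And>\<phi> f e. \<phi> \<in> A \<Longrightarrow> f \<in> faces \<Longrightarrow> e \<in> U \<Longrightarrow> e \<subseteq> fst \<phi> \<Longrightarrow> e \<subseteq> fst f \<Longrightarrow> f \<in> A"
    by (rule maximal_development[OF developed_single[OF f0(1), of "\<lambda>_. h0", OF h0], of \<phi>0]) auto
  define p where "p = g \<phi>0 u"
  define q where "q = g \<phi>0 v"
  have frA: "free_edge A \<phi>0 u v" unfolding free_edge_def using e0E f0 U(2) uv by auto
  obtain d where d: "norm d = 1" "d \<bullet> (q - p) = 0" "\<And>z. z \<in> region A g \<Longrightarrow> d \<bullet> (z - p) \<le> 0"
    unfolding p_def q_def by (rule free_support[OF A(1,2) frA]) blast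
  have chA: "chart (fst \<phi>0) (g \<phi>0)" using developedD(2)[OF A(1,2)] .
  have pq: "dist p q = dist u v" unfolding p_def q_def using chart_dist[OF chA] uvf by blast
  obtain h1 where h1: "chart (fst \<psi>0) h1" "h1 u = p" "h1 v = q"
    "\<And>y. y \<in> fst \<psi>0 \<Longrightarrow> 0 \<le> d \<bullet> (h1 y - p)" "\<And>y. y \<in> fst \<psi>0 \<Longrightarrow> d \<bullet> (h1 y - p) = 0 \<longleftrightarrow> y \<in> closed_segment u v"
    by (rule chart_exists[OF faceD(1)[OF f0(3)] face(2)[OF f0(3)] ef(2) uv(1) pq d(1,2)]) blast
  obtain B k where B: "developed B k" "\<psi>0 \<in> B" "k \<psi>0 = h1"
    "\<And>\<phi> f e. \<phi> \<in> B \<Longrightarrow> f \<in> faces \<Longrightarrow> e \<in> U \<Longrightarrow> e \<subseteq> fst \<phi> \<Longrightarrow> e \<subseteq> fst f \<Longrightarrow> f \<in> B"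
    by (rule maximal_development[OF developed_single[OF f0(3), of "\<lambda>_. h1", OF h1(1)], of \<psi>0]) auto
  have kp: "k \<psi>0 u = p" "k \<psi>0 v = q" using B(3) h1 by auto
  have frB: "free_edge B \<psi>0 u v" unfolding free_edge_def using e0E f0 U(2) uv by auto
  have pqne: "p \<noteq> q" using pq uv(1) by auto
  \<comment> \<open>As e0 is free in B, the region of B has a supporting line through p and q. Its
    normal is d or its negative, and the image of a vertex of \<open>\<psi>0\<close> off e0 decides
    the sign.\<close>
  have dB: "0 \<le> d \<bullet> (z - p)" if z: "z \<in> region B k" for z
  proof -
    obtain d' where d': "norm d' = 1" "d' \<bullet> (q - p) = 0" "\<And>z. z \<in> region B k \<Longrightarrow> d' \<bullet> (z - p) \<le> 0"
      by (rule free_support[OF B(1,2) frB]) (use kp in auto)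
    define a where "a = (1 / norm (q - p)) *\<^sub>R (q - p)"
    have a: "norm a = 1" "a \<bullet> d = 0" "d' \<bullet> a = 0" unfolding a_def using pqne d(2) d'(2) by (auto simp: inner_commute)
    have de: "d' = (d' \<bullet> d) *\<^sub>R d" using decomp_real2[OF a(1) d(1) a(2), of d'] a(3) by simp
    obtain c where c: "closed_segment u c face_of fst \<psi>0" "c \<notin> closed_segment u v"
      by (rule polygon_edge_corner[OF faceD(1)[OF f0(3)] face(2)[OF f0(3)] ef(2) uv(1)]) blast
    have cf: "c \<in> fst \<psi>0" using face_of_imp_subset[OF c(1)] by auto
    have dc: "d \<bullet> (h1 c - p) > 0" using h1(4,5)[OF cf] c(2) by (auto simp: order_less_le)
    have "h1 c \<in> region B k" unfolding region_def using B(2,3) cf by blast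
    then have "(d' \<bullet> d) * (d \<bullet> (h1 c - p)) \<le> 0" using d'(3) de by (metis inner_scaleR_left)
    then have "d' \<bullet> d \<le> 0" using dc by (simp add: mult_le_0_iff)
    moreover have "\<bar>d' \<bullet> d\<bar> = 1" using arg_cong[OF de, of norm] d(1) d'(1) by simp
    ultimately have "d' \<bullet> d = - 1" by linarith
    then have "d' = - d" using de by simp
    then show ?thesis using d'(3)[OF z] by simp
  qed
  \<comment> \<open>A common face would join the two faces at e0 through edges off the
    circuit.\<close>
  have AB: "\<omega> \<notin> B" if "\<omega> \<in> A" for \<omega>
  proof
    assume "\<omega> \<in> B"
    then have m1: "(\<psi>0, \<omega>) \<in> (adj U {} faces)\<^sup>*"
      using adj_rtrancl_mono[OF developedD(1)[OF B(1)] order_refl order_refl developedD(3)[OF B(1,2)]] by blast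
    have m2: "(\<phi>0, \<omega>) \<in> (adj U {} faces)\<^sup>*"
      using adj_rtrancl_mono[OF developedD(1)[OF A(1)] order_refl order_refl developedD(3)[OF A(1,2) that]] by blast
    have "(\<phi>0, \<psi>0) \<in> (adj U {} faces)\<^sup>*" by (rule rtrancl_trans[OF m2 adj_rtrancl_sym[OF m1]])
    then show False using sides_separate[OF f0(2,4,1,3) fp(1)] by blast
  qed
  \<comment> \<open>Both parts are closed under crossing edges off the circuit, and crossing e0 only
    leads to one of the two initial faces.\<close>
  have cover: "\<omega> \<in> A \<or> \<omega> \<in> B" if "\<omega> \<in> faces" for \<omega>
    using conn[OF f0(1) that]
  proof (induction rule: rtrancl_induct)
    case base then show ?case using A(2) by blast
  next
    case (step y z)
    then obtain e where e: "z \<in> faces" "e = e0 \<or> e \<in> U" "e \<subseteq> fst y" "e \<subseteq> fst z" unfolding adj_def by auto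
    show ?case
    proof (cases "e = e0")
      case True
      then have "z \<in> {\<phi>0, \<psi>0}" using fp(2) e by blast
      then show ?thesis using A(2) B(2) by blast
    next
      case False
      then have eU: "e \<in> U" using e(2) by simp
      from step.IH show ?thesis
      proof
        assume "y \<in> A" then show ?thesis using A(3)[OF _ e(1) eU e(3,4)] by simp
      next
        assume "y \<in> B" then show ?thesis using B(4)[OF _ e(1) eU e(3,4)] by simp
      qed
    qed
  qed
  have AF: "A \<subseteq> faces" and BF: "B \<subseteq> faces" using developedD(1) A(1) B(1) by auto
  have seg_agree: "g \<phi>0 x = k \<psi>0 x" if x: "x \<in> closed_segment u v" for x
  proof -
    obtain t where t: "0 \<le> t" "t \<le> 1" "x = (1 - t) *\<^sub>R u + t *\<^sub>R v" using x unfolding closed_segment_def by blast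
    show ?thesis unfolding t(3) B(3)
      using chart_affine[OF chA faceD(2)[OF f0(1)] uvf(1,2) t(1,2)]
        chart_affine[OF h1(1) faceD(2)[OF f0(3)] uvf(3,4) t(1,2)] h1(2,3) p_def q_def by simp
  qed
  \<comment> \<open>The two fans are disjoint, as they belong to different halves, and the total
    angle at x is less than 2 pi.\<close>
  have angle_split: "(\<Sum>\<psi>\<in>fan A \<phi>0 x. face_angle (fst \<psi>) x) < pi \<or> (\<Sum>\<psi>\<in>fan B \<psi>0 x. face_angle (fst \<psi>) x) < pi"
    if x: "x \<in> poly_vertices P" "x \<in> fst \<phi>0" "x \<in> fst \<psi>0" for x
  proof -
    have fA: "fan A \<phi>0 x \<subseteq> A" "\<forall>\<psi>\<in>fan A \<phi>0 x. x \<in> fst \<psi>" using fan_subset[OF A(2) x(2)] by auto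
    have fB: "fan B \<psi>0 x \<subseteq> B" "\<forall>\<psi>\<in>fan B \<psi>0 x. x \<in> fst \<psi>" using fan_subset[OF B(2) x(3)] by auto
    have fin: "finite (fan A \<phi>0 x)" "finite (fan B \<psi>0 x)"
      using finite_fan[OF A(2) AF x(2)] finite_fan[OF B(2) BF x(3)] by auto
    have "(\<Sum>\<psi>\<in>fan A \<phi>0 x. face_angle (fst \<psi>) x) + (\<Sum>\<psi>\<in>fan B \<psi>0 x. face_angle (fst \<psi>) x)
        = (\<Sum>\<psi>\<in>fan A \<phi>0 x \<union> fan B \<psi>0 x. face_angle (fst \<psi>) x)"
    proof -
      have "fan A \<phi>0 x \<inter> fan B \<psi>0 x = {}" using fA(1) fB(1) AB by blast
      from sum.union_disjoint[OF fin this, of "\<lambda>\<psi>. face_angle (fst \<psi>) x"] show ?thesis by (rule sym)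
    qed
    also have "\<dots> \<le> (\<Sum>\<phi> | \<phi> \<in> faces \<and> x \<in> fst \<phi>. face_angle (fst \<phi>) x)"
    proof (rule sum_mono2)
      show "fan A \<phi>0 x \<union> fan B \<psi>0 x \<subseteq> {\<phi> \<in> faces. x \<in> fst \<phi>}" using fA fB AF BF by blast
      show "0 \<le> face_angle (fst \<psi>) x" if "\<psi> \<in> {\<phi> \<in> faces. x \<in> fst \<phi>} - (fan A \<phi>0 x \<union> fan B \<psi>0 x)" for \<psi>
        using face_angle_pos[of \<psi> x] x(1) that by simp
    qed (use finite_faces in simp)
    also have "\<dots> < 2 * pi" using total[OF x(1)] .
    finally show ?thesis by linarith
  qed
  have meet: "x = y \<and> (\<psi>, \<omega>) \<in> (adj (insert e0 U) {x} faces)\<^sup>*"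
    if \<psi>: "\<psi> \<in> A" "x \<in> fst \<psi>" and \<omega>: "\<omega> \<in> B" "y \<in> fst \<omega>" and eq: "g \<psi> x = k \<omega> y" for \<psi> \<omega> x y
  proof -
    define z where "z = g \<psi> x"
    have zA: "z \<in> region A g" unfolding region_def z_def using \<psi> by blast
    have zB: "z \<in> region B k" unfolding region_def z_def eq using \<omega> by blast
    have zp: "d \<bullet> (z - p) = 0" using d(3)[OF zA] dB[OF zB] by simp
    have dq: "d \<bullet> (z - q) = d \<bullet> (z - p)" for z using d(2) by (simp add: inner_diff_right)
    have sw: "free_edge A \<phi>0 v u" "free_edge B \<psi>0 v u" using frA frB unfolding free_edge_def by (auto simp: closed_segment_commute)
    have md: "norm (- d) = 1" "(- d) \<bullet> (q - p) = 0" "(- d) \<bullet> (p - q) = 0" "d \<bullet> (p - q) = 0"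
      using d by (auto simp: inner_diff_right)
    \<comment> \<open>A common point z lies on the line through p and q and in both regions; so it
      is enough that one of them has an angle less than pi at u to exclude the points beyond
      p.\<close>
    have "0 \<le> (z - p) \<bullet> (q - p)" 
      using angle_split[OF uv(3) uvf(1,3)]
    proof
      assume "(\<Sum>\<psi>\<in>fan A \<phi>0 u. face_angle (fst \<psi>) u) < pi"
      from end_bound[OF A(1,2) uv(3) uvf(1) frA d(1) _ _ zA _ this] show ?thesis
        using d zp unfolding p_def q_def by blast
    next
      assume "(\<Sum>\<psi>\<in>fan B \<psi>0 u. face_angle (fst \<psi>) u) < pi"
      from end_bound[OF B(1,2) uv(3) uvf(3) frB md(1) _ _ zB _ this, unfolded kp] show ?thesis
        using md(2) dB zp by simp
    qed
    moreover have "0 \<le> (z - q) \<bullet> (p - q)" 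
      using angle_split[OF uv(4) uvf(2,4)]
    proof
      assume "(\<Sum>\<psi>\<in>fan A \<phi>0 v. face_angle (fst \<psi>) v) < pi"
      from end_bound[OF A(1,2) uv(4) uvf(2) sw(1) d(1) _ _ zA _ this, folded p_def q_def] show ?thesis
        using md(4) d(3) zp dq by simp
    next
      assume "(\<Sum>\<psi>\<in>fan B \<psi>0 v. face_angle (fst \<psi>) v) < pi"
      from end_bound[OF B(1,2) uv(4) uvf(4) sw(2) md(1) _ _ zB _ this, unfolded kp] show ?thesis
        using md(3) dB zp dq by simp
    qed
    ultimately have "z \<in> closed_segment p q" by (rule on_line_between[OF pqne d(1,2) zp])
    then have "z \<in> g \<phi>0 ` closed_segment u v" unfolding p_def q_def
      using chart_segment[OF chA faceD(2)[OF f0(1)] uvf(1,2)] by simp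
    then obtain x' where x': "x' \<in> closed_segment u v" "z = g \<phi>0 x'" by auto
    have x'f: "x' \<in> fst \<phi>0" "x' \<in> fst \<psi>0" using x' f0 uv by auto
    have eA: "g \<psi> x = g \<phi>0 x'" using x'(2) z_def by simp
    have xx: "x = x'" using developedD(7)[OF A(1) \<psi>(1) A(2) \<psi>(2) x'f(1) eA] .
    have lA: "(\<psi>, \<phi>0) \<in> (adj U {x} A)\<^sup>*" using developedD(8)[OF A(1) \<psi>(1) A(2) \<psi>(2)] x'f(1) eA xx by simp
    have eB: "k \<omega> y = k \<psi>0 x'" using x' z_def eq seg_agree by simp
    have yx: "y = x'" using developedD(7)[OF B(1) \<omega>(1) B(2) \<omega>(2) x'f(2) eB] .
    have lB: "(\<omega>, \<psi>0) \<in> (adj U {x} B)\<^sup>*" using developedD(8)[OF B(1) \<omega>(1) B(2) \<omega>(2)] x'f(2) eB xx yx by simp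
    have sub: "U \<subseteq> insert e0 U" by auto
    have 1: "(\<psi>, \<phi>0) \<in> (adj (insert e0 U) {x} faces)\<^sup>*" by (rule adj_rtrancl_mono[OF AF sub order_refl lA])
    have 2: "(\<psi>0, \<omega>) \<in> (adj (insert e0 U) {x} faces)\<^sup>*"
      by (rule adj_rtrancl_sym[OF adj_rtrancl_mono[OF BF sub order_refl lB]])
    have "(\<phi>0, \<psi>0) \<in> adj (insert e0 U) {x} faces" unfolding adj_def using f0 fp(1) x' xx uv(2) by auto
    then have "(\<psi>, \<psi>0) \<in> (adj (insert e0 U) {x} faces)\<^sup>*" using 1 by (meson rtrancl.rtrancl_into_rtrancl)
    then show ?thesis using 2 xx yx by (meson rtrancl_trans)
  qed
  define G where "G \<omega> = (if \<omega> \<in> A then g \<omega> else k \<omega>)" for \<omega>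
  have GA: "G \<omega> = g \<omega>" if "\<omega> \<in> A" for \<omega> using that by (simp add: G_def)
  have GB: "G \<omega> = k \<omega>" if "\<omega> \<in> B" for \<omega>
    using that AB[of \<omega>] unfolding G_def by meson
  have d0: "d \<noteq> 0" using d(1) by auto
  have "g \<phi>0 ` fst \<phi>0 \<subseteq> region A g" unfolding region_def using A(2) by blast
  then have "g \<phi>0 ` fst \<phi>0 \<subseteq> {z. d \<bullet> z \<le> d \<bullet> p}" using d(3) by (force simp: inner_diff_right)
  then have i1: "interior (g \<phi>0 ` fst \<phi>0) \<subseteq> {z. d \<bullet> z < d \<bullet> p}"
    using interior_mono interior_halfspace_le[OF d0] by metis
  have "k \<psi>0 ` fst \<psi>0 \<subseteq> {z. d \<bullet> z \<ge> d \<bullet> p}" using h1(4) B(3) by (force simp: inner_diff_right)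
  then have i2: "interior (k \<psi>0 ` fst \<psi>0) \<subseteq> {z. d \<bullet> z > d \<bullet> p}"
    using interior_mono interior_halfspace_ge[OF d0] by metis
  have int0: "interior (g \<phi>0 ` fst \<phi>0) \<inter> interior (k \<psi>0 ` fst \<psi>0) = {}" using i1 i2 by force
  have iso: "dist (G \<phi> x) (G \<phi> y) = dist x y" if "\<phi> \<in> faces" "x \<in> fst \<phi>" "y \<in> fst \<phi>" for \<phi> x y
  proof -
    have "chart (fst \<phi>) (G \<phi>)"
      using cover[OF that(1)] developedD(2)[OF A(1), of \<phi>] developedD(2)[OF B(1), of \<phi>] GA GB by metis
    then show ?thesis using chart_dist that by blast
  qed
  have glue: "(\<forall>x\<in>e. G \<phi> x = G \<psi> x) \<and> interior (G \<phi> ` fst \<phi>) \<inter> interior (G \<psi> ` fst \<psi>) = {}"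
    if e: "e \<in> insert e0 U" and \<phi>: "\<phi> \<in> faces" "\<psi> \<in> faces" "\<phi> \<noteq> \<psi>" "e \<subseteq> fst \<phi>" "e \<subseteq> fst \<psi>" for e \<phi> \<psi>
  proof (cases "e = e0")
    case True
    then have "\<phi> \<in> {\<phi>0, \<psi>0}" "\<psi> \<in> {\<phi>0, \<psi>0}" using fp(2) \<phi> by blast+
    then have "\<phi> = \<phi>0 \<and> \<psi> = \<psi>0 \<or> \<phi> = \<psi>0 \<and> \<psi> = \<phi>0" using \<phi>(3) by auto
    moreover have "\<forall>x\<in>e. g \<phi>0 x = k \<psi>0 x" using seg_agree True uv(2) by simp
    ultimately show ?thesis using int0 GA[OF A(2)] GB[OF B(2)] by auto
  next
    case False
    then have eU: "e \<in> U" using e by simp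
    show ?thesis
    proof (cases "\<phi> \<in> A")
      case True
      then have "\<psi> \<in> A" using A(3)[OF True \<phi>(2) eU \<phi>(4,5)] by simp
      then show ?thesis using developedD(4,5)[OF A(1) eU True _ \<phi>(3,4,5)] GA True by simp
    next
      case False
      then have B1: "\<phi> \<in> B" using cover \<phi> by blast
      then have "\<psi> \<in> B" using B(4)[OF B1 \<phi>(2) eU \<phi>(4,5)] by simp
      then show ?thesis using developedD(4,5)[OF B(1) eU B1 _ \<phi>(3,4,5)] GB B1 by simp
    qed
  qed
  have inj: "x = y \<and> (\<phi>, \<psi>) \<in> (adj (insert e0 U) {x} faces)\<^sup>*"
    if \<phi>: "\<phi> \<in> faces" "\<psi> \<in> faces" "x \<in> fst \<phi>" "y \<in> fst \<psi>" "G \<phi> x = G \<psi> y" for \<phi> \<psi> x y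
  proof -
    have sub: "U \<subseteq> insert e0 U" by auto
    consider "\<phi> \<in> A" "\<psi> \<in> A" | "\<phi> \<in> A" "\<psi> \<in> B" | "\<phi> \<in> B" "\<psi> \<in> A" | "\<phi> \<in> B" "\<psi> \<in> B"
      using cover[OF \<phi>(1)] cover[OF \<phi>(2)] by blast
    then show ?thesis
    proof cases
      case 1
      then have eq: "g \<phi> x = g \<psi> y" using \<phi>(5) GA by simp
      have xy: "x = y" using developedD(7)[OF A(1) 1 \<phi>(3,4) eq] .
      have "(\<phi>, \<psi>) \<in> (adj U {x} A)\<^sup>*" using developedD(8)[OF A(1) 1 \<phi>(3)] \<phi>(4) eq xy by simp
      then show ?thesis using adj_rtrancl_mono[OF AF sub order_refl] xy by blast
    next
      case 2
      then have eq: "g \<phi> x = k \<psi> y" using \<phi>(5) GA GB by simp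
      show ?thesis by (rule meet[OF 2(1) \<phi>(3) 2(2) \<phi>(4) eq])
    next
      case 3
      then have "g \<psi> y = k \<phi> x" using \<phi>(5) GA GB by simp
      from meet[OF 3(2) \<phi>(4) 3(1) \<phi>(3) this]
      have yx: "y = x" and m: "(\<psi>, \<phi>) \<in> (adj (insert e0 U) {y} faces)\<^sup>*" by blast+
      show ?thesis using adj_rtrancl_sym[OF m] unfolding yx by simp
    next
      case 4
      then have eq: "k \<phi> x = k \<psi> y" using \<phi>(5) GB by simp
      have xy: "x = y" using developedD(7)[OF B(1) 4 \<phi>(3,4) eq] .
      have "(\<phi>, \<psi>) \<in> (adj U {x} B)\<^sup>*" using developedD(8)[OF B(1) 4 \<phi>(3)] \<phi>(4) eq xy by simp
      then show ?thesis using adj_rtrancl_mono[OF BF sub order_refl] xy by blast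
    qed
  qed
  have eu: "edge_unfolding P T G"
    unfolding edge_unfolding_def T(1) uncut_adj_eq[OF T(1)]
  proof (intro conjI ballI impI; (elim conjE)?)
    show "spanning_tree P T" by (rule T(2))
    show "dist (G \<phi> x) (G \<phi> y) = dist x y" if "\<phi> \<in> faces" "x \<in> fst \<phi>" "y \<in> fst \<phi>" for \<phi> x y
      by (rule iso[OF that])
    show "(\<phi>, \<psi>) \<in> (adj (insert e0 U) {} faces)\<^sup>*" if "\<phi> \<in> faces" "\<psi> \<in> faces" for \<phi> \<psi>
      by (rule conn[OF that])
    fix e \<phi> \<psi> assume a: "e \<in> insert e0 U" "\<phi> \<in> faces" "\<psi> \<in> faces" "\<phi> \<noteq> \<psi>" "e \<subseteq> fst \<phi>" "e \<subseteq> fst \<psi>"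
    show "interior (G \<phi> ` fst \<phi>) \<inter> interior (G \<psi> ` fst \<psi>) = {}" using glue[OF a] by (rule conjunct2)
    show "G \<phi> x = G \<psi> x" if "x \<in> e" for x using glue[OF a, THEN conjunct1] that by (rule bspec)
  qed
  moreover have "is_net P T G"
    unfolding is_net_def uncut_adj_eq[OF T(1)]
  proof (intro conjI[OF eu] ballI impI)
    fix \<phi> \<psi> x y assume "\<phi> \<in> faces" "\<psi> \<in> faces" "x \<in> fst \<phi>" "y \<in> fst \<psi>" "G \<phi> x = G \<psi> y"
    then show "x = y \<and> (\<phi>, \<psi>) \<in> (adj (insert e0 U) {x} faces)\<^sup>*" by (rule inj)
  qed
  ultimately show ?thesis using that by blast
qed

end

section \<open>The circuit without one edge as the cut tree\<close>

lemma side_adj_eq: "side_adj P vs v = adj (poly_edges P - circuit_edges vs) {v} (surf_faces P)"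
  unfolding side_adj_def adj_def by auto

locale hamiltonian =
  fixes P :: "(real^3) set" and Q :: "(real^3) list"
  assumes polyP: "polytope P" and Q: "ham_circuit P Q"
begin

text \<open>The circuit edge that stays uncut and plays the role of \<open>e0\<close>; it joins the
  last vertex of the list to the first, so that the cut follows the list order.\<close>

definition closing :: "(real^3) set" where "closing = closed_segment (last Q) (hd Q)"

definition path_edges :: "(real^3) set set" where "path_edges = circuit_edges Q - {closing}"

lemma length_Q: "3 \<le> length Q" and distinct_Q: "distinct Q" and set_Q: "set Q = poly_vertices P"
  using Q by (auto simp: ham_circuit_def)

lemma Q_nonempty: "Q \<noteq> []" using length_Q by auto

lemma segment_eq: "closed_segment a b = closed_segment c d \<longleftrightarrow> {a, b} = {c, d}" for a b c d :: "real^3"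
  by (rule closed_segment_eq)

lemma nth_eq: "i < length Q \<Longrightarrow> j < length Q \<Longrightarrow> Q ! i = Q ! j \<longleftrightarrow> i = j"
  using distinct_Q by (rule nth_eq_iff_index_eq)

lemma closing_eq: "closing = closed_segment (Q ! (length Q - 1)) (Q ! 0)"
  unfolding closing_def using Q_nonempty by (simp add: last_conv_nth hd_conv_nth)

lemma circuit_edges_poly: "circuit_edges Q \<subseteq> poly_edges P"
  using Q unfolding ham_circuit_def circuit_edges_def by auto

lemma last_index_mod: "(length Q - 1 + 1) mod length Q = 0"
proof -
  have "length Q - 1 + 1 = length Q" using length_Q by simp
  then show ?thesis by simp
qed

lemma closing_circuit: "closing \<in> circuit_edges Q"
proof -
  have "closing = closed_segment (Q ! (length Q - 1)) (Q ! ((length Q - 1 + 1) mod length Q)) \<and> length Q - 1 < length Q"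
    unfolding last_index_mod closing_eq using length_Q by auto
  then show ?thesis unfolding circuit_edges_def by blast
qed

lemma path_edges_eq: "path_edges = {closed_segment (Q ! i) (Q ! Suc i) | i. Suc i < length Q}"
proof (intro set_eqI iffI)
  fix e assume "e \<in> path_edges"
  then obtain i where i: "i < length Q" "e = closed_segment (Q ! i) (Q ! ((i + 1) mod length Q))" "e \<noteq> closing"
    unfolding path_edges_def circuit_edges_def by auto
  have "i \<noteq> length Q - 1"
  proof
    assume "i = length Q - 1"
    then have "(i + 1) mod length Q = 0" using last_index_mod by simp
    then show False using i \<open>i = length Q - 1\<close> unfolding closing_eq by simp
  qed
  then have "Suc i < length Q" using i by simp
  then show "e \<in> {closed_segment (Q ! i) (Q ! Suc i) | i. Suc i < length Q}" using i by auto
next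
  fix e assume "e \<in> {closed_segment (Q ! i) (Q ! Suc i) | i. Suc i < length Q}"
  then obtain i where i: "Suc i < length Q" "e = closed_segment (Q ! i) (Q ! Suc i)" by blast
  then have "e = closed_segment (Q ! i) (Q ! ((i + 1) mod length Q))" by simp
  then have "e \<in> circuit_edges Q" unfolding circuit_edges_def using i(1) by (intro CollectI exI[of _ i]) auto
  moreover have "e \<noteq> closing"
  proof
    assume "e = closing"
    then have "{Q ! i, Q ! Suc i} = {Q ! (length Q - 1), Q ! 0}" using i(2) closing_eq segment_eq by metis
    moreover have "Q ! Suc i \<noteq> Q ! 0" using nth_eq[of "Suc i" 0] i(1) Q_nonempty by auto
    ultimately have "Q ! Suc i = Q ! (length Q - 1)" "Q ! i = Q ! 0" by (auto simp: doubleton_eq_iff)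
    then have "Suc i = length Q - 1" "i = 0" using nth_eq[of "Suc i" "length Q - 1"] nth_eq[of i 0] i(1) length_Q Q_nonempty by auto
    then show False using length_Q by simp
  qed
  ultimately show "e \<in> path_edges" unfolding path_edges_def by blast
qed

lemma path_edge_index:
  assumes "closed_segment a b \<in> path_edges" "i < length Q" "a = Q ! i"
  shows "i \<noteq> 0 \<and> b = Q ! (i - 1) \<or> Suc i < length Q \<and> b = Q ! Suc i"
proof -
  obtain j where j: "Suc j < length Q" "closed_segment a b = closed_segment (Q ! j) (Q ! Suc j)"
    using assms(1) unfolding path_edges_eq by blast
  then have "{a, b} = {Q ! j, Q ! Suc j}" using segment_eq by blast
  then consider "a = Q ! j" "b = Q ! Suc j" | "a = Q ! Suc j" "b = Q ! j" by (auto simp: doubleton_eq_iff)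
  then show ?thesis
  proof cases
    case 1
    then have "i = j" using nth_eq[of i j] assms j by auto
    then show ?thesis using 1 j by auto
  next
    case 2
    then have "i = Suc j" using nth_eq[of i "Suc j"] assms j by auto
    then show ?thesis using 2 j by auto
  qed
qed

lemma path_connected: "u \<in> poly_vertices P \<Longrightarrow> v \<in> poly_vertices P \<Longrightarrow> (u, v) \<in> (tree_link path_edges)\<^sup>*"
proof -
  assume uv: "u \<in> poly_vertices P" "v \<in> poly_vertices P"
  have step: "(Q ! i, Q ! Suc i) \<in> tree_link path_edges" "(Q ! Suc i, Q ! i) \<in> tree_link path_edges" if "Suc i < length Q" for i
    unfolding tree_link_def path_edges_eq using that by (auto simp: closed_segment_commute[of "Q ! Suc i"])
  have 0: "(Q ! 0, Q ! i) \<in> (tree_link path_edges)\<^sup>*" "(Q ! i, Q ! 0) \<in> (tree_link path_edges)\<^sup>*" if "i < length Q" for i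
    using that
  proof (induction i)
    case (Suc i)
    { case 1 show ?case using Suc(1) step(1)[OF 1] 1 by (meson Suc_lessD rtrancl.rtrancl_into_rtrancl) }
    { case 2 show ?case using Suc(2) step(2)[OF 2] 2 by (meson Suc_lessD converse_rtrancl_into_rtrancl) }
  qed auto
  obtain i j where "i < length Q" "u = Q ! i" "j < length Q" "v = Q ! j"
    using uv set_Q by (metis in_set_conv_nth)
  then show ?thesis using 0 by (meson rtrancl_trans)
qed

text \<open>In a cycle along path edges, the vertex which comes first on the path would have its successor on the path as both neighbours.\<close>
lemma path_acyclic:
  assumes cs: "distinct cs" "3 \<le> length cs" "\<forall>i < length cs. closed_segment (cs ! i) (cs ! ((i + 1) mod length cs)) \<in> path_edges"
  shows False
proof -
  let ?n = "length cs"
  have inQ: "\<exists>j<length Q. cs ! i = Q ! j" if "i < ?n" for i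
  proof -
    have "closed_segment (cs ! i) (cs ! ((i + 1) mod ?n)) \<in> path_edges" using cs(3) that by blast
    then obtain j where j: "Suc j < length Q" "{cs ! i, cs ! ((i + 1) mod ?n)} = {Q ! j, Q ! Suc j}"
      unfolding path_edges_eq using segment_eq by blast
    then have "cs ! i = Q ! j \<or> cs ! i = Q ! Suc j" by (auto simp: doubleton_eq_iff)
    then show ?thesis using j(1) Suc_lessD by blast
  qed
  then obtain idx where idx: "\<And>i. i < ?n \<Longrightarrow> idx i < length Q \<and> cs ! i = Q ! idx i" by metis
  have "0 \<in> {..<?n}" using cs(2) by auto
  then have "idx ` {..<?n} \<noteq> {}" by blast
  then have "Min (idx ` {..<?n}) \<in> idx ` {..<?n}" by (intro Min_in) auto
  then obtain m where m: "m < ?n" "idx m = Min (idx ` {..<?n})" by auto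
  have mn: "idx m \<le> idx i" if "i < ?n" for i unfolding m(2) using that by simp
  have nb: "cs ! i = Q ! Suc (idx m)" if i: "i < ?n" "closed_segment (cs ! m) (cs ! i) \<in> path_edges" for i
  proof -
    have "idx m \<noteq> 0 \<and> cs ! i = Q ! (idx m - 1) \<or> Suc (idx m) < length Q \<and> cs ! i = Q ! Suc (idx m)"
      using path_edge_index[OF i(2), of "idx m"] idx[OF m(1)] by blast
    moreover have "\<not> (idx m \<noteq> 0 \<and> cs ! i = Q ! (idx m - 1))"
    proof
      assume a: "idx m \<noteq> 0 \<and> cs ! i = Q ! (idx m - 1)"
      then have "idx i = idx m - 1" using nth_eq[of "idx i" "idx m - 1"] idx[OF i(1)] idx[OF m(1)] by auto
      then show False using mn[OF i(1)] a by auto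
    qed
    ultimately show ?thesis by blast
  qed
  \<comment> \<open>The two cyclic neighbours of m, which differ because a cycle has at least three
    vertices.\<close>
  define nx where "nx = (m + 1) mod ?n"
  define pr where "pr = (if m = 0 then ?n - 1 else m - 1)"
  have n0: "0 < ?n" using cs(2) by linarith
  have nx: "nx < ?n" unfolding nx_def using n0 by simp
  have pr: "pr < ?n" "(pr + 1) mod ?n = m" unfolding pr_def using n0 m(1) by auto
  have "cs ! nx = Q ! Suc (idx m)" using nb[OF nx] cs(3) m(1) unfolding nx_def by blast
  moreover have "closed_segment (cs ! m) (cs ! pr) \<in> path_edges"
    using cs(3)[rule_format, OF pr(1)] pr(2) by (simp add: closed_segment_commute)
  then have "cs ! pr = Q ! Suc (idx m)" using nb[OF pr(1)] by blast
  ultimately have "nx = pr" using nth_eq_iff_index_eq[OF cs(1) nx pr(1)] by simp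
  moreover have "nx = (if m = ?n - 1 then 0 else m + 1)" unfolding nx_def using m(1) Suc_pred[OF n0] by auto
  ultimately show False unfolding pr_def using cs(2) m(1) by (auto split: if_splits)
qed

lemma spanning_path: "spanning_tree P path_edges"
  unfolding spanning_tree_def
proof (intro conjI)
  show "path_edges \<subseteq> poly_edges P" using circuit_edges_poly unfolding path_edges_def by blast
  show "\<forall>u\<in>poly_vertices P. \<forall>v\<in>poly_vertices P. (u, v) \<in> (tree_link path_edges)\<^sup>*" using path_connected by blast
  show "\<not> (\<exists>cs. distinct cs \<and> 3 \<le> length cs \<and>
    (\<forall>i<length cs. closed_segment (cs ! i) (cs ! ((i + 1) mod length cs)) \<in> path_edges))" using path_acyclic by blast
qed

lemma uncut_edges: "poly_edges P - path_edges = insert closing (poly_edges P - circuit_edges Q)"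
  unfolding path_edges_def using closing_circuit circuit_edges_poly by blast

end

lemma faces3_eq:
  assumes "aff_dim P = 3"
  shows "surf_faces P = (\<lambda>F. (F, True)) ` {F. F face_of P \<and> aff_dim F = 2}"
  using assms by (auto simp: surf_faces_def)

text \<open>Induction along the circuit. Around \<open>Q ! i\<close>,
  \<open>facets_around_vertex\<close> avoids the edge to the next vertex. The edge to the previous
  vertex may be crossed, but its facets also contain \<open>Q ! (i - 1)\<close>, where the induction
  hypothesis joins them off the cut; at the start of the list that edge is \<open>closing\<close>,
  which is not cut. The facets at successive vertices are then connected through a facet on their
  common edge.\<close>

lemma hamiltonian_dual_connected:
  assumes "polytope P" "aff_dim P = 3" "ham_circuit P Q"
    and \<phi>: "\<phi> \<in> surf_faces P" "\<psi> \<in> surf_faces P"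
  shows "(\<phi>, \<psi>) \<in> (adj (poly_edges P - hamiltonian.path_edges Q) {} (surf_faces P))\<^sup>*"
proof -
  interpret p: polyhedron3 P by unfold_locales (use assms in auto)
  interpret q: hamiltonian P Q by unfold_locales (use assms in auto)
  let ?W = "poly_edges P - q.path_edges"
  let ?R = "adj ?W {} (surf_faces P)"
  have faces: "surf_faces P = (\<lambda>F. (F, True)) ` p.facets"
    using faces3_eq[OF assms(2)] unfolding p.facets_def .
  have around: "\<forall>F\<in>p.facets. \<forall>G\<in>p.facets. Q ! i \<in> F \<longrightarrow> Q ! i \<in> G \<longrightarrow> ((F, True), (G, True)) \<in> ?R\<^sup>*"
    if "i < length Q" for i
    using that
  proof (induction i rule: less_induct)
    case (less i)
    \<comment> \<open>For the last index this is the first vertex of the list, and the edge avoided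
      is \<open>closing\<close>.\<close>
    define x0 where "x0 = Q ! ((i + 1) mod length Q)"
    have "closed_segment (Q ! i) x0 \<in> circuit_edges Q" unfolding x0_def circuit_edges_def using less.prems by blast
    then have x0: "x0 \<in> p.nbr (Q ! i)" using q.circuit_edges_poly unfolding p.nbr_def by blast
    have hop: "((G, True), (G', True)) \<in> ?R\<^sup>*"
      if G: "G \<in> p.facets" "G' \<in> p.facets" and x: "x \<in> p.nbr (Q ! i) - {x0}" "{Q ! i, x} \<subseteq> G \<inter> G'" for G G' x
    proof (cases "closed_segment (Q ! i) x \<in> q.path_edges")
      case True
      have "\<not> (Suc i < length Q \<and> x = Q ! Suc i)"
      proof
        assume "Suc i < length Q \<and> x = Q ! Suc i"
        then have "x = x0" unfolding x0_def by simp
        then show False using x by blast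
      qed
      then have i: "i \<noteq> 0" "x = Q ! (i - 1)" using q.path_edge_index[OF True less.prems refl] by auto
      have "i - 1 < i" "i - 1 < length Q" using i(1) less.prems by auto
      from less.IH[OF this] show ?thesis using G x(2) i(2) by blast
    next
      case False
      then have W: "closed_segment (Q ! i) x \<in> ?W" using x unfolding p.nbr_def by blast
      have sub: "closed_segment (Q ! i) x \<subseteq> G" "closed_segment (Q ! i) x \<subseteq> G'"
        using p.segment_subset_facet G x(2) by auto
      show ?thesis
      proof (cases "G = G'")
        case False
        then have "((G, True), (G', True)) \<in> ?R" unfolding adj_def using W sub G faces by auto
        then show ?thesis by blast
      qed simp
    qed
    show ?case
    proof (intro ballI impI)
      fix F G assume FG: "F \<in> p.facets" "G \<in> p.facets" "Q ! i \<in> F" "Q ! i \<in> G"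
      from p.facets_around_vertex[OF x0 FG(1,3,2,4)]
      show "((F, True), (G, True)) \<in> ?R\<^sup>*"
      proof (induction rule: rtrancl_induct)
        case (step G G')
        then obtain x where "G \<in> p.facets" "G' \<in> p.facets" "x \<in> p.nbr (Q ! i) - {x0}" "{Q ! i, x} \<subseteq> G \<inter> G'" by blast
        then have "((G, True), (G', True)) \<in> ?R\<^sup>*" by (rule hop)
        then show ?case using step.IH by (rule rtrancl_trans[rotated])
      qed simp
    qed
  qed
  have along: "\<forall>F\<in>p.facets. \<forall>G\<in>p.facets. Q ! 0 \<in> F \<longrightarrow> Q ! i \<in> G \<longrightarrow> ((F, True), (G, True)) \<in> ?R\<^sup>*"
    if "i < length Q" for i
    using that
  proof (induction i)
    case 0
    then show ?case using around by blast
  next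
    case (Suc i)
    have "closed_segment (Q ! i) (Q ! Suc i) \<in> q.path_edges" unfolding q.path_edges_eq using Suc.prems by blast
    then have "closed_segment (Q ! i) (Q ! Suc i) \<in> poly_edges P"
      using q.circuit_edges_poly unfolding q.path_edges_def by blast
    then obtain H H' where "{F \<in> p.facets. closed_segment (Q ! i) (Q ! Suc i) \<subseteq> F} = {H, H'}" by (rule p.edge_two_facets)
    then have "H \<in> p.facets" "closed_segment (Q ! i) (Q ! Suc i) \<subseteq> H" by blast+
    then have H: "H \<in> p.facets" "Q ! i \<in> H" "Q ! Suc i \<in> H" by auto
    show ?case
    proof (intro ballI impI)
      fix F G assume FG: "F \<in> p.facets" "G \<in> p.facets" "Q ! 0 \<in> F" "Q ! Suc i \<in> G"
      have "((F, True), (H, True)) \<in> ?R\<^sup>*" using Suc.IH Suc.prems FG H by auto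
      moreover have "((H, True), (G, True)) \<in> ?R\<^sup>*" using around[OF Suc.prems] FG H by blast
      ultimately show "((F, True), (G, True)) \<in> ?R\<^sup>*" by (rule rtrancl_trans)
    qed
  qed
  have vertex: "\<exists>i<length Q. Q ! i \<in> F" if F: "F \<in> p.facets" for F
  proof -
    have "F \<noteq> {}" using p.facetD(2)[OF F] by auto
    then obtain x where "x extreme_point_of F"
      using extreme_point_exists_convex polytope_imp_compact[OF p.facetD(3)[OF F]] p.facetD(4)[OF F] by blast
    then have "x \<in> F" "x \<in> poly_vertices P"
      using extreme_point_of_face[OF p.facetD(1)[OF F]] by (auto simp: poly_vertices_def)
    then show ?thesis using q.set_Q by (metis in_set_conv_nth)
  qed
  obtain F G where FG: "F \<in> p.facets" "G \<in> p.facets" "\<phi> = (F, True)" "\<psi> = (G, True)" using \<phi> unfolding faces by blast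
  obtain i j where ij: "i < length Q" "Q ! i \<in> F" "j < length Q" "Q ! j \<in> G" using vertex FG by blast
  have "Suc 0 < length Q" using q.length_Q by linarith
  then have "closed_segment (Q ! 0) (Q ! Suc 0) \<in> q.path_edges" unfolding q.path_edges_eq by blast
  then have "closed_segment (Q ! 0) (Q ! 1) \<in> poly_edges P"
    using q.circuit_edges_poly unfolding q.path_edges_def by auto
  then obtain H H' where "{F \<in> p.facets. closed_segment (Q ! 0) (Q ! 1) \<subseteq> F} = {H, H'}" by (rule p.edge_two_facets)
  then have "H \<in> p.facets" "closed_segment (Q ! 0) (Q ! 1) \<subseteq> H" by blast+
  then have H: "H \<in> p.facets" "Q ! 0 \<in> H" by auto
  have "((H, True), (F, True)) \<in> ?R\<^sup>*" "((H, True), (G, True)) \<in> ?R\<^sup>*" using along ij FG H by blast+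
  then show ?thesis unfolding FG using adj_rtrancl_sym rtrancl_trans by metis
qed

text \<open>The condition on even edge sets comes from \<open>even_edge_set_meets_spanning\<close>,
  with the cut path as the spanning set: the uncut edges avoid it, and it joins all
  vertices.\<close>

lemma slit_surface_solid:
  assumes P: "polytope P" "aff_dim P = 3" and Q: "hamiltonian_quasigeodesic P Q"
  shows "slit_surface P (poly_edges P - circuit_edges Q) (hamiltonian.closing Q)"
    and "v \<in> poly_vertices P \<Longrightarrow> (\<Sum>\<phi> | \<phi> \<in> surf_faces P \<and> v \<in> fst \<phi>. face_angle (fst \<phi>) v) < 2 * pi"
proof -
  have ham: "ham_circuit P Q" using Q by (simp add: hamiltonian_quasigeodesic_def)
  interpret p: polyhedron3 P by unfold_locales (use P in auto)
  interpret q: hamiltonian P Q by unfold_locales (use P ham in auto)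
  have faces: "surf_faces P = (\<lambda>F. (F, True)) ` p.facets"
    using faces3_eq[OF P(2)] unfolding p.facets_def .
  let ?U = "poly_edges P - circuit_edges Q"
  show "slit_surface P ?U q.closing"
  proof
    show "polytope P" by (rule P(1))
    show "fst \<phi> face_of P" "aff_dim (fst \<phi>) = 2" if "\<phi> \<in> surf_faces P" for \<phi>
      using that p.facetD unfolding faces by auto
    show "finite (surf_faces P)" unfolding faces using p.finite_facets by simp
    show "insert q.closing ?U \<subseteq> poly_edges P" using q.closing_circuit q.circuit_edges_poly by blast
    show "q.closing \<notin> ?U" using q.closing_circuit by blast
    show "\<exists>\<phi> \<psi>. \<phi> \<noteq> \<psi> \<and> {\<omega> \<in> surf_faces P. e \<subseteq> fst \<omega>} = {\<phi>, \<psi>}" if e: "e \<in> poly_edges P" for e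
    proof -
      obtain F G where FG: "F \<noteq> G" "{F \<in> p.facets. e \<subseteq> F} = {F, G}" by (rule p.edge_two_facets[OF e])
      have "{\<omega> \<in> surf_faces P. e \<subseteq> fst \<omega>} = (\<lambda>F. (F, True)) ` {F \<in> p.facets. e \<subseteq> F}" unfolding faces by auto
      also have "\<dots> = {(F, True), (G, True)}" unfolding FG(2) by simp
      finally have "{\<omega> \<in> surf_faces P. e \<subseteq> fst \<omega>} = {(F, True), (G, True)}" .
      moreover have "(F, True) \<noteq> (G, True)" using FG(1) by simp
      ultimately show ?thesis by (intro exI conjI)
    qed
    show "C = {}" if C: "C \<subseteq> insert q.closing ?U" and ev: "\<And>\<phi>. \<phi> \<in> surf_faces P \<Longrightarrow> even (card {e \<in> C. e \<subseteq> fst \<phi>})" for C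
    proof (rule p.even_edge_set_meets_spanning[of C q.path_edges])
      show "C \<subseteq> poly_edges P" "C \<inter> q.path_edges = {}" using C q.uncut_edges by blast+
      show "even (card {e \<in> C. e \<subseteq> F})" if "F \<in> p.facets" for F
      proof -
        have "(F, True) \<in> surf_faces P" unfolding faces using that by blast
        from ev[OF this] show ?thesis by simp
      qed
      show "q.path_edges \<subseteq> poly_edges P" using q.circuit_edges_poly unfolding q.path_edges_def by blast
    qed (rule q.path_connected)
    show "(\<Sum>\<psi> | \<psi> \<in> surf_faces P \<and> v \<in> fst \<psi> \<and> (\<phi>, \<psi>) \<in> (adj ?U {v} (surf_faces P))\<^sup>*. face_angle (fst \<psi>) v) \<le> pi"
      if "\<phi> \<in> surf_faces P" "v \<in> poly_vertices P" "v \<in> fst \<phi>" for \<phi> v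
      using Q that unfolding hamiltonian_quasigeodesic_def side_angle_def side_adj_eq by blast
  qed
  show "(\<Sum>\<phi> | \<phi> \<in> surf_faces P \<and> v \<in> fst \<phi>. face_angle (fst \<phi>) v) < 2 * pi" if v: "v \<in> poly_vertices P"
  proof -
    have "{\<phi>. \<phi> \<in> surf_faces P \<and> v \<in> fst \<phi>} = (\<lambda>F. (F, True)) ` {F. F \<in> p.facets \<and> v \<in> F}" unfolding faces by auto
    then have "(\<Sum>\<phi> | \<phi> \<in> surf_faces P \<and> v \<in> fst \<phi>. face_angle (fst \<phi>) v) = (\<Sum>F | F \<in> p.facets \<and> v \<in> F. face_angle F v)"
      by (simp only:) (simp add: sum.reindex inj_on_def)
    then show ?thesis using p.face_angle_sum_less v by (simp add: poly_vertices_def)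
  qed
qed

text \<open>At each vertex of a polygon there are exactly two edges, and the circuit, having at
  least three vertices, uses two different ones there.\<close>

lemma circuit_edges_polygon:
  assumes P: "polytope P" "aff_dim P = 2" and Q: "ham_circuit P Q"
  shows "circuit_edges Q = poly_edges P"
proof
  interpret q: hamiltonian P Q by unfold_locales (use P Q in auto)
  show "circuit_edges Q \<subseteq> poly_edges P" by (rule q.circuit_edges_poly)
  show "poly_edges P \<subseteq> circuit_edges Q"
  proof
    fix e assume e: "e \<in> poly_edges P"
    then obtain x y where xy: "e = closed_segment x y" "x extreme_point_of P"
      using polytope_1_segment[OF P(1), of e] unfolding poly_edges_def by blast
    then have "x \<in> set Q" using q.set_Q by (simp add: poly_vertices_def)
    then obtain i where i: "i < length Q" "x = Q ! i" by (metis in_set_conv_nth)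
    let ?n = "length Q"
    define pr where "pr = (if i = 0 then ?n - 1 else i - 1)"
    have pr: "pr < ?n" "(pr + 1) mod ?n = i" "pr \<noteq> i" "pr \<noteq> (i + 1) mod ?n"
    proof -
      show "pr < ?n" "(pr + 1) mod ?n = i" "pr \<noteq> i" using i(1) q.length_Q unfolding pr_def by auto
      have "(i + 1) mod ?n = (if i = ?n - 1 then 0 else i + 1)" using i(1) q.last_index_mod by auto
      then show "pr \<noteq> (i + 1) mod ?n" using i(1) q.length_Q unfolding pr_def by auto
    qed
    define e1 where "e1 = closed_segment (Q ! i) (Q ! ((i + 1) mod ?n))"
    define e2 where "e2 = closed_segment (Q ! pr) (Q ! i)"
    have c: "e1 \<in> circuit_edges Q" "e2 \<in> circuit_edges Q"
      unfolding e1_def e2_def circuit_edges_def using i(1) pr(1,2) by (blast, metis (mono_tags, lifting) mem_Collect_eq)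
    have "(i + 1) mod ?n < ?n" using i(1) by (intro mod_less_divisor) auto
    then have "Q ! pr \<noteq> Q ! ((i + 1) mod ?n)" "Q ! pr \<noteq> Q ! i" using q.nth_eq pr i by auto
    then have "e1 \<noteq> e2" unfolding e1_def e2_def by (auto simp: closed_segment_eq doubleton_eq_iff)
    then have "card {e1, e2} = 2" by simp
    moreover define N where "N = {e. e face_of P \<and> aff_dim e = 1 \<and> x \<in> e}"
    have "card N = 2" unfolding N_def by (rule polygon_edges_at_vertex[OF P xy(2)])
    moreover have "finite N" unfolding N_def by (rule finite_face_set[OF P(1)])
    moreover have "{e1, e2} \<subseteq> N" using c q.circuit_edges_poly i unfolding N_def poly_edges_def e1_def e2_def by auto
    ultimately have "{e1, e2} = N" by (metis card_subset_eq)
    moreover have "e \<in> N" using e xy unfolding N_def poly_edges_def by auto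
    ultimately show "e \<in> circuit_edges Q" using c by blast
  qed
qed

text \<open>Every edge lies on the circuit, so each copy of \<open>P\<close> is a side of its own
  and \<open>closing\<close> alone joins the two. A nonempty set of uncut edges is
  \<open>{closing}\<close>, which has one edge in each face; the total angle at a vertex is twice an
  angle less than pi.\<close>

lemma slit_surface_flat:
  assumes P: "polytope P" "aff_dim P = 2" and Q: "hamiltonian_quasigeodesic P Q"
  shows "slit_surface P (poly_edges P - circuit_edges Q) (hamiltonian.closing Q)"
    and "v \<in> poly_vertices P \<Longrightarrow> (\<Sum>\<phi> | \<phi> \<in> surf_faces P \<and> v \<in> fst \<phi>. face_angle (fst \<phi>) v) < 2 * pi"
    and "\<phi> \<in> surf_faces P \<Longrightarrow> \<psi> \<in> surf_faces P \<Longrightarrow>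
      (\<phi>, \<psi>) \<in> (adj (poly_edges P - hamiltonian.path_edges Q) {} (surf_faces P))\<^sup>*"
proof -
  have ham: "ham_circuit P Q" using Q by (simp add: hamiltonian_quasigeodesic_def)
  interpret q: hamiltonian P Q by unfold_locales (use P ham in auto)
  have faces: "surf_faces P = {(P, True), (P, False)}" using P by (simp add: surf_faces_def)
  have U: "poly_edges P - circuit_edges Q = {}" using circuit_edges_polygon[OF P ham] by simp
  have sub: "e \<subseteq> P" if "e \<in> poly_edges P" for e using that face_of_imp_subset by (auto simp: poly_edges_def)
  have e0: "q.closing \<in> poly_edges P" using q.closing_circuit q.circuit_edges_poly by blast
  show "slit_surface P (poly_edges P - circuit_edges Q) q.closing"
  proof
    show "polytope P" by (rule P(1))
    show "fst \<phi> face_of P" "aff_dim (fst \<phi>) = 2" if "\<phi> \<in> surf_faces P" for \<phi>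
      using that P face_of_refl[OF polytope_imp_convex[OF P(1)]] unfolding faces by auto
    show "finite (surf_faces P)" unfolding faces by simp
    show "insert q.closing (poly_edges P - circuit_edges Q) \<subseteq> poly_edges P" using e0 by blast
    show "q.closing \<notin> poly_edges P - circuit_edges Q" using q.closing_circuit by blast
    show "\<exists>\<phi> \<psi>. \<phi> \<noteq> \<psi> \<and> {\<omega> \<in> surf_faces P. e \<subseteq> fst \<omega>} = {\<phi>, \<psi>}" if e: "e \<in> poly_edges P" for e
      unfolding faces using sub[OF e] by (intro exI[of _ "(P, True)"] exI[of _ "(P, False)"]) auto
    show "C = {}" if C: "C \<subseteq> insert q.closing (poly_edges P - circuit_edges Q)"
      and ev: "\<And>\<phi>. \<phi> \<in> surf_faces P \<Longrightarrow> even (card {e \<in> C. e \<subseteq> fst \<phi>})" for C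
    proof (rule ccontr)
      assume "C \<noteq> {}"
      then have "C = {q.closing}" using C U by blast
      then have "{e \<in> C. e \<subseteq> fst (P, True)} = {q.closing}" using sub[OF e0] by auto
      then show False using ev[of "(P, True)"] unfolding faces by simp
    qed
    show "(\<Sum>\<psi> | \<psi> \<in> surf_faces P \<and> v \<in> fst \<psi> \<and> (\<phi>, \<psi>) \<in> (adj (poly_edges P - circuit_edges Q) {v} (surf_faces P))\<^sup>*.
        face_angle (fst \<psi>) v) \<le> pi" if "\<phi> \<in> surf_faces P" "v \<in> poly_vertices P" "v \<in> fst \<phi>" for \<phi> v
      using Q that unfolding hamiltonian_quasigeodesic_def side_angle_def side_adj_eq by blast
  qed
  show "(\<Sum>\<phi> | \<phi> \<in> surf_faces P \<and> v \<in> fst \<phi>. face_angle (fst \<phi>) v) < 2 * pi" if v: "v \<in> poly_vertices P"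
  proof -
    have "v extreme_point_of P" "v \<in> P" using v by (auto simp: poly_vertices_def extreme_point_of_def)
    then have "{\<phi>. \<phi> \<in> surf_faces P \<and> v \<in> fst \<phi>} = {(P, True), (P, False)}" unfolding faces by auto
    then show ?thesis using face_angle_bounds[OF P \<open>v extreme_point_of P\<close>] by simp
  qed
  show "(\<phi>, \<psi>) \<in> (adj (poly_edges P - q.path_edges) {} (surf_faces P))\<^sup>*" if "\<phi> \<in> surf_faces P" "\<psi> \<in> surf_faces P"
  proof (cases "\<phi> = \<psi>")
    case False
    have "q.closing \<in> poly_edges P - q.path_edges" using q.uncut_edges by blast
    then have "(\<phi>, \<psi>) \<in> adj (poly_edges P - q.path_edges) {} (surf_faces P)"
      unfolding adj_def using False that sub[OF e0] unfolding faces by auto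
    then show ?thesis by blast
  qed simp
qed

theorem theorem1:
  fixes P :: "(real^3) set" and Q :: "(real^3) list"
  assumes "convex_polyhedron P"
    and "hamiltonian_quasigeodesic P Q"
  shows "\<exists>T g. edge_unfolding P T g \<and> is_net P T g"
proof -
  have P: "polytope P" "aff_dim P = 3 \<or> aff_dim P = 2" using assms(1) by (auto simp: convex_polyhedron_def)
  have ham: "ham_circuit P Q" using assms(2) by (simp add: hamiltonian_quasigeodesic_def)
  interpret q: hamiltonian P Q by unfold_locales (use P ham in auto)
  let ?U = "poly_edges P - circuit_edges Q"
  have slit: "slit_surface P ?U q.closing"
    using P(2) slit_surface_solid(1)[OF P(1) _ assms(2)] slit_surface_flat(1)[OF P(1) _ assms(2)] by blast
  have total: "(\<Sum>\<phi> | \<phi> \<in> surf_faces P \<and> v \<in> fst \<phi>. face_angle (fst \<phi>) v) < 2 * pi" if "v \<in> poly_vertices P" for v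
    using P(2) slit_surface_solid(2)[OF P(1) _ assms(2) that] slit_surface_flat(2)[OF P(1) _ assms(2) that] by blast
  have conn: "(\<phi>, \<psi>) \<in> (adj (insert q.closing ?U) {} (surf_faces P))\<^sup>*"
    if "\<phi> \<in> surf_faces P" "\<psi> \<in> surf_faces P" for \<phi> \<psi>
    using P(2) hamiltonian_dual_connected[OF P(1) _ ham that] slit_surface_flat(3)[OF P(1) _ assms(2) that]
    unfolding q.uncut_edges by blast
  show ?thesis
    by (rule slit_surface.net_exists[OF slit q.uncut_edges q.spanning_path conn total]) blast+
qed

end
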